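(* Consider a fixed design with sampling weights $w_{i,d}\in\{0,1\}$ ($i=1,\dots,M$, $d=1,\dots,n_{\mathrm{exp}}$) providing, for some matrices $H_{i,d}$ and offsets $b_{i,d}$, the linear--Gaussian observation models $$ y_{i,d}=H_{i,d}\,\theta+b_{i,d}+\varepsilon_{i,d},\qquad \varepsilon_{i,d}\sim\mathcal N(0,R_{i,d}),\qquad i=1,\dots,M,\ d=1,\dots,n_{\mathrm{exp}}, $$ with $R_{i,d}$ positive definite, the noises $\varepsilon_{i,d}$ being mutually independent and independent of $\theta\in\mathbb{R}^{n_\theta}$ (the observation $y_{i,d}$ being collected exactly when $w_{i,d}=1$). For a prior $p$ on $\mathbb{R}^{n_\theta}$, let $J_{\mathrm{EIG}}(p)$ be the exact expected information gain and $J_{\mathrm{tilt}}(p)$ the Gaussian tilting objective constructed from $p$ (with a chosen reference point $\theta_{\mathrm{ref}}$), as defined in the context. 1. If the prior is Gaussian, $p_0=\mathcal N(m_0,\Sigma_0)$, then the Gaussian tilting surrogate with $\theta_{\mathrm{ref}}=m_0$ is exact, and $$ J_{\mathrm{tilt}}(p_0)=J_{\mathrm{EIG}}(p_0)=\tfrac12\log\det\bigl(I+\Sigma_0F_M\bigr),\qquad F_M=\sum_{i=1}^M\sum_{d=1}^{n_{\mathrm{exp}}}w_{i,d}\,H_{i,d}^\top R_{i,d}^{-1}H_{i,d}. $$ 2. Let $(p_k)_{k\ge1}$ be a sequence of priors on $\mathbb{R}^{n_\theta}$ with finite second moment such that $p_k\to p_0:=\mathcal N(m_0,\Sigma_0)$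 in the $2$-Wasserstein distance $W_2$. Then, with the reference point $\theta_{\mathrm{ref}}^{(k)}$ used in $J_{\mathrm{tilt}}(p_k)$ set to the mean of $p_k$, one has, for the fixed design, $$ J_{\mathrm{tilt}}(p_k)\xrightarrow[k\to\infty]{}J_{\mathrm{EIG}}(p_0). $$
   Context: For each stage $i$, $y_i$ denotes the block of observations collected at stage $i$, i.e. $(y_{i,d})_{d:\,w_{i,d}=1}$ (sensors with $w_{i,d}=0$ produce a deterministic value carrying no information), and $$ \ell_i(y_i\mid\theta)=\prod_{d:\,w_{i,d}=1}\mathcal N\bigl(y_{i,d};\,H_{i,d}\theta+b_{i,d},\,R_{i,d}\bigr) $$ is its conditional density given $\theta$ (an empty product is $1$, and a stage with no active sensor contributes $0$). The blocks $y_1,\dots,y_M$ are conditionally independent given $\theta$. Exact expected information gain under a prior $p$: $J_{\mathrm{EIG}}(p)$ is the mutual information between $\theta\sim p$ and $y=(y_1,\dots,y_M)$, $$ J_{\mathrm{EIG}}(p)=\mathbb{E}\Bigl[\log\frac{\prod_{i=1}^M\ell_i(y_i\mid\theta)}{\int\prod_{i=1}^M\ell_i(y_i\mid\theta')\,p(d\theta')}\Bigr], $$ the expectation being over $\theta\sim p$ and $y_i\mid\theta\sim\ell_i(\cdot\mid\theta)$. Accumulated Fisher information: $F_0=0$ and $F_i=F_{i-1}+\sum_{d=1}^{n_{\mathrm{exp}}}w_{i,d}\,H_{i,d}^\top R_{i,d}^{-1}H_{i,d}$ for $i=1,\dots,M$. Gaussian tilting objective with reference point $\theta_{\mathrm{ref}}\in\mathbb{R}^{n_\theta}$: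 set $\phi_i(\theta)=\exp\bigl(-\tfrac12(\theta-\theta_{\mathrm{ref}})^\top F_i(\theta-\theta_{\mathrm{ref}})\bigr)$, let $q_i$ be the probability measure $$ q_i(d\theta)=\frac{\phi_i(\theta)\,p(d\theta)}{\int\phi_i(\theta')\,p(d\theta')}, $$ and define $$ J_{\mathrm{tilt}}(p)=\sum_{i=1}^M\mathbb{E}\Bigl[\log\frac{\ell_i(y_i\mid\theta)}{\int\ell_i(y_i\mid\theta')\,q_{i-1}(d\theta')}\Bigr], $$ where in the $i$-th term the expectation is over $\theta\sim q_{i-1}$ and $y_i\mid\theta\sim\ell_i(\cdot\mid\theta)$. $\mathcal N(m,\Sigma)$ is the Gaussian law with mean $m$ and covariance $\Sigma$; $I$ is the $n_\theta\times n_\theta$ identity matrix. *)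

theory Defs
  imports
    "HOL-Probability.Probability"
    "Jordan_Normal_Form.Determinant"
    "Jordan_Normal_Form.Gauss_Jordan_Elimination"
begin

text \<open>
  The parameter lives in \<open>real ^ 'n\<close>. The dimension of an observation may differ from sensor to
  sensor, so an observation of dimension \<open>m\<close> is a function in \<open>nat \<Rightarrow> real\<close> that is looked at on
  \<open>{..<m}\<close> only, and noise covariances are matrices with explicit carrier. The names \<open>det\<close>,
  \<open>$\<close> and \<open>\<bullet>\<close> exist both for such matrices and for \<open>real ^ 'n\<close>; they are qualified where needed.
  Stages and sensors are numbered from 1.
\<close>

record 'n design =
  stages :: nat
  sensors :: nat
  weight :: "nat \<Rightarrow> nat \<Rightarrow> real"
  obs_dim :: "nat \<Rightarrow> nat \<Rightarrow> nat"
  obs_row :: "nat \<Rightarrow> nat \<Rightarrow> nat \<Rightarrow> (real, 'n) Finite_Cartesian_Product.vec"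
    \<comment> \<open>\<open>obs_row D i d j\<close> is the \<open>j\<close>-th row of the matrix \<open>H\<close> of sensor \<open>d\<close> at stage \<open>i\<close>, for \<open>j < obs_dim D i d\<close>\<close>
  offset :: "nat \<Rightarrow> nat \<Rightarrow> nat \<Rightarrow> real"
  noise_cov :: "nat \<Rightarrow> nat \<Rightarrow> real mat"

definition pos_def_mat :: "nat \<Rightarrow> real mat \<Rightarrow> bool" where
  "pos_def_mat m A \<longleftrightarrow> A \<in> carrier_mat m m \<and> transpose_mat A = A \<and>
     (\<forall>v \<in> carrier_vec m. v \<noteq> 0\<^sub>v m \<longrightarrow> scalar_prod v (A *\<^sub>v v) > 0)"

definition mat_inv :: "real mat \<Rightarrow> real mat" where
  \<comment> \<open>only meaningful for invertible matrices\<close>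
  "mat_inv A = the (mat_inverse A)"

definition valid_design :: "'n::finite design \<Rightarrow> bool" where
  "valid_design D \<longleftrightarrow>
     (\<forall>i \<in> {1..stages D}. \<forall>d \<in> {1..sensors D}.
        weight D i d \<in> {0, 1} \<and> pos_def_mat (obs_dim D i d) (noise_cov D i d))"

definition normal_pdf :: "nat \<Rightarrow> (nat \<Rightarrow> real) \<Rightarrow> real mat \<Rightarrow> (nat \<Rightarrow> real) \<Rightarrow> real" where
  "normal_pdf m \<mu> R x =
     (let v = Matrix.vec m (\<lambda>j. x j - \<mu> j)
      in exp (- (scalar_prod v (mat_inv R *\<^sub>v v)) / 2) / sqrt ((2 * pi) ^ m * Determinant.det R))"

definition obs_mean :: "'n::finite design \<Rightarrow> nat \<Rightarrow> nat \<Rightarrow> real ^ 'n \<Rightarrow> nat \<Rightarrow> real" where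
  "obs_mean D i d \<theta> j = inner (obs_row D i d j) \<theta> + offset D i d j"

definition active :: "'n::finite design \<Rightarrow> nat \<Rightarrow> nat set" where
  "active D i = {d \<in> {1..sensors D}. weight D i d = 1}"

text \<open>The dominating (Lebesgue) measures for the block \<open>y\<^sub>i\<close> and for \<open>y = (y\<^sub>1, \<dots>, y\<^sub>M)\<close>.\<close>

definition block_measure :: "'n::finite design \<Rightarrow> nat \<Rightarrow> (nat \<Rightarrow> nat \<Rightarrow> real) measure" where
  "block_measure D i = PiM (active D i) (\<lambda>d. PiM {..<obs_dim D i d} (\<lambda>_. lborel))"

definition obs_measure :: "'n::finite design \<Rightarrow> (nat \<Rightarrow> nat \<Rightarrow> nat \<Rightarrow> real) measure" where
  "obs_measure D = PiM {1..stages D} (block_measure D)"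

definition lik :: "'n::finite design \<Rightarrow> nat \<Rightarrow> (nat \<Rightarrow> nat \<Rightarrow> real) \<Rightarrow> real ^ 'n \<Rightarrow> real" where
  "lik D i y \<theta> =
     (\<Prod>d \<in> active D i. normal_pdf (obs_dim D i d) (obs_mean D i d \<theta>) (noise_cov D i d) (y d))"

definition full_lik :: "'n::finite design \<Rightarrow> (nat \<Rightarrow> nat \<Rightarrow> nat \<Rightarrow> real) \<Rightarrow> real ^ 'n \<Rightarrow> real" where
  "full_lik D y \<theta> = (\<Prod>i = 1..stages D. lik D i (y i) \<theta>)"

text \<open>
  Expected log-ratio of likelihood and evidence under the joint law of \<open>(\<theta>, y)\<close>, where \<open>\<theta>\<close> has
  law \<open>p\<close> and \<open>y\<close> given \<open>\<theta>\<close> has density \<open>L y \<theta>\<close> with respect to \<open>\<mu>\<close>.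
\<close>

definition info_gain ::
    "'y measure \<Rightarrow> ('y \<Rightarrow> real ^ 'n \<Rightarrow> real) \<Rightarrow> (real ^ 'n::finite) measure \<Rightarrow> real" where
  "info_gain \<mu> L p =
     (\<integral>(\<theta>, y). ln (L y \<theta> / (\<integral>\<theta>'. L y \<theta>' \<partial>p))
        \<partial>density (p \<Otimes>\<^sub>M \<mu>) (\<lambda>(\<theta>, y). ennreal (L y \<theta>)))"

definition J_EIG :: "'n::finite design \<Rightarrow> (real ^ 'n) measure \<Rightarrow> real" where
  "J_EIG D p = info_gain (obs_measure D) (full_lik D) p"

definition sensor_info :: "'n::finite design \<Rightarrow> nat \<Rightarrow> nat \<Rightarrow> real ^ 'n ^ 'n" where
  \<comment> \<open>the product \<open>H\<^sup>T R\<^sup>-\<^sup>1 H\<close>, entry by entry\<close>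
  "sensor_info D i d =
     (\<chi> a b. \<Sum>j < obs_dim D i d. \<Sum>k < obs_dim D i d.
        vec_nth (obs_row D i d j) a * mat_inv (noise_cov D i d) $$ (j, k) * vec_nth (obs_row D i d k) b)"

primrec fisher :: "'n::finite design \<Rightarrow> nat \<Rightarrow> real ^ 'n ^ 'n" where
  "fisher D 0 = 0"
| "fisher D (Suc i) =
     fisher D i + (\<Sum>d = 1..sensors D. weight D (Suc i) d *\<^sub>R sensor_info D (Suc i) d)"

definition tilt_weight :: "'n::finite design \<Rightarrow> real ^ 'n \<Rightarrow> nat \<Rightarrow> real ^ 'n \<Rightarrow> real" where
  "tilt_weight D \<theta>ref i \<theta> = exp (- inner (\<theta> - \<theta>ref) (fisher D i *v (\<theta> - \<theta>ref)) / 2)"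

definition tilted ::
    "'n::finite design \<Rightarrow> real ^ 'n \<Rightarrow> (real ^ 'n) measure \<Rightarrow> nat \<Rightarrow> (real ^ 'n) measure" where
  "tilted D \<theta>ref p i =
     density p (\<lambda>\<theta>. ennreal (tilt_weight D \<theta>ref i \<theta> / (\<integral>\<theta>'. tilt_weight D \<theta>ref i \<theta>' \<partial>p)))"

definition J_tilt :: "'n::finite design \<Rightarrow> real ^ 'n \<Rightarrow> (real ^ 'n) measure \<Rightarrow> real" where
  "J_tilt D \<theta>ref p =
     (\<Sum>i = 1..stages D. info_gain (block_measure D i) (lik D i) (tilted D \<theta>ref p (i - 1)))"

definition std_gaussian :: "(real ^ 'n::finite) measure" where
  "std_gaussian = density lborel (\<lambda>z. ennreal (\<Prod>a\<in>UNIV. std_normal_density (vec_nth z a)))"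

text \<open>
  The law of \<open>m + A z\<close> for a standard Gaussian \<open>z\<close> has covariance \<open>A A\<^sup>T\<close>. Every symmetric positive
  semidefinite matrix has this form, so singular covariances are included.
\<close>

definition gaussian_law ::
    "real ^ 'n \<Rightarrow> real ^ 'n ^ 'n \<Rightarrow> (real ^ 'n::finite) measure \<Rightarrow> bool" where
  "gaussian_law m S p \<longleftrightarrow>
     (\<exists>A :: real ^ 'n ^ 'n. A ** Finite_Cartesian_Product.transpose A = S \<and>
        p = distr std_gaussian borel (\<lambda>z. m + A *v z))"

definition prior2 :: "(real ^ 'n::finite) measure \<Rightarrow> bool" where
  \<comment> \<open>Borel probability measures with finite second moment\<close>
  "prior2 p \<longleftrightarrow> prob_space p \<and> sets p = sets borel \<and> integrable p (\<lambda>\<theta>. (norm \<theta>)\<^sup>2)"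

definition couplings ::
    "(real ^ 'n::finite) measure \<Rightarrow> (real ^ 'n) measure \<Rightarrow> ((real ^ 'n) \<times> (real ^ 'n)) measure set" where
  "couplings p q =
     {\<gamma>. sets \<gamma> = sets (borel \<Otimes>\<^sub>M borel) \<and> distr \<gamma> borel fst = p \<and> distr \<gamma> borel snd = q}"

definition wasserstein2 ::
    "(real ^ 'n::finite) measure \<Rightarrow> (real ^ 'n) measure \<Rightarrow> ennreal" where
  "wasserstein2 p q =
     (let c = (INF \<gamma>\<in>couplings p q. \<integral>\<^sup>+(x, y). ennreal ((dist x y)\<^sup>2) \<partial>\<gamma>)
      in if c = \<infinity> then \<infinity> else ennreal (sqrt (enn2real c)))"

end

theory Submission
  imports Defs "HOL-Real_Asymp.Real_Asymp"
begin

text \<open>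
  Every stage likelihood has the form
  \<open>L(y | \<theta>) = h(y) exp (s(y) \<bullet> \<theta> - \<theta> \<bullet> G \<theta> / 2)\<close>, where \<open>G\<close> is the Fisher information of the stage,
  and this form is stable under products. Since \<open>L(\<sqdot> | \<theta>)\<close> integrates to 1 for every \<open>\<theta>\<close>, the
  moment generating function of \<open>s\<close> is known, hence also all its first and second moments.
  With \<open>W(y) = \<integral> exp (s(y) \<bullet> \<theta> - \<theta> \<bullet> G \<theta> / 2) q(d\<theta>)\<close> this gives
  \<open>info_gain = E\<^sub>q (\<theta> \<bullet> G \<theta>) / 2 - E (ln W)\<close>.

  If \<open>q\<close> is a tilt of the law of \<open>m + A z\<close> with \<open>z\<close> standard Gaussian, then \<open>W\<close> is an explicit
  Gaussian integral and the gain is half the increment of \<open>ln det (I + A\<^sup>T F A)\<close>, so the sum over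
  the stages telescopes to the gain of the full experiment.

  For the limit, \<open>W\<close> is bounded above by \<open>exp (C |s|\<^sup>2)\<close> because \<open>s\<close> is almost surely orthogonal to
  the kernel of \<open>G\<close>, and below by Jensen's inequality. So \<open>W\<^sub>k ln W\<^sub>k\<close> is dominated by
  \<open>C (1 + |s|\<^sup>2) W\<^sub>k\<close>, whose integrals converge together with the second moments of the tilted
  priors, and a dominated convergence theorem with varying dominating functions applies. The
  convergence of the integrals against tilted priors is read off from near-optimal couplings.
\<close>

text \<open>Neither the prior covariance nor the information matrix has to be invertible. So no
  density of the prior is used: everything is pulled back to a standard Gaussian \<open>z\<close>,
  where the covariances that occur are inverses of matrices \<open>I + T\<close>, and the kernel of
  \<open>G\<close> is split off by hand.

  The obstacle in the limit is that \<open>W ln W\<close> is unbounded, so almost sure convergence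
  of the evidence does not suffice. What helps is that the mean of \<open>|s|^2\<close> is a
  quadratic functional of the prior, and integrals of functions of quadratic growth are what
  convergence in \<open>W_2\<close> controls.

  The tilt adds a difficulty, because its reference point moves with \<open>k\<close> and its weight
  multiplies the test function. A quadratic test function times a weight whose Lipschitz constant
  grows linearly has a modulus of cubic growth, and the coupling estimate squares it. The resulting
  sixth moment is required of the limit prior only, which is Gaussian.\<close>

abbreviation idm :: "real ^ 'n ^ 'n::finite" where "idm \<equiv> Finite_Cartesian_Product.mat 1"
abbreviation vdet :: "'a::comm_ring_1 ^ 'n ^ 'n::finite \<Rightarrow> 'a" where "vdet \<equiv> Determinants.det"
abbreviation mtr :: "'a ^ 'm ^ 'n \<Rightarrow> 'a ^ 'n ^ 'm" where "mtr \<equiv> Finite_Cartesian_Product.transpose"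

lemmas mtr_def = Finite_Cartesian_Product.transpose_def
lemmas mtr_mtr = Finite_Cartesian_Product.transpose_transpose
lemmas idm_def = Finite_Cartesian_Product.mat_def
lemmas cart_eq_iff = Finite_Cartesian_Product.vec_eq_iff

section \<open>Gaussian integrals by successive Schur complements\<close>

text \<open>Index sets and entry functions replace a matrix type, so that one elimination step
  serves both the covariances with explicit carrier (indices \<open>{..<m}\<close>) and the matrices
  over a finite index type.\<close>

definition qform :: "'i set \<Rightarrow> ('i \<Rightarrow> 'i \<Rightarrow> real) \<Rightarrow> ('i \<Rightarrow> real) \<Rightarrow> real" where
  "qform I P x = (\<Sum>i\<in>I. \<Sum>j\<in>I. P i j * x i * x j)"

definition qposdef :: "'i set \<Rightarrow> ('i \<Rightarrow> 'i \<Rightarrow> real) \<Rightarrow> bool" where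
  "qposdef I P \<longleftrightarrow> (\<forall>i\<in>I. \<forall>j\<in>I. P i j = P j i) \<and> (\<forall>x. (\<exists>i\<in>I. x i \<noteq> 0) \<longrightarrow> qform I P x > 0)"

definition schur :: "'i \<Rightarrow> ('i \<Rightarrow> 'i \<Rightarrow> real) \<Rightarrow> 'i \<Rightarrow> 'i \<Rightarrow> real" where
  "schur a P i j = P i j - P i a * P a j / P a a"

lemma qform_cong: "(\<And>i. i \<in> I \<Longrightarrow> x i = y i) \<Longrightarrow> qform I P x = qform I P y"
  unfolding qform_def by (intro sum.cong) auto

text \<open>Completing the square in the coordinate \<open>a\<close>: the Schur complement is what
  is left once all cross terms with \<open>x a\<close> are absorbed.\<close>

lemma qform_insert:
  assumes "finite I" "a \<notin> I" "P a a \<noteq> 0" "\<And>i. i \<in> I \<Longrightarrow> P i a = P a i"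
  shows "qform (insert a I) P x
    = P a a * (x a + (\<Sum>j\<in>I. P a j * x j) / P a a)\<^sup>2 + qform I (schur a P) x"
proof -
  define b where "b = (\<Sum>j\<in>I. P a j * x j)"
  have 1: "qform (insert a I) P x = P a a * (x a)\<^sup>2 + 2 * x a * b + qform I P x"
    using assms unfolding qform_def b_def
    by (simp add: sum.distrib sum_distrib_left power2_eq_square algebra_simps)
  have "(\<Sum>i\<in>I. \<Sum>j\<in>I. P i a * P a j / P a a * x i * x j)
      = (\<Sum>i\<in>I. \<Sum>j\<in>I. (P a i * x i) * (P a j * x j)) / P a a"
    using assms by (simp add: sum_divide_distrib mult_ac)
  also have "\<dots> = b\<^sup>2 / P a a"
    by (simp add: b_def power2_eq_square sum_product)
  finally have "qform I (schur a P) x = qform I P x - b\<^sup>2 / P a a"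
    by (simp add: qform_def schur_def left_diff_distrib sum_subtractf)
  moreover have "P a a * (x a + b / P a a)\<^sup>2 = P a a * (x a)\<^sup>2 + 2 * x a * b + b\<^sup>2 / P a a"
    using assms(3) by (simp add: power2_eq_square field_simps)
  ultimately show ?thesis
    unfolding b_def[symmetric] using 1 by simp
qed

lemma qposdefD: "qposdef I P \<Longrightarrow> i \<in> I \<Longrightarrow> x i \<noteq> 0 \<Longrightarrow> qform I P x > 0"
  unfolding qposdef_def by (elim conjE allE[of _ x] impE) auto

lemma qposdef_sym: "qposdef I P \<Longrightarrow> i \<in> I \<Longrightarrow> j \<in> I \<Longrightarrow> P i j = P j i"
  unfolding qposdef_def by simp

lemma qposdef_diag:
  assumes "finite I" "qposdef I P" "a \<in> I"
  shows "P a a > 0"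
proof -
  have "qform I P (\<lambda>i. if i = a then 1 else 0) > 0"
    by (rule qposdefD[OF assms(2,3)]) simp
  also have "qform I P (\<lambda>i. if i = a then 1 else 0) = P a a"
  proof -
    have "qform I P (\<lambda>i. if i = a then 1 else 0)
        = (\<Sum>i\<in>I. if i = a then (\<Sum>j\<in>I. if j = a then P i j else 0) else 0)"
      unfolding qform_def by (intro sum.cong) (auto intro!: sum.cong)
    then show ?thesis using assms(1,3) by simp
  qed
  finally show ?thesis .
qed

lemma qposdef_schur:
  assumes "finite I" "a \<notin> I" "qposdef (insert a I) P"
  shows "qposdef I (schur a P)"
  unfolding qposdef_def
proof (intro conjI ballI allI impI)
  have sym: "P i j = P j i" if "i \<in> insert a I" "j \<in> insert a I" for i j
    using qposdef_sym[OF assms(3)] that by blast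
  show "schur a P i j = schur a P j i" if "i \<in> I" "j \<in> I" for i j
    using that sym[of i j] sym[of i a] sym[of j a] by (simp add: schur_def)
  have p: "P a a > 0" using qposdef_diag[of "insert a I" P a] assms by simp
  fix x :: "'a \<Rightarrow> real" assume "\<exists>i\<in>I. x i \<noteq> 0"
  then obtain k where k: "k \<in> I" "x k \<noteq> 0" by blast
  \<comment> \<open>This value of the coordinate \<open>a\<close> makes the completed square vanish,
    so the form of \<open>y\<close> is the Schur form of \<open>x\<close>.\<close>
  define y where "y = x(a := - (\<Sum>j\<in>I. P a j * x j) / P a a)"
  have yx: "y i = x i" if "i \<in> I" for i using that assms(2) by (auto simp: y_def)
  have "qform (insert a I) P y > 0" using qposdefD[OF assms(3), of k y] k yx by simp
  moreover have "(\<Sum>j\<in>I. P a j * y j) = (\<Sum>j\<in>I. P a j * x j)"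
    by (intro sum.cong) (auto simp: yx)
  then have "y a + (\<Sum>j\<in>I. P a j * y j) / P a a = 0"
    by (simp add: y_def)
  then have "qform (insert a I) P y = qform I (schur a P) y"
    using p sym by (subst qform_insert[OF assms(1,2)]) auto
  ultimately show "qform I (schur a P) x > 0"
    using qform_cong[of I x y] yx by metis
qed

lemma nn_integral_gaussian_1:
  assumes "p > 0"
  shows "(\<integral>\<^sup>+t. ennreal (exp (- (p * (t - c)\<^sup>2) / 2)) \<partial>lborel) = ennreal (sqrt (2 * pi / p))"
proof -
  have "exp (- (p * (t - c)\<^sup>2) / 2) = sqrt (2 * pi / p) * normal_density c (1 / sqrt p) t" for t
    using assms by (simp add: normal_density_def power_divide real_sqrt_divide field_simps)
  then have "(\<integral>\<^sup>+t. ennreal (exp (- (p * (t - c)\<^sup>2) / 2)) \<partial>lborel)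
     = (\<integral>\<^sup>+t. ennreal (sqrt (2 * pi / p)) * ennreal (normal_density c (1 / sqrt p) t) \<partial>lborel)"
    using assms by (simp add: ennreal_mult)
  also have "\<dots> = ennreal (sqrt (2 * pi / p)) * (\<integral>\<^sup>+t. ennreal (normal_density c (1 / sqrt p) t)
      \<partial>lborel)"
    by (rule nn_integral_cmult) simp
  also have "(\<integral>\<^sup>+t. ennreal (normal_density c (1 / sqrt p) t) \<partial>lborel) = 1"
    using assms by (subst nn_integral_eq_integral) auto
  finally show ?thesis by simp
qed

lemma measurable_qform [measurable]:
  assumes "\<And>i. i \<in> I \<Longrightarrow> (\<lambda>w. f w i) \<in> borel_measurable M"
  shows "(\<lambda>w. qform I P (\<lambda>i. f w i - \<mu> i)) \<in> borel_measurable M"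
  unfolding qform_def
  by (intro borel_measurable_sum borel_measurable_times borel_measurable_diff
      borel_measurable_const assms)

text \<open>Integrate over the coordinate \<open>a\<close> innermost. The centre of that
  one-dimensional Gaussian depends on the other coordinates, but its integral does not, so it leaves
  as a constant factor.\<close>

lemma nn_integral_gaussian_insert:
  assumes "finite I" "a \<notin> I" "qposdef (insert a I) P"
  shows "(\<integral>\<^sup>+x. ennreal (exp (- qform (insert a I) P (\<lambda>i. x i - \<mu> i) / 2)) \<partial>PiM (insert a I) (\<lambda>_.
      lborel))
    = ennreal (sqrt (2 * pi / P a a)) *
      (\<integral>\<^sup>+x. ennreal (exp (- qform I (schur a P) (\<lambda>i. x i - \<mu> i) / 2)) \<partial>PiM I (\<lambda>_. lborel))"
proof -
  interpret product_sigma_finite "\<lambda>_. lborel :: real measure" ..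
  have p: "P a a > 0" using qposdef_diag[of "insert a I" P a] assms by simp
  have sym: "P i j = P j i" if "i \<in> insert a I" "j \<in> insert a I" for i j
    using qposdef_sym[OF assms(3)] that by blast
  have [measurable]: "(\<lambda>x. qform J R (\<lambda>i. x i - \<mu> i)) \<in> borel_measurable (PiM J (\<lambda>_. lborel))" for
      J R
    by (rule measurable_qform) measurable
  have q: "qform (insert a I) P (\<lambda>i. (x(a := t)) i - \<mu> i) = P a a * (t - (\<mu> a - (\<Sum>j\<in>I. P a j * (x
      j - \<mu> j)) / P a a))\<^sup>2
      + qform I (schur a P) (\<lambda>i. x i - \<mu> i)" for x t
  proof -
    have "qform I (schur a P) (\<lambda>i. (x(a := t)) i - \<mu> i) = qform I (schur a P) (\<lambda>i. x i - \<mu> i)"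
      using assms(2) by (intro qform_cong) auto
    moreover have "(\<Sum>j\<in>I. P a j * ((x(a := t)) j - \<mu> j)) = (\<Sum>j\<in>I. P a j * (x j - \<mu> j))"
      using assms(2) by (intro sum.cong) auto
    moreover have "qform (insert a I) P (\<lambda>i. (x(a := t)) i - \<mu> i)
        = P a a * (((x(a := t)) a - \<mu> a) + (\<Sum>j\<in>I. P a j * ((x(a := t)) j - \<mu> j)) / P a a)\<^sup>2
          + qform I (schur a P) (\<lambda>i. (x(a := t)) i - \<mu> i)"
      using p sym by (intro qform_insert[OF assms(1,2)]) auto
    moreover have "((x(a := t)) a - \<mu> a) + S = t - (\<mu> a - S)" for S by simp
    ultimately show ?thesis by (simp only:)
  qed
  have "(\<integral>\<^sup>+x. ennreal (exp (- qform (insert a I) P (\<lambda>i. x i - \<mu> i) / 2)) \<partial>PiM (insert a I) (\<lambda>_.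
      lborel))
     = (\<integral>\<^sup>+x. \<integral>\<^sup>+t. ennreal (exp (- qform (insert a I) P (\<lambda>i. (x(a := t)) i - \<mu> i) / 2)) \<partial>lborel
         \<partial>PiM I (\<lambda>_. lborel))"
    by (rule product_nn_integral_insert[OF assms(1,2)]) measurable
  also have "\<dots> = (\<integral>\<^sup>+x. ennreal (sqrt (2 * pi / P a a)) *
      ennreal (exp (- qform I (schur a P) (\<lambda>i. x i - \<mu> i) / 2)) \<partial>PiM I (\<lambda>_. lborel))"
  proof (rule nn_integral_cong)
    fix x :: "'a \<Rightarrow> real"
    let ?c = "\<mu> a - (\<Sum>j\<in>I. P a j * (x j - \<mu> j)) / P a a"
    let ?r = "exp (- qform I (schur a P) (\<lambda>i. x i - \<mu> i) / 2)"
    have "(\<integral>\<^sup>+t. ennreal (exp (- qform (insert a I) P (\<lambda>i. (x(a := t)) i - \<mu> i) / 2)) \<partial>lborel)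
      = (\<integral>\<^sup>+t. ennreal (exp (- (P a a * (t - ?c)\<^sup>2) / 2)) * ennreal ?r \<partial>lborel)"
      unfolding q by (intro nn_integral_cong) (simp add: ennreal_mult[symmetric]
          exp_add[symmetric] add_divide_distrib)
    also have "\<dots> = ennreal (sqrt (2 * pi / P a a)) * ennreal ?r"
      by (subst nn_integral_multc) (simp_all only: nn_integral_gaussian_1[OF p], measurable)
    finally show "(\<integral>\<^sup>+t. ennreal (exp (- qform (insert a I) P (\<lambda>i. (x(a := t)) i - \<mu> i) / 2))
        \<partial>lborel)
      = ennreal (sqrt (2 * pi / P a a)) * ennreal ?r" .
  qed
  also have "\<dots> = ennreal (sqrt (2 * pi / P a a)) *
      (\<integral>\<^sup>+x. ennreal (exp (- qform I (schur a P) (\<lambda>i. x i - \<mu> i) / 2)) \<partial>PiM I (\<lambda>_. lborel))"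
    by (rule nn_integral_cmult) measurable
  finally show ?thesis .
qed

text \<open>The unipotent factor \<open>?F\<close> encodes the column operations that clear the last
  row up to the pivot; the product is block triangular with the Schur complement and the pivot on
  its diagonal.\<close>

lemma det_schur:
  assumes "P m m \<noteq> 0"
  shows "Determinant.det (Matrix.mat (Suc m) (Suc m) (\<lambda>(i, j). P i j))
    = P m m * Determinant.det (Matrix.mat m m (\<lambda>(i, j). schur m P i j))"
proof -
  let ?M = "Matrix.mat (Suc m) (Suc m) (\<lambda>(i, j). P i j)"
  let ?A = "Matrix.mat m m (\<lambda>(i, j). schur m P i j)"
  let ?B = "Matrix.mat m 1 (\<lambda>(i, j). P i m)"
  let ?C = "0\<^sub>m 1 m :: real mat"
  let ?D = "Matrix.mat 1 1 (\<lambda>_. P m m)"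
  let ?R = "Matrix.mat 1 m (\<lambda>(i, j). - P m j / P m m)"
  let ?F = "four_block_mat (1\<^sub>m m) (0\<^sub>m m 1) ?R (1\<^sub>m 1)"
  let ?G = "four_block_mat ?A ?B ?C ?D"
  have F: "?F \<in> carrier_mat (m + 1) (m + 1)" by (intro four_block_carrier_mat) auto
  have detF: "Determinant.det ?F = 1"
    by (subst det_four_block_mat_upper_right_zero[of _ m _ 1]) auto
  have "?M * ?F = ?G"
  proof (rule eq_matI)
    show "dim_row (?M * ?F) = dim_row ?G" "dim_col (?M * ?F) = dim_col ?G" by auto
    fix i j assume "i < dim_row ?G" "j < dim_col ?G"
    then have ij: "i < Suc m" "j < Suc m" by auto
    have "(?M * ?F) $$ (i, j) = (\<Sum>k<Suc m. P i k * ?F $$ (k, j))"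
      using ij by (simp add: scalar_prod_def atLeast0LessThan del: sum.lessThan_Suc)
    also have "\<dots> = (\<Sum>k<m. P i k * (if k = j then 1 else 0)) + P i m * (if j < m then - P m j / P m
        m else 1)"
      unfolding sum.lessThan_Suc using ij
      by (intro arg_cong2[of _ _ _ _ "(+)"] sum.cong refl) auto
    also have "\<dots> = ?G $$ (i, j)"
      using ij assms by (auto simp: schur_def less_Suc_eq if_distrib[of "\<lambda>x. _ * x"] cong: if_cong)
    finally show "(?M * ?F) $$ (i, j) = ?G $$ (i, j)" .
  qed
  moreover have "Determinant.det (?M * ?F) = Determinant.det ?M * Determinant.det ?F"
    using F by (intro det_mult[of _ "Suc m"]) auto
  moreover have "Determinant.det ?G = Determinant.det ?A * Determinant.det ?D"
    by (rule det_four_block_mat_lower_left_zero) auto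
  ultimately show ?thesis using detF by (simp add: det_single)
qed

lemma lessThan_Suc_insert: "{..<Suc m} = insert m {..<m}" by auto

text \<open>Integral and determinant obey matching recursions under one Schur step. Positivity of
  the determinant comes along because every pivot is positive.\<close>

lemma nn_integral_gaussian_nat:
  assumes "qposdef {..<m} P"
  shows "Determinant.det (Matrix.mat m m (\<lambda>(i, j). P i j)) > 0 \<and>
    (\<integral>\<^sup>+x. ennreal (exp (- qform {..<m} P (\<lambda>i. x i - \<mu> i) / 2)) \<partial>PiM {..<m} (\<lambda>_. lborel))
    = ennreal (sqrt ((2 * pi) ^ m / Determinant.det (Matrix.mat m m (\<lambda>(i, j). P i j))))"
  using assms
proof (induction m arbitrary: P)
  case 0
  interpret product_sigma_finite "\<lambda>_. lborel :: real measure" ..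
  show ?case by (simp add: qform_def nn_integral_empty Determinant.det_dim_zero del:
      nn_integral_const)
next
  case (Suc m)
  have ps: "qposdef (insert m {..<m}) P" using Suc.prems by (simp add: lessThan_Suc_insert)
  have p: "P m m > 0" using qposdef_diag[OF _ ps, of m] by simp
  note IH = Suc.IH[OF qposdef_schur[OF _ _ ps]]
  let ?d = "Determinant.det (Matrix.mat m m (\<lambda>(i, j). schur m P i j))"
  have d: "?d > 0" using IH by simp
  have "sqrt (2 * pi / P m m) * sqrt ((2 * pi) ^ m / ?d) = sqrt ((2 * pi) ^ Suc m / (P m m * ?d))"
    by (simp add: real_sqrt_mult[symmetric])
  moreover have "(\<integral>\<^sup>+x. ennreal (exp (- qform {..<Suc m} P (\<lambda>i. x i - \<mu> i) / 2)) \<partial>PiM {..<Suc m}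
      (\<lambda>_. lborel))
      = ennreal (sqrt (2 * pi / P m m)) * ennreal (sqrt ((2 * pi) ^ m / ?d))"
    unfolding lessThan_Suc_insert
    by (subst nn_integral_gaussian_insert[OF _ _ ps]) (use IH in auto)
  ultimately show ?case
    using p d by (simp add: det_schur ennreal_mult[symmetric])
qed

section \<open>Likelihoods as an exponential family with quadratic log-partition function\<close>

lemma scalar_prod_mult_mat_vec_eq_qform:
  assumes "A \<in> carrier_mat m m"
  shows "scalar_prod (Matrix.vec m f) (A *\<^sub>v Matrix.vec m f) = qform {..<m} (\<lambda>i j. A $$ (i, j)) f"
  using assms
  by (auto simp: scalar_prod_def qform_def atLeast0LessThan sum_distrib_left mult_ac intro!:
      sum.cong)

text \<open>Definiteness excludes a kernel, so the inverse exists and \<open>mat_inv\<close> is not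
  a default value. The form of the inverse at \<open>v\<close> equals the form of \<open>R\<close>
  at the preimage of \<open>v\<close> under \<open>R\<close>, which is nonzero with
  \<open>v\<close>.\<close>

lemma pos_def_mat_mat_inv:
  assumes "pos_def_mat m R"
  shows "mat_inv R \<in> carrier_mat m m" (is ?C)
    and "R * mat_inv R = 1\<^sub>m m" (is ?I)
    and "qposdef {..<m} (\<lambda>i j. mat_inv R $$ (i, j))" (is ?P)
proof -
  let ?Q = "mat_inv R"
  have R: "R \<in> carrier_mat m m" and Rt: "transpose_mat R = R"
    and pos: "\<And>v. v \<in> carrier_vec m \<Longrightarrow> v \<noteq> 0\<^sub>v m \<Longrightarrow> scalar_prod v (R *\<^sub>v v) > 0"
    using assms unfolding pos_def_mat_def by auto
  have "Determinant.det R \<noteq> 0"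
  proof
    assume "Determinant.det R = 0"
    then obtain v where v: "v \<in> carrier_vec m" "v \<noteq> 0\<^sub>v m" "R *\<^sub>v v = 0\<^sub>v m"
      using det_0_iff_vec_prod_zero[OF R] by auto
    with pos[OF v(1,2)] show False by simp
  qed
  then have "R \<in> Units (ring_mat TYPE(real) m ())"
    by (rule det_non_zero_imp_unit[OF R])
  then obtain B where "mat_inverse R = Some B"
    using mat_inverse(1)[OF R, where b = "()"] by fastforce
  then have Q: "R * ?Q = 1\<^sub>m m" "?Q * R = 1\<^sub>m m" "?Q \<in> carrier_mat m m"
    using mat_inverse(2)[OF R] unfolding mat_inv_def by auto
  show ?C ?I using Q by auto
  have Qt: "transpose_mat ?Q = ?Q"
  proof -
    have "transpose_mat ?Q * R = 1\<^sub>m m"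
      using transpose_mult[OF R Q(3)] Q(1) Rt by simp
    then have "transpose_mat ?Q * R * ?Q = ?Q" using Q(3) by simp
    then show ?thesis
      using Q R by (simp add: assoc_mult_mat[of "transpose_mat ?Q" m m R m ?Q m])
  qed
  show ?P
    unfolding qposdef_def
  proof (intro conjI ballI allI impI)
    fix i j assume "i \<in> {..<m}" "j \<in> {..<m}"
    then show "?Q $$ (i, j) = ?Q $$ (j, i)"
      using Q(3) by (metis Qt index_transpose_mat(1) carrier_matD lessThan_iff)
  next
    fix x :: "nat \<Rightarrow> real" assume "\<exists>i\<in>{..<m}. x i \<noteq> 0"
    then obtain k where k: "k < m" "x k \<noteq> 0" by auto
    let ?v = "Matrix.vec m x"
    let ?w = "?Q *\<^sub>v ?v"
    have w: "?w \<in> carrier_vec m" using Q(3) by simp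
    have Rw: "R *\<^sub>v ?w = ?v"
      using Q R by (metis assoc_mult_mat_vec one_mult_mat_vec vec_carrier)
    have "?w \<noteq> 0\<^sub>v m"
    proof
      assume "?w = 0\<^sub>v m"
      moreover have "R *\<^sub>v 0\<^sub>v m = 0\<^sub>v m" using R by (intro eq_vecI) auto
      ultimately have "?v = 0\<^sub>v m" using Rw by simp
      then have "vec_index ?v k = vec_index (0\<^sub>v m) k" by simp
      with k show False by simp
    qed
    then have "0 < scalar_prod ?w (R *\<^sub>v ?w)" by (rule pos[OF w])
    also have "\<dots> = scalar_prod ?v ?w"
      unfolding Rw using w by (simp add: comm_scalar_prod[of ?w m])
    finally show "qform {..<m} (\<lambda>i j. ?Q $$ (i, j)) x > 0"
      using scalar_prod_mult_mat_vec_eq_qform[OF Q(3)] by simp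
  qed
qed

lemma normal_pdf_eq:
  assumes "pos_def_mat m R"
  shows "normal_pdf m \<mu> R x
    = exp (- qform {..<m} (\<lambda>i j. mat_inv R $$ (i, j)) (\<lambda>i. x i - \<mu> i) / 2)
      / sqrt ((2 * pi) ^ m * Determinant.det R)"
  unfolding normal_pdf_def Let_def
  by (simp add: scalar_prod_mult_mat_vec_eq_qform pos_def_mat_mat_inv(1)[OF assms])

lemma nn_integral_normal_pdf:
  assumes "pos_def_mat m R"
  shows "Determinant.det R > 0"
    and "(\<integral>\<^sup>+x. ennreal (normal_pdf m \<mu> R x) \<partial>PiM {..<m} (\<lambda>_. lborel)) = 1"
proof -
  let ?Q = "mat_inv R"
  note Q = pos_def_mat_mat_inv[OF assms]
  have R: "R \<in> carrier_mat m m" using assms unfolding pos_def_mat_def by auto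
  have "Matrix.mat m m (\<lambda>(i, j). ?Q $$ (i, j)) = ?Q" using Q(1) by auto
  note g = nn_integral_gaussian_nat[OF Q(3), unfolded this, of \<mu>]
  have d: "Determinant.det ?Q > 0" using g by simp
  have dd: "Determinant.det R * Determinant.det ?Q = 1"
    using det_mult[OF R Q(1)] Q(2) by simp
  then have "Determinant.det R * Determinant.det ?Q > 0" by simp
  then show dR: "Determinant.det R > 0" using d by (rule zero_less_mult_pos2)
  \<comment> \<open>The Gaussian integral for the precision matrix evaluates to exactly this
    normalising constant, since its determinant is the reciprocal of that of
    \<open>R\<close>.\<close>
  define c where "c = sqrt ((2 * pi) ^ m * Determinant.det R)"
  have c: "c > 0" using dR by (simp add: c_def)
  have dQ: "Determinant.det ?Q = 1 / Determinant.det R" using dd dR by (simp add: field_simps)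
  have [measurable]: "(\<lambda>x. qform {..<m} (\<lambda>i j. ?Q $$ (i, j)) (\<lambda>i. x i - \<mu> i)) \<in> borel_measurable
      (PiM {..<m} (\<lambda>_. lborel))"
    by (rule measurable_qform) measurable
  have "(\<integral>\<^sup>+x. ennreal (normal_pdf m \<mu> R x) \<partial>PiM {..<m} (\<lambda>_. lborel))
    = (\<integral>\<^sup>+x. ennreal (1 / c) * ennreal (exp (- qform {..<m} (\<lambda>i j. ?Q $$ (i, j)) (\<lambda>i. x i - \<mu> i) /
        2)) \<partial>PiM {..<m} (\<lambda>_. lborel))"
    unfolding normal_pdf_eq[OF assms] c_def[symmetric] using c by (simp add:
        ennreal_mult[symmetric])
  also have "\<dots> = ennreal (1 / c) * ennreal c"
    using g by (subst nn_integral_cmult) (auto simp: dQ c_def)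
  also have "\<dots> = 1" using c by (simp add: ennreal_mult[symmetric])
  finally show "(\<integral>\<^sup>+x. ennreal (normal_pdf m \<mu> R x) \<partial>PiM {..<m} (\<lambda>_. lborel)) = 1" .
qed

text \<open>At \<theta> = 0 the likelihood is \<open>h\<close>. The assumption
  \<open>normalized\<close> carries the probabilistic content: for all \<theta> together it
  prescribes the moment generating function of \<open>s\<close>, and with it that \<open>G\<close>
  is positive semidefinite (\<open>G_psd\<close>).\<close>

locale gauss_family = sigma_finite_measure M for M :: "'y measure" +
  fixes L :: "'y \<Rightarrow> real ^ 'n::finite \<Rightarrow> real" and h :: "'y \<Rightarrow> real" and s :: "'y \<Rightarrow> real ^ 'n"
    and G :: "real ^ 'n ^ 'n"
  assumes h_measurable [measurable]: "h \<in> borel_measurable M"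
    and s_measurable [measurable]: "s \<in> borel_measurable M"
    and h_pos: "h y > 0"
    and L_eq: "L y \<theta> = h y * exp (inner (s y) \<theta> - inner \<theta> (G *v \<theta>) / 2)"
    and normalized: "(\<integral>\<^sup>+y. ennreal (L y \<theta>) \<partial>M) = 1"
    and G_sym: "mtr G = G"

lemma sigma_finite_PiM_lborel: "sigma_finite_measure (PiM {..<m::nat} (\<lambda>_. lborel :: real measure))"
proof -
  interpret finite_product_sigma_finite "\<lambda>_. lborel :: real measure" "{..<m}"
    by unfold_locales auto
  show ?thesis by (rule sigma_finite_measure_axioms)
qed

lemma inner_sum_matrix:
  fixes r :: "'k \<Rightarrow> real ^ 'n::finite"
  shows "inner \<theta> ((\<chi> a b. \<Sum>j\<in>I. \<Sum>k\<in>I. vec_nth (r j) a * Q j k * vec_nth (r k) b) *v \<theta>)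
    = qform I Q (\<lambda>j. inner (r j) \<theta>)"
proof -
  have "inner \<theta> ((\<chi> a b. \<Sum>j\<in>I. \<Sum>k\<in>I. vec_nth (r j) a * Q j k * vec_nth (r k) b) *v \<theta>)
    = (\<Sum>a\<in>UNIV. \<Sum>b\<in>UNIV. \<Sum>j\<in>I. \<Sum>k\<in>I.
        Q j k * (vec_nth (r j) a * vec_nth \<theta> a) * (vec_nth (r k) b * vec_nth \<theta> b))"
    by (simp add: inner_vec_def matrix_vector_mult_def sum_distrib_left sum_distrib_right mult_ac)
  also have "\<dots> = (\<Sum>a\<in>UNIV. \<Sum>j\<in>I. \<Sum>b\<in>UNIV. \<Sum>k\<in>I.
        Q j k * (vec_nth (r j) a * vec_nth \<theta> a) * (vec_nth (r k) b * vec_nth \<theta> b))"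
    by (intro sum.cong refl sum.swap)
  also have "\<dots> = (\<Sum>j\<in>I. \<Sum>a\<in>UNIV. \<Sum>b\<in>UNIV. \<Sum>k\<in>I.
        Q j k * (vec_nth (r j) a * vec_nth \<theta> a) * (vec_nth (r k) b * vec_nth \<theta> b))"
    by (rule sum.swap)
  also have "\<dots> = (\<Sum>j\<in>I. \<Sum>a\<in>UNIV. \<Sum>k\<in>I. \<Sum>b\<in>UNIV.
        Q j k * (vec_nth (r j) a * vec_nth \<theta> a) * (vec_nth (r k) b * vec_nth \<theta> b))"
    by (intro sum.cong refl sum.swap)
  also have "\<dots> = (\<Sum>j\<in>I. \<Sum>k\<in>I. \<Sum>a\<in>UNIV. \<Sum>b\<in>UNIV.
        Q j k * (vec_nth (r j) a * vec_nth \<theta> a) * (vec_nth (r k) b * vec_nth \<theta> b))"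
    by (intro sum.cong refl sum.swap)
  also have "\<dots> = qform I Q (\<lambda>j. inner (r j) \<theta>)"
    by (simp add: qform_def inner_vec_def sum_product sum_distrib_left mult_ac)
  finally show ?thesis .
qed

lemma qform_diff:
  assumes "\<And>i j. i \<in> I \<Longrightarrow> j \<in> I \<Longrightarrow> P i j = P j i"
  shows "qform I P (\<lambda>i. x i - y i)
    = qform I P x - 2 * (\<Sum>i\<in>I. \<Sum>j\<in>I. P i j * y i * x j) + qform I P y"
proof -
  have "(\<Sum>i\<in>I. \<Sum>j\<in>I. P i j * x i * y j) = (\<Sum>j\<in>I. \<Sum>i\<in>I. P j i * x i * y j)"
    by (subst sum.swap) (intro sum.cong refl, simp add: assms)
  then have "(\<Sum>i\<in>I. \<Sum>j\<in>I. P i j * x i * y j) = (\<Sum>i\<in>I. \<Sum>j\<in>I. P i j * y i * x j)"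
    by (simp add: mult_ac)
  then show ?thesis
    by (simp add: qform_def algebra_simps sum.distrib sum_subtractf)
qed

text \<open>Expand the square of the residual y - b - H \<theta> in the precision form: the cross
  term yields the statistic \<open>H^T R^-1 (y - b)\<close>, the part quadratic in \<theta> yields
  \<open>H^T R^-1 H\<close>, and the rest is the density at \<theta> = 0.\<close>

lemma gauss_family_sensor:
  fixes r :: "nat \<Rightarrow> real ^ 'n::finite"
  assumes "pos_def_mat m R"
  defines "Q \<equiv> \<lambda>i j. mat_inv R $$ (i, j)"
  shows "gauss_family (PiM {..<m} (\<lambda>_. lborel))
    (\<lambda>x \<theta>. normal_pdf m (\<lambda>j. inner (r j) \<theta> + b j) R x)
    (\<lambda>x. normal_pdf m b R x)
    (\<lambda>x. \<Sum>j<m. \<Sum>k<m. (Q j k * (x k - b k)) *\<^sub>R r j)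
    (\<chi> a c. \<Sum>j<m. \<Sum>k<m. vec_nth (r j) a * Q j k * vec_nth (r k) c)"
    (is "gauss_family _ ?L ?h ?s ?G")
proof -
  interpret sigma_finite_measure "PiM {..<m} (\<lambda>_. lborel :: real measure)"
    by (rule sigma_finite_PiM_lborel)
  note Q = pos_def_mat_mat_inv(3)[OF assms(1), folded Q_def]
  have sym: "Q i j = Q j i" if "i < m" "j < m" for i j
    using qposdef_sym[OF Q] that by simp
  note pdf = normal_pdf_eq[OF assms(1), folded Q_def]
  show ?thesis
  proof
    have "(\<lambda>x. qform {..<m} Q (\<lambda>i. x i - b i)) \<in> borel_measurable (PiM {..<m} (\<lambda>_. lborel))"
      by (rule measurable_qform) measurable
    then show "?h \<in> borel_measurable (PiM {..<m} (\<lambda>_. lborel))"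
      unfolding pdf by measurable
    show "?s \<in> borel_measurable (PiM {..<m} (\<lambda>_. lborel))"
      by measurable
    show "?h x > 0" for x
      unfolding pdf using nn_integral_normal_pdf(1)[OF assms(1)] by simp
    show "(\<integral>\<^sup>+x. ennreal (?L x \<theta>) \<partial>PiM {..<m} (\<lambda>_. lborel)) = 1" for \<theta>
      by (rule nn_integral_normal_pdf(2)[OF assms(1)])
    show "mtr ?G = ?G"
    proof -
      have "(\<Sum>j<m. \<Sum>k<m. vec_nth (r j) a * Q j k * vec_nth (r k) c)
          = (\<Sum>j<m. \<Sum>k<m. vec_nth (r j) c * Q j k * vec_nth (r k) a)" for a c
        by (subst sum.swap) (intro sum.cong refl, auto simp: sym)
      then show ?thesis
        by (simp add: mtr_def cart_eq_iff)
    qed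
    show "?L x \<theta> = ?h x * exp (inner (?s x) \<theta> - inner \<theta> (?G *v \<theta>) / 2)" for x \<theta>
    proof -
      have "qform {..<m} Q (\<lambda>j. x j - (inner (r j) \<theta> + b j))
         = qform {..<m} Q (\<lambda>j. (x j - b j) - inner (r j) \<theta>)"
        by (simp add: algebra_simps)
      also have "\<dots> = qform {..<m} Q (\<lambda>j. x j - b j)
          - 2 * (\<Sum>j<m. \<Sum>k<m. Q j k * inner (r j) \<theta> * (x k - b k)) + inner \<theta> (?G *v \<theta>)"
        unfolding inner_sum_matrix by (rule qform_diff) (simp add: sym)
      also have "(\<Sum>j<m. \<Sum>k<m. Q j k * inner (r j) \<theta> * (x k - b k)) = inner (?s x) \<theta>"
        by (simp add: inner_sum_left mult_ac)
      finally show ?thesis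
        unfolding pdf by (simp add: exp_add[symmetric] algebra_simps diff_divide_distrib
            add_divide_distrib)
    qed
  qed
qed

lemma inner_sum_matrix_vector_mult:
  fixes G :: "'i \<Rightarrow> real ^ 'n ^ 'n::finite"
  shows "inner x (sum G I *v y) = (\<Sum>i\<in>I. inner x (G i *v y))"
  by (induction I rule: infinite_finite_induct) (simp_all add: matrix_vector_mult_add_rdistrib
      inner_add_right)

text \<open>Independent observations multiply likelihoods, hence add exponents. The rule is applied
  twice: to the sensors of one stage and to the stages of the design.\<close>

lemma gauss_family_PiM:
  assumes "product_sigma_finite M" "finite I"
    and fam: "\<And>i. i \<in> I \<Longrightarrow> gauss_family (M i) (L i) (h i) (s i) (G i)"
  shows "gauss_family (PiM I M) (\<lambda>y \<theta>. \<Prod>i\<in>I. L i (y i) \<theta>) (\<lambda>y. \<Prod>i\<in>I. h i (y i))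
    (\<lambda>y. \<Sum>i\<in>I. s i (y i)) (\<Sum>i\<in>I. G i)"
proof -
  interpret product_sigma_finite M by fact
  interpret finite_product_sigma_finite M I by unfold_locales fact
  interpret sigma_finite_measure "PiM I M" by (rule sigma_finite_measure_axioms)
  have [measurable]: "h i \<in> borel_measurable (M i)" "s i \<in> borel_measurable (M i)" if "i \<in> I" for i
    using gauss_family.h_measurable gauss_family.s_measurable fam[OF that] by blast+
  have Lm [measurable]: "(\<lambda>y. L i y \<theta>) \<in> borel_measurable (M i)" if "i \<in> I" for i \<theta>
    unfolding gauss_family.L_eq[OF fam[OF that]] using that by measurable
  have Lpos: "L i y \<theta> \<ge> 0" if "i \<in> I" for i y \<theta>
    unfolding gauss_family.L_eq[OF fam[OF that]] using gauss_family.h_pos[OF fam[OF that], of y]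
    by simp
  show ?thesis
  proof
    show "(\<lambda>y. \<Prod>i\<in>I. h i (y i)) \<in> borel_measurable (PiM I M)" by measurable
    show "(\<lambda>y. \<Sum>i\<in>I. s i (y i)) \<in> borel_measurable (PiM I M)" by measurable
    show "(\<Prod>i\<in>I. h i (y i)) > 0" for y
      by (intro prod_pos ballI) (rule gauss_family.h_pos[OF fam])
    show "mtr (\<Sum>i\<in>I. G i) = (\<Sum>i\<in>I. G i)"
    proof -
      have "vec_nth (vec_nth (G i) a) b = vec_nth (vec_nth (G i) b) a" if "i \<in> I" for i a b
        using arg_cong[OF gauss_family.G_sym[OF fam[OF that]], of "\<lambda>X. vec_nth (vec_nth X b) a"]
        by (simp add: mtr_def)
      then show ?thesis
        by (simp add: mtr_def cart_eq_iff)
    qed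
    show "(\<Prod>i\<in>I. L i (y i) \<theta>) = (\<Prod>i\<in>I. h i (y i))
        * exp (inner (\<Sum>i\<in>I. s i (y i)) \<theta> - inner \<theta> ((\<Sum>i\<in>I. G i) *v \<theta>) / 2)" for y \<theta>
    proof -
      have "(\<Prod>i\<in>I. L i (y i) \<theta>)
          = (\<Prod>i\<in>I. h i (y i) * exp (inner (s i (y i)) \<theta> - inner \<theta> (G i *v \<theta>) / 2))"
        by (intro prod.cong refl gauss_family.L_eq[OF fam])
      also have "\<dots> = (\<Prod>i\<in>I. h i (y i)) * exp (\<Sum>i\<in>I. inner (s i (y i)) \<theta> - inner \<theta> (G i *v \<theta>) / 2)"
        using assms(2) by (simp add: prod.distrib exp_sum)
      also have "(\<Sum>i\<in>I. inner (s i (y i)) \<theta> - inner \<theta> (G i *v \<theta>) / 2)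
          = inner (\<Sum>i\<in>I. s i (y i)) \<theta> - inner \<theta> ((\<Sum>i\<in>I. G i) *v \<theta>) / 2"
        by (simp add: inner_sum_matrix_vector_mult inner_sum_left sum_subtractf sum_divide_distrib)
      finally show ?thesis .
    qed
    show "(\<integral>\<^sup>+y. ennreal (\<Prod>i\<in>I. L i (y i) \<theta>) \<partial>PiM I M) = 1" for \<theta>
    proof -
      have "(\<integral>\<^sup>+y. ennreal (\<Prod>i\<in>I. L i (y i) \<theta>) \<partial>PiM I M)
          = (\<integral>\<^sup>+y. (\<Prod>i\<in>I. ennreal (L i (y i) \<theta>)) \<partial>PiM I M)"
        by (intro nn_integral_cong prod_ennreal[symmetric] Lpos)
      also have "\<dots> = (\<Prod>i\<in>I. \<integral>\<^sup>+y. ennreal (L i y \<theta>) \<partial>M i)"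
        by (rule product_nn_integral_prod[OF assms(2)]) measurable
      also have "\<dots> = 1"
        by (intro prod.neutral ballI gauss_family.normalized[OF fam])
      finally show ?thesis .
    qed
  qed
qed

section \<open>Gaussian integrals on a Euclidean vector space\<close>

text \<open>The coordinatewise integrals live on product measures, the prior on vectors; agreement
  on boxes identifies the two Lebesgue measures.\<close>

lemma lborel_vec_eq: "(lborel :: (real ^ 'n::finite) measure) = distr (PiM UNIV (\<lambda>_. lborel))
    borel vec_lambda"
proof (rule lborel_eqI)
  interpret product_sigma_finite "\<lambda>_. lborel :: real measure" ..
  show "sets (distr (PiM UNIV (\<lambda>_. lborel)) borel (vec_lambda :: _ \<Rightarrow> real ^ 'n)) = sets borel" by
      simp
  have [measurable]: "(vec_lambda :: _ \<Rightarrow> real ^ 'n) \<in> borel_measurable (PiM UNIV (\<lambda>_. lborel))"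
    by (subst borel_measurable_euclidean_space) (auto simp: Basis_vec_def inner_axis)
  fix l u :: "real ^ 'n" assume le: "\<And>b. b \<in> Basis \<Longrightarrow> inner l b \<le> inner u b"
  have le': "vec_nth l i \<le> vec_nth u i" for i
    using le[of "axis i 1"] by (simp add: inner_axis axis_in_Basis_iff)
  have "emeasure (distr (PiM UNIV (\<lambda>_. lborel)) borel vec_lambda) (box l u)
     = emeasure (PiM UNIV (\<lambda>_. lborel)) (\<Pi>\<^sub>E i\<in>UNIV. {vec_nth l i <..< vec_nth u i})"
    by (subst emeasure_distr) (auto simp: box_def Basis_vec_def inner_axis space_PiM PiE_def Pi_def
        extensional_def intro!: arg_cong[where f = "emeasure _"])
  also have "\<dots> = (\<Prod>i\<in>UNIV. emeasure lborel {vec_nth l i <..< vec_nth u i})"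
    by (rule emeasure_PiM) auto
  also have "\<dots> = (\<Prod>i\<in>UNIV. ennreal (vec_nth (u - l) i))"
    using le' by (intro prod.cong) auto
  also have "\<dots> = (\<Prod>b\<in>Basis. ennreal (inner (u - l) b))"
    unfolding Basis_vec_def
    by (subst prod.UNION_disjoint) (auto simp: inner_axis axis_eq_axis)
  also have "\<dots> = ennreal (\<Prod>b\<in>Basis. inner (u - l) b)"
    using le by (intro prod_ennreal) (auto simp: inner_diff_left)
  finally show "emeasure (distr (PiM UNIV (\<lambda>_. lborel)) borel vec_lambda) (box l u)
    = ennreal (\<Prod>b\<in>Basis. inner (u - l) b)" .
qed

lemma measurable_matrix_vector_mult [measurable]:
  fixes A :: "real ^ 'n::finite ^ 'm::finite"
  assumes "f \<in> borel_measurable M"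
  shows "(\<lambda>x. A *v f x) \<in> borel_measurable M"
  by (rule measurable_compose[OF assms])
    (intro borel_measurable_continuous_onI linear_continuous_on matrix_vector_mul_bounded_linear)

lemma vec_nth_vec_lambda: "vec_nth (vec_lambda x) = x"
  by (simp add: fun_eq_iff)

lemma inner_matrix_qform:
  "inner z (P *v z) = qform UNIV (\<lambda>i j. vec_nth (vec_nth P i) j) (vec_nth z)"
  by (simp add: inner_vec_def matrix_vector_mult_def qform_def sum_distrib_left mult_ac)

lemma vdet_shear:
  fixes c :: "'n::finite \<Rightarrow> real"
  shows "vdet (\<chi> i j. (if i = j then 1 else 0) + (if i = a \<and> j \<noteq> a then c j else 0)) = 1"
proof -
  let ?x = "\<Sum>j\<in>UNIV - {a}. c j *s Finite_Cartesian_Product.row j idm"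
  have "?x \<in> vec.span {Finite_Cartesian_Product.row j idm | j. j \<noteq> a}"
    by (intro vec.span_sum vec.span_scale vec.span_base) auto
  from det_row_span[OF this]
  have "vdet (\<chi> k. if k = a then Finite_Cartesian_Product.row a idm + ?x else
      Finite_Cartesian_Product.row k idm) = 1" by simp
  also have "(\<chi> k. if k = a then Finite_Cartesian_Product.row a idm + ?x else
      Finite_Cartesian_Product.row k idm)
      = (\<chi> i j. (if i = j then 1 else 0) + (if i = a \<and> j \<noteq> a then c j else 0))"
    by (auto simp: cart_eq_iff Finite_Cartesian_Product.row_def idm_def
        if_distrib[of "\<lambda>x. _ * x"] sum.delta cong: if_cong)
  finally show ?thesis .
qed

text \<open>Congruence with the shear \<open>E\<close>, of determinant 1, clears row and column
  \<open>a\<close> up to the pivot. The size of a matrix is fixed by its type, so the eliminated row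
  and column stay in place as those of the identity.\<close>

lemma vdet_schur:
  fixes P :: "real ^ 'n ^ 'n::finite" and a :: 'n
  defines "p \<equiv> \<lambda>i j. vec_nth (vec_nth P i) j"
  assumes "p a a \<noteq> 0" "\<And>i. p i a = p a i"
  shows "vdet P = p a a * vdet (\<chi> i j. if i = a \<or> j = a then (if i = j then 1 else 0) else schur a
      p i j)"
proof -
  define E :: "real ^ 'n ^ 'n" where
    "E = (\<chi> i j. (if i = j then 1 else 0) + (if i = a \<and> j \<noteq> a then - p a j / p a a else 0))"
  have detE: "vdet E = 1" unfolding E_def by (rule vdet_shear)
  have PE: "vec_nth (vec_nth (P ** E) i) j = (if j = a then p i a else schur a p i j)" for i j
  proof -
    have "vec_nth (vec_nth (P ** E) i) j
      = (\<Sum>k\<in>UNIV. (if k = j then p i j else 0) + (if k = a then (if j \<noteq> a then - p i a * p a j / p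
          a a else 0) else 0))"
      unfolding matrix_matrix_mult_def E_def p_def
      by (simp only: vec_lambda_beta, rule sum.cong) (auto simp: algebra_simps)
    also have "\<dots> = (if j = a then p i a else schur a p i j)"
      by (simp add: sum.distrib schur_def)
    finally show ?thesis .
  qed
  have "vec_nth (vec_nth (mtr E ** (P ** E)) i) j
      = (if i = a then (if j = a then p a a else 0) else if j = a then 0 else schur a p i j)" for
          i j
  proof -
    have "vec_nth (vec_nth (mtr E ** (P ** E)) i) j
      = (\<Sum>k\<in>UNIV. (if k = i then vec_nth (vec_nth (P ** E) i) j else 0)
          + (if k = a then (if i \<noteq> a then - p a i / p a a * vec_nth (vec_nth (P ** E) a) j else 0)
              else 0))"
      unfolding matrix_matrix_mult_def[of "mtr E"]
      by (simp only: vec_lambda_beta, rule sum.cong)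
        (auto simp: E_def mtr_def algebra_simps)
    also have "\<dots> = vec_nth (vec_nth (P ** E) i) j
        + (if i \<noteq> a then - p a i / p a a * vec_nth (vec_nth (P ** E) a) j else 0)"
      by (simp add: sum.distrib)
    also have "\<dots> = (if i = a then (if j = a then p a a else 0) else if j = a then 0 else schur a p
        i j)"
      using assms(2) assms(3)[of i] unfolding PE by (auto simp: schur_def)
    finally show ?thesis .
  qed
  then have "mtr E ** (P ** E) = (\<chi> i. if i = a then p a a *s axis a 1
      else (\<chi> j. if j = a then 0 else schur a p i j))"
    by (auto simp: cart_eq_iff axis_def)
  moreover have "vdet (mtr E ** (P ** E)) = vdet P"
    using detE by (simp add: Determinants.det_mul Determinants.det_transpose)
  ultimately have "vdet P = vdet (\<chi> i. if i = a then p a a *s axis a 1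
      else (\<chi> j. if j = a then 0 else schur a p i j))"
    by simp
  also have "\<dots> = p a a * vdet (\<chi> i. if i = a then axis a 1
      else (\<chi> j. if j = a then 0 else schur a p i j))"
    by (rule det_row_mul)
  also have "(\<chi> i. if i = a then axis a 1 else (\<chi> j. if j = a then 0 else schur a p i j))
      = (\<chi> i j. if i = a \<or> j = a then (if i = j then 1 else 0) else schur a p i j)"
    by (auto simp: cart_eq_iff axis_def)
  finally show ?thesis .
qed

lemma qform_cong_matrix: "(\<And>i j. i \<in> I \<Longrightarrow> j \<in> I \<Longrightarrow> P i j = Q i j) \<Longrightarrow> qform I P = qform I Q"
  unfolding qform_def by (intro ext sum.cong) auto

lemma qposdef_cong: "(\<And>i j. i \<in> I \<Longrightarrow> j \<in> I \<Longrightarrow> P i j = Q i j) \<Longrightarrow> qposdef I P = qposdef I Q"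
  using qform_cong_matrix[of I P Q] unfolding qposdef_def by simp

text \<open>Extending a matrix on \<open>I \<times> I\<close> by the identity keeps all determinants in the type
  \<open>real ^ 'n ^ 'n\<close> while the index set of the integral grows.\<close>

lemma nn_integral_gaussian_vec_aux:
  fixes P :: "real ^ 'n ^ 'n::finite"
  assumes "qposdef I (\<lambda>i j. vec_nth (vec_nth P i) j)"
    "\<And>i j. i \<notin> I \<or> j \<notin> I \<Longrightarrow> vec_nth (vec_nth P i) j = (if i = j then 1 else 0)"
  shows "vdet P > 0 \<and>
    (\<integral>\<^sup>+x. ennreal (exp (- qform I (\<lambda>i j. vec_nth (vec_nth P i) j) (\<lambda>i. x i - 0) / 2)) \<partial>PiM I (\<lambda>_.
        lborel))
    = ennreal (sqrt ((2 * pi) ^ card I / vdet P))"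
  using finite[of I] assms
proof (induction I arbitrary: P rule: finite_induct)
  case empty
  interpret product_sigma_finite "\<lambda>_. lborel :: real measure" ..
  have "P = idm"
    using empty by (auto simp: cart_eq_iff idm_def)
  then show ?case by (simp add: qform_def nn_integral_empty del: nn_integral_const)
next
  case (insert a I)
  let ?p = "\<lambda>i j. vec_nth (vec_nth P i) j"
  define S :: "real ^ 'n ^ 'n" where
    "S = (\<chi> i j. if i = a \<or> j = a then (if i = j then 1 else 0) else schur a ?p i j)"
  let ?s = "\<lambda>i j. vec_nth (vec_nth S i) j"
  have p: "?p a a > 0" using qposdef_diag[OF _ insert.prems(1), of a] insert.hyps by simp
  have pia: "?p i a = ?p a i" for i
    using qposdef_sym[OF insert.prems(1), of i a] insert.prems(2)[of i a] insert.prems(2)[of a i]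
    by (cases "i \<in> insert a I") auto
  have ss: "?s i j = schur a ?p i j" if "i \<in> I" "j \<in> I" for i j
    using that insert.hyps by (auto simp: S_def)
  have d: "vdet P = ?p a a * vdet S"
    unfolding S_def by (rule vdet_schur[OF less_imp_neq[OF p, symmetric] pia])
  have "qposdef I (schur a ?p)" by (rule qposdef_schur[OF insert.hyps insert.prems(1)])
  then have qs: "qposdef I ?s" using qposdef_cong[of I ?s "schur a ?p"] ss by simp
  have off: "?s i j = (if i = j then 1 else 0)" if "i \<notin> I \<or> j \<notin> I" for i j
    using that insert.prems(2)[of i j] insert.prems(2)[of i a] insert.prems(2)[of a j] p
    by (auto simp: S_def schur_def)
  note IH = insert.IH[OF qs off]
  have "(\<integral>\<^sup>+x. ennreal (exp (- qform (insert a I) ?p (\<lambda>i. x i - 0) / 2)) \<partial>PiM (insert a I) (\<lambda>_.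
      lborel))
      = ennreal (sqrt (2 * pi / ?p a a)) * ennreal (sqrt ((2 * pi) ^ card I / vdet S))"
    by (subst nn_integral_gaussian_insert[OF insert.hyps insert.prems(1)])
       (use IH qform_cong_matrix[of I ?s "schur a ?p"] ss in simp)
  moreover have "sqrt (2 * pi / ?p a a) * sqrt ((2 * pi) ^ card I / vdet S)
      = sqrt ((2 * pi) ^ card (insert a I) / vdet P)"
    using insert.hyps by (simp add: d real_sqrt_mult[symmetric])
  ultimately show ?case
    using IH p d by (simp add: ennreal_mult[symmetric])
qed

definition mposdef :: "real ^ 'n ^ 'n::finite \<Rightarrow> bool" where
  "mposdef P \<longleftrightarrow> mtr P = P \<and> (\<forall>x. x \<noteq> 0 \<longrightarrow> inner x (P *v x) > 0)"

lemma nn_integral_gaussian_vec: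
  fixes P :: "real ^ 'n ^ 'n::finite"
  assumes "mposdef P"
  shows "vdet P > 0"
    and "(\<integral>\<^sup>+z. ennreal (exp (- inner z (P *v z) / 2)) \<partial>lborel)
      = ennreal (sqrt ((2 * pi) ^ CARD('n) / vdet P))"
proof -
  let ?p = "\<lambda>i j. vec_nth (vec_nth P i) j"
  have "qposdef UNIV ?p"
    unfolding qposdef_def
  proof (intro conjI ballI allI impI)
    show "?p i j = ?p j i" for i j
      using assms arg_cong[of "mtr P" P "\<lambda>X. ?p i j"] unfolding mposdef_def
      by (metis (mono_tags) mtr_def vec_lambda_beta)
    fix x :: "'n \<Rightarrow> real" assume "\<exists>i\<in>UNIV. x i \<noteq> 0"
    then have "(\<chi> i. x i) \<noteq> 0" by (auto simp: cart_eq_iff)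
    then have "inner (\<chi> i. x i) (P *v (\<chi> i. x i)) > 0" using assms unfolding mposdef_def by blast
    then show "qform UNIV ?p x > 0" unfolding inner_matrix_qform by (simp add: vec_nth_vec_lambda)
  qed
  from nn_integral_gaussian_vec_aux[OF this]
  have *: "vdet P > 0" "(\<integral>\<^sup>+x. ennreal (exp (- qform UNIV ?p x / 2)) \<partial>PiM UNIV (\<lambda>_. lborel))
      = ennreal (sqrt ((2 * pi) ^ CARD('n) / vdet P))" by auto
  show "vdet P > 0" by fact
  have [measurable]: "(vec_lambda :: _ \<Rightarrow> real ^ 'n) \<in> borel_measurable (PiM UNIV (\<lambda>_. lborel))"
    by (subst borel_measurable_euclidean_space) (auto simp: Basis_vec_def inner_axis)
  have "(\<lambda>z. exp (- inner z (P *v z) / 2)) \<in> borel_measurable borel"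
    by measurable
  then have "(\<integral>\<^sup>+z. ennreal (exp (- inner z (P *v z) / 2)) \<partial>lborel)
    = (\<integral>\<^sup>+x. ennreal (exp (- qform UNIV ?p x / 2)) \<partial>PiM UNIV (\<lambda>_. lborel))"
    by (subst lborel_vec_eq, subst nn_integral_distr) (auto simp: inner_matrix_qform
        vec_nth_vec_lambda)
  then show "(\<integral>\<^sup>+z. ennreal (exp (- inner z (P *v z) / 2)) \<partial>lborel)
      = ennreal (sqrt ((2 * pi) ^ CARD('n) / vdet P))" using * by simp
qed

section \<open>The identity det (I + A M) = det (I + M A)\<close>

lemma matrix_add_rdistrib:
  fixes A B :: "'a::semiring_1 ^ 'n::finite ^ 'm"
  shows "(A + B) ** C = A ** C + B ** C"
  by (simp add: matrix_matrix_mult_def cart_eq_iff sum.distrib distrib_right)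

text \<open>Over the polynomial ring \<open>t I + A\<close> is always cancellable, even if \<open>A\<close> is singular.\<close>

lemma vdet_idm_add_mult_commute:
  fixes A M :: "real ^ 'n ^ 'n::finite"
  shows "vdet (idm + A ** M) = vdet (idm + M ** A)"
proof -
  define X :: "real poly ^ 'n ^ 'n" where
    "X = (\<chi> i j. [: vec_nth (vec_nth A i) j, if i = j then 1 else 0 :])"
  define N :: "real poly ^ 'n ^ 'n" where "N = (\<chi> i j. [: vec_nth (vec_nth M i) j :])"
  define ev :: "real poly ^ 'n ^ 'n \<Rightarrow> real \<Rightarrow> real ^ 'n ^ 'n" where
    "ev Y t = (\<chi> i j. poly (vec_nth (vec_nth Y i) j) t)" for Y t
  let ?I = "Finite_Cartesian_Product.mat 1 :: real poly ^ 'n ^ 'n"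
  have ev_det: "poly (vdet Y) t = vdet (ev Y t)" for Y t
    by (simp add: Determinants.det_def ev_def poly_sum poly_prod of_int_poly)
  have ev_mult: "ev (Y ** Z) t = ev Y t ** ev Z t" for Y Z t
    by (simp add: ev_def matrix_matrix_mult_def poly_sum)
  have ev_add: "ev (Y + Z) t = ev Y t + ev Z t" for Y Z t
    by (simp add: ev_def cart_eq_iff)
  have ev_I: "ev ?I t = idm" for t
    by (simp add: ev_def idm_def cart_eq_iff)
  have evX: "ev X 0 = A" and evN: "ev N 0 = M"
    by (simp_all add: ev_def X_def N_def cart_eq_iff)
  have "vdet X \<noteq> 0"
  proof
    assume "vdet X = 0"
    \<comment> \<open>Beyond the operator norm of \<open>A\<close>, the number -t cannot be an
      eigenvalue of \<open>A\<close>; hence the determinant of \<open>X\<close> is a nonzero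
      polynomial.\<close>
    define t where "t = onorm ((*v) A) + 1"
    have "vdet (ev X t) = 0" using \<open>vdet X = 0\<close> ev_det[of X t] by simp
    moreover have "ev X t = A + t *\<^sub>R idm"
      by (simp add: ev_def X_def cart_eq_iff idm_def)
    ultimately have "\<not> invertible (A + t *\<^sub>R idm)" by (simp add: invertible_det_nz)
    then obtain x where x: "x \<noteq> 0" "(A + t *\<^sub>R idm) *v x = 0"
      using matrix_left_invertible_ker invertible_left_inverse by blast
    then have "A *v x = - (t *\<^sub>R x)"
      by (simp add: matrix_vector_mult_add_rdistrib scaleR_matrix_vector_assoc[symmetric]
          eq_neg_iff_add_eq_0)
    then have "norm (A *v x) = \<bar>t\<bar> * norm x" by simp
    moreover have "norm (A *v x) \<le> onorm ((*v) A) * norm x"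
      by (rule onorm[OF matrix_vector_mul_bounded_linear])
    moreover have "onorm ((*v) A) \<ge> 0" by (rule onorm_pos_le[OF matrix_vector_mul_bounded_linear])
    ultimately show False using x(1) by (simp add: t_def)
  qed
  \<comment> \<open>Both sides are X + X N X. The determinant of \<open>X\<close> cancels in the
    domain of polynomials, and evaluation at 0 returns to \<open>A\<close>.\<close>
  have "X ** (?I + N ** X) = (?I + X ** N) ** X"
    by (simp add: matrix_add_ldistrib matrix_add_rdistrib matrix_mul_assoc)
  then have "vdet X * vdet (?I + N ** X) = vdet (?I + X ** N) * vdet X"
    by (metis Determinants.det_mul)
  then have "vdet (?I + N ** X) = vdet (?I + X ** N)" using \<open>vdet X \<noteq> 0\<close> by simp
  then have "poly (vdet (?I + N ** X)) 0 = poly (vdet (?I + X ** N)) 0" by simp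
  then show ?thesis
    unfolding ev_det ev_add ev_mult ev_I evX evN by simp
qed

section \<open>Moments from the moment generating function\<close>

lemma mposdef_matrix_inv:
  assumes "mposdef P"
  shows "P ** matrix_inv P = idm" "matrix_inv P ** P = idm" "mtr (matrix_inv P) = matrix_inv P"
proof -
  have "invertible P" using nn_integral_gaussian_vec(1)[OF assms] by (simp add: invertible_det_nz)
  then have "P ** matrix_inv P = idm \<and> matrix_inv P ** P = idm"
    unfolding invertible_def matrix_inv_def by (rule someI_ex)
  then show 1: "P ** matrix_inv P = idm" "matrix_inv P ** P = idm" by auto
  have "mtr (matrix_inv P) ** P = idm"
    using 1(1) assms by (metis matrix_transpose_mul mposdef_def transpose_mat)
  then show "mtr (matrix_inv P) = matrix_inv P"
    using 1 by (metis matrix_mul_assoc matrix_mul_lid matrix_mul_rid)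
qed

lemma inner_matrix_sym: "mtr P = P \<Longrightarrow> inner x (P *v y) = inner y (P *v x)"
  for P :: "real ^ 'n ^ 'n::finite"
  by (metis dot_lmul_matrix inner_commute transpose_matrix_vector)

lemma onorm_matrix_nonneg: "onorm ((*v) Q) \<ge> 0" for Q :: "real ^ 'n ^ 'n::finite"
  by (rule onorm_pos_le[OF matrix_vector_mul_bounded_linear])

lemma norm_matrix_le: "norm (Q *v x) \<le> onorm ((*v) Q) * norm x" for Q :: "real ^ 'n ^ 'n::finite"
  by (rule onorm[OF matrix_vector_mul_bounded_linear])

lemma abs_inner_matrix_le: "\<bar>inner x (Q *v y)\<bar> \<le> onorm ((*v) Q) * (norm x * norm y)"
  for Q :: "real ^ 'n ^ 'n::finite"
proof -
  have "\<bar>inner x (Q *v y)\<bar> \<le> norm x * norm (Q *v y)" by (rule Cauchy_Schwarz_ineq2)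
  also have "\<dots> \<le> norm x * (onorm ((*v) Q) * norm y)" by (intro mult_left_mono norm_matrix_le) simp
  finally show ?thesis by (simp add: mult_ac)
qed

lemma std_gaussian_density_eq:
  fixes z :: "real ^ 'n::finite"
  shows "(\<Prod>a\<in>UNIV. std_normal_density (vec_nth z a)) = exp (- inner z z / 2) / sqrt ((2 * pi) ^
      CARD('n))"
proof -
  have "(\<Prod>a\<in>UNIV. std_normal_density (vec_nth z a))
      = (\<Prod>a\<in>(UNIV::'n set). 1 / sqrt (2 * pi)) * exp (\<Sum>a\<in>UNIV. - (vec_nth z a)\<^sup>2 / 2)"
    unfolding std_normal_density_def prod.distrib by (simp add: exp_sum)
  also have "(\<Sum>a\<in>UNIV. - (vec_nth z a)\<^sup>2 / 2) = - inner z z / 2"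
    by (simp add: inner_vec_def power2_eq_square sum_negf sum_divide_distrib)
  finally show ?thesis by (simp add: power_one_over real_sqrt_power[symmetric] real_sqrt_mult
      power_mult_distrib)
qed

text \<open>The density of \<open>z\<close> turns \<open>P - idm\<close> into \<open>P\<close>; then
  complete the square at \<open>w\<close>, the solution of P w = u, and translate. In this form the
  rule also covers growing exponents, as long as \<open>P\<close> stays positive definite.\<close>

lemma nn_integral_std_gaussian_exp_quadratic:
  fixes P :: "real ^ 'n ^ 'n::finite"
  assumes "mposdef P"
  shows "(\<integral>\<^sup>+z. ennreal (exp (inner u z - inner z ((P - idm) *v z) / 2)) \<partial>std_gaussian)
    = ennreal (exp (inner u (matrix_inv P *v u) / 2) / sqrt (vdet P))"
proof -
  define w where "w = matrix_inv P *v u"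
  define c where "c = sqrt ((2 * pi) ^ CARD('n))"
  have c: "c > 0" by (simp add: c_def)
  have sym: "mtr P = P" using assms by (simp add: mposdef_def)
  have Pw: "P *v w = u"
    by (simp add: w_def matrix_vector_mul_assoc mposdef_matrix_inv[OF assms])
  have sq: "inner u z - inner z (P *v z) / 2 = inner u w / 2 - inner (z - w) (P *v (z - w)) / 2"
      for z
    using inner_matrix_sym[OF sym, of w z]
    by (simp add: matrix_vector_mult_diff_distrib Pw inner_diff_left inner_diff_right
        inner_commute field_simps)
  have "(\<integral>\<^sup>+z. ennreal (exp (inner u z - inner z ((P - idm) *v z) / 2)) \<partial>std_gaussian)
    = (\<integral>\<^sup>+z. ennreal (exp (- inner z z / 2) / c) * ennreal (exp (inner u z - inner z ((P - idm) *v
        z) / 2)) \<partial>lborel)"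
    unfolding std_gaussian_def std_gaussian_density_eq c_def
    by (subst nn_integral_density) measurable
  also have "\<dots> = (\<integral>\<^sup>+z. ennreal (exp (inner u w / 2) / c) * ennreal (exp (- inner (z - w) (P *v (z
      - w)) / 2)) \<partial>lborel)"
  proof (rule nn_integral_cong)
    fix z :: "real ^ 'n"
    have "inner u w / 2 - inner (z - w) (P *v (z - w)) / 2 = - inner z z / 2 + (inner u z - inner
        z ((P - idm) *v z) / 2)"
      unfolding sq[symmetric] by (simp add: matrix_vector_mult_diff_rdistrib inner_diff_right
          diff_divide_distrib)
    then have "exp (inner u w / 2) * exp (- inner (z - w) (P *v (z - w)) / 2)
      = exp (- inner z z / 2) * exp (inner u z - inner z ((P - idm) *v z) / 2)"
      unfolding exp_add[symmetric] by simp
    then show "ennreal (exp (- inner z z / 2) / c) * ennreal (exp (inner u z - inner z ((P - idm)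
        *v z) / 2))
      = ennreal (exp (inner u w / 2) / c) * ennreal (exp (- inner (z - w) (P *v (z - w)) / 2))"
      using c by (simp add: ennreal_mult[symmetric])
  qed
  also have "\<dots> = ennreal (exp (inner u w / 2) / c) * (\<integral>\<^sup>+z. ennreal (exp (- inner (z - w) (P *v (z
      - w)) / 2)) \<partial>lborel)"
    by (rule nn_integral_cmult) measurable
  also have "(\<integral>\<^sup>+z. ennreal (exp (- inner (z - w) (P *v (z - w)) / 2)) \<partial>lborel)
      = (\<integral>\<^sup>+z. ennreal (exp (- inner (z - w) (P *v (z - w)) / 2)) \<partial>distr lborel borel ((+) w))"
    by (simp add: lborel_distr_plus)
  also have "\<dots> = (\<integral>\<^sup>+z. ennreal (exp (- inner z (P *v z) / 2)) \<partial>lborel)"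
    by (subst nn_integral_distr) (auto, measurable)
  also have "\<dots> = ennreal (c / sqrt (vdet P))"
    using nn_integral_gaussian_vec[OF assms] by (simp add: c_def real_sqrt_divide)
  finally show ?thesis
    using c by (simp add: ennreal_mult'[symmetric] w_def)
qed

text \<open>Taylor expansion with Lagrange remainder at \<open>y\<close> and \<open>- y\<close>; the
  linear terms cancel. The bounds trap the second difference quotient from which the variance is
  recovered.\<close>

lemma exp_second_difference_bounds:
  fixes y :: real
  shows "y\<^sup>2 * exp (- \<bar>y\<bar>) \<le> exp y + exp (- y) - 2" "exp y + exp (- y) - 2 \<le> y\<^sup>2 * exp \<bar>y\<bar>"
proof -
  have *: "\<exists>t. \<bar>t\<bar> \<le> \<bar>x\<bar> \<and> exp x = 1 + x + exp t / 2 * x\<^sup>2" for x :: real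
    using Maclaurin_exp_le[of x 2] by (auto simp: numeral_2_eq_2)
  obtain t where t: "\<bar>t\<bar> \<le> \<bar>y\<bar>" "exp y = 1 + y + exp t / 2 * y\<^sup>2" using *[of y] by auto
  obtain t' where t': "\<bar>t'\<bar> \<le> \<bar>y\<bar>" "exp (- y) = 1 - y + exp t' / 2 * y\<^sup>2" using *[of "- y"] by auto
  have eq: "exp y + exp (- y) - 2 = y\<^sup>2 * ((exp t + exp t') / 2)"
    unfolding t(2) t'(2) by (simp add: algebra_simps add_divide_distrib)
  have e: "exp (- \<bar>y\<bar>) \<le> exp t" "exp (- \<bar>y\<bar>) \<le> exp t'" "exp t \<le> exp \<bar>y\<bar>" "exp t' \<le> exp \<bar>y\<bar>"
    using t(1) t'(1) by auto
  have avg: "y\<^sup>2 * l \<le> y\<^sup>2 * ((b + c) / 2) \<and> y\<^sup>2 * ((b + c) / 2) \<le> y\<^sup>2 * u"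
    if "l \<le> b" "l \<le> c" "b \<le> u" "c \<le> u" for l b c u :: real
    using that by (intro conjI mult_left_mono) auto
  show "y\<^sup>2 * exp (- \<bar>y\<bar>) \<le> exp y + exp (- y) - 2" "exp y + exp (- y) - 2 \<le> y\<^sup>2 * exp \<bar>y\<bar>"
    unfolding eq using avg[OF e] by auto
qed

lemma square_le_exp_add_exp_minus: "x\<^sup>2 \<le> 2 * (exp x + exp (- x))" for x :: real
proof -
  have "1 + \<bar>x\<bar> + \<bar>x\<bar>\<^sup>2 / 2 \<le> exp \<bar>x\<bar>" by (rule exp_lower_Taylor_quadratic) simp
  then have "x\<^sup>2 \<le> 2 * exp \<bar>x\<bar>" by simp
  also have "exp \<bar>x\<bar> \<le> exp x + exp (- x)" by (cases "x \<ge> 0") auto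
  finally show ?thesis by simp
qed

text \<open>The bound consists of exponentials only, whose integrability is known from the moment
  generating function.\<close>

lemma exp_times_square_le: "x\<^sup>2 * exp \<bar>x\<bar> \<le> 2 * (exp (2 * x) + exp (- (2 * x)) + 2)" for x :: real
proof -
  have a: "exp \<bar>x\<bar> \<le> exp x + exp (- x)" by (cases "x \<ge> 0") auto
  have "x\<^sup>2 * exp \<bar>x\<bar> \<le> (2 * (exp x + exp (- x))) * (exp x + exp (- x))"
    by (rule mult_mono[OF square_le_exp_add_exp_minus a]) (auto intro!: add_nonneg_nonneg)
  also have "\<dots> = 2 * (exp (2 * x) + exp (- (2 * x)) + 2)"
  proof -
    have "exp x * exp x = exp (2 * x)" "exp (- x) * exp (- x) = exp (- (2 * x))" "exp x * exp (-
        x) = 1"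
      by (simp_all flip: exp_add)
    then show ?thesis by (simp add: distrib_left distrib_right mult.commute)
  qed
  finally show ?thesis .
qed

text \<open>\<open>X\<close> may be degenerate (\<open>v = 0\<close>), so no density is used: the
  mean is squeezed to 0 by the tangent of the exponential, and the variance is the second derivative
  of the moment generating function at 0, taken as a limit of symmetric difference
  quotients.\<close>

lemma gaussian_mgf_moments:
  assumes "prob_space M" and [measurable]: "X \<in> borel_measurable M"
    and mgf: "\<And>t::real. (\<integral>\<^sup>+w. ennreal (exp (t * X w)) \<partial>M) = ennreal (exp (t\<^sup>2 * v / 2))"
  shows "integrable M X" "integrable M (\<lambda>w. (X w)\<^sup>2)" "integral\<^sup>L M X = 0" "(\<integral>w. (X w)\<^sup>2 \<partial>M) = v"
proof -
  interpret prob_space M by fact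
  have E: "integrable M (\<lambda>w. exp (t * X w))" "(\<integral>w. exp (t * X w) \<partial>M) = exp (t\<^sup>2 * v / 2)" for t
  proof -
    show "integrable M (\<lambda>w. exp (t * X w))"
      using mgf[of t] by (intro integrableI_nonneg) auto
    then show "(\<integral>w. exp (t * X w) \<partial>M) = exp (t\<^sup>2 * v / 2)"
      using mgf[of t] by (simp add: nn_integral_eq_integral)
  qed
  have E1: "integrable M (\<lambda>w. exp (X w))" "integrable M (\<lambda>w. exp (- X w))"
    "integrable M (\<lambda>w. exp (2 * X w))" "integrable M (\<lambda>w. exp (- (2 * X w)))"
    using E(1)[of 1] E(1)[of "-1"] E(1)[of 2] E(1)[of "-2"] by simp_all
  show i2: "integrable M (\<lambda>w. (X w)\<^sup>2)"
  proof (rule Bochner_Integration.integrable_bound)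
    show "integrable M (\<lambda>w. 2 * (exp (X w) + exp (- X w)))" using E1 by simp
    show "AE w in M. norm ((X w)\<^sup>2) \<le> norm (2 * (exp (X w) + exp (- X w)))"
      using square_le_exp_add_exp_minus by (intro AE_I2) (simp add: abs_of_pos add_pos_pos)
  qed measurable
  show i1: "integrable M X"
  proof (rule Bochner_Integration.integrable_bound)
    show "integrable M (\<lambda>w. 1 + (X w)\<^sup>2)" using i2 by simp
    show "AE w in M. norm (X w) \<le> norm (1 + (X w)\<^sup>2)"
    proof (intro AE_I2)
      fix w
      have "0 \<le> (\<bar>X w\<bar> - 1)\<^sup>2" by simp
      then have "2 * \<bar>X w\<bar> \<le> 1 + (X w)\<^sup>2" by (simp add: power2_diff)
      then show "norm (X w) \<le> norm (1 + (X w)\<^sup>2)" by simp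
    qed
  qed measurable
  define r where "r n = 1 / real (Suc n)" for n
  have r: "r n > 0" "r n \<le> 1" for n by (auto simp: r_def)
  have r0: "r \<longlonglongrightarrow> 0" unfolding r_def by real_asymp
  \<comment> \<open>From 1 + x \<le> exp x. The right side is of order t^2, so dividing by small
    \<open>t\<close> of either sign leaves mean 0.\<close>
  have le: "t * integral\<^sup>L M X \<le> exp (t\<^sup>2 * v / 2) - 1" for t
  proof -
    have "(\<integral>w. 1 + t * X w \<partial>M) \<le> (\<integral>w. exp (t * X w) \<partial>M)"
      using i1 E(1)[of t] by (intro integral_mono) auto
    then show ?thesis using i1 E(2)[of t] by (simp add: prob_space)
  qed
  have lim1: "(\<lambda>n. (exp ((r n)\<^sup>2 * v / 2) - 1) / r n) \<longlonglongrightarrow> 0"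
    unfolding r_def by real_asymp
  have lim2: "(\<lambda>n. (2 * exp ((r n)\<^sup>2 * v / 2) - 2) / (r n)\<^sup>2) \<longlonglongrightarrow> v"
    unfolding r_def by real_asymp
  show "integral\<^sup>L M X = 0"
  proof (rule antisym)
    show "integral\<^sup>L M X \<le> 0"
    proof (rule LIMSEQ_le_const[OF lim1])
      have "integral\<^sup>L M X \<le> (exp ((r n)\<^sup>2 * v / 2) - 1) / r n" for n
        using le[of "r n"] r(1)[of n] by (simp add: pos_le_divide_eq mult.commute)
      then show "\<exists>N. \<forall>n\<ge>N. integral\<^sup>L M X \<le> (exp ((r n)\<^sup>2 * v / 2) - 1) / r n" by blast
    qed
    have "- integral\<^sup>L M X \<le> 0"
    proof (rule LIMSEQ_le_const[OF lim1])
      have "- integral\<^sup>L M X \<le> (exp ((r n)\<^sup>2 * v / 2) - 1) / r n" for n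
        using le[of "- r n"] r(1)[of n] by (simp add: pos_le_divide_eq mult.commute)
      then show "\<exists>N. \<forall>n\<ge>N. - integral\<^sup>L M X \<le> (exp ((r n)\<^sup>2 * v / 2) - 1) / r n" by blast
    qed
    then show "0 \<le> integral\<^sup>L M X" by simp
  qed
  \<comment> \<open>Symmetric second difference quotient of the exponential with step
    \<open>r n\<close>. Since \<open>r n\<close> is at most 1, one dominating function serves all
    \<open>n\<close>.\<close>
  define g where "g n x = (exp (r n * x) + exp (- (r n * x)) - 2) / (r n)\<^sup>2" for n and x :: real
  have g: "x\<^sup>2 * exp (- (r n * \<bar>x\<bar>)) \<le> g n x" "g n x \<le> x\<^sup>2 * exp (r n * \<bar>x\<bar>)" for n x
    using exp_second_difference_bounds[of "r n * x"] r(1)[of n]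
    by (simp_all add: g_def pos_le_divide_eq pos_divide_le_eq power_mult_distrib abs_mult mult_ac)
  have glim: "(\<lambda>n. g n x) \<longlonglongrightarrow> x\<^sup>2" for x
  proof (rule tendsto_sandwich)
    show "\<forall>\<^sub>F n in sequentially. x\<^sup>2 * exp (- (r n * \<bar>x\<bar>)) \<le> g n x"
      "\<forall>\<^sub>F n in sequentially. g n x \<le> x\<^sup>2 * exp (r n * \<bar>x\<bar>)" using g by auto
    have "(\<lambda>n. x\<^sup>2 * exp (- (r n * \<bar>x\<bar>))) \<longlonglongrightarrow> x\<^sup>2 * exp (- (0 * \<bar>x\<bar>))"
      by (intro tendsto_intros r0)
    then show "(\<lambda>n. x\<^sup>2 * exp (- (r n * \<bar>x\<bar>))) \<longlonglongrightarrow> x\<^sup>2" by simp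
    have "(\<lambda>n. x\<^sup>2 * exp (r n * \<bar>x\<bar>)) \<longlonglongrightarrow> x\<^sup>2 * exp (0 * \<bar>x\<bar>)"
      by (intro tendsto_intros r0)
    then show "(\<lambda>n. x\<^sup>2 * exp (r n * \<bar>x\<bar>)) \<longlonglongrightarrow> x\<^sup>2" by simp
  qed
  have "(\<lambda>n. \<integral>w. g n (X w) \<partial>M) \<longlonglongrightarrow> (\<integral>w. (X w)\<^sup>2 \<partial>M)"
  proof (rule integral_dominated_convergence)
    show "integrable M (\<lambda>w. 2 * (exp (2 * X w) + exp (- (2 * X w)) + 2))" using E1 by simp
    show "AE w in M. norm (g n (X w)) \<le> 2 * (exp (2 * X w) + exp (- (2 * X w)) + 2)" for n
    proof (intro AE_I2)
      fix w
      have "0 \<le> (X w)\<^sup>2 * exp (- (r n * \<bar>X w\<bar>))" by simp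
      then have "0 \<le> g n (X w)" using g(1)[of "X w" n] by linarith
      moreover have "r n * \<bar>X w\<bar> \<le> \<bar>X w\<bar>" using r[of n] by (simp add: mult_left_le_one_le)
      then have "(X w)\<^sup>2 * exp (r n * \<bar>X w\<bar>) \<le> (X w)\<^sup>2 * exp \<bar>X w\<bar>" by (simp add: mult_left_mono)
      ultimately show "norm (g n (X w)) \<le> 2 * (exp (2 * X w) + exp (- (2 * X w)) + 2)"
        using g(2)[of n "X w"] exp_times_square_le[of "X w"] by simp
    qed
    show "AE w in M. (\<lambda>n. g n (X w)) \<longlonglongrightarrow> (X w)\<^sup>2" using glim by simp
  qed (auto simp: g_def)
  moreover have "(\<integral>w. g n (X w) \<partial>M) = (2 * exp ((r n)\<^sup>2 * v / 2) - 2) / (r n)\<^sup>2" for n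
    using E(1)[of "r n"] E(1)[of "- r n"] E(2)[of "r n"] E(2)[of "- r n"]
    by (simp add: g_def prob_space)
  ultimately show "(\<integral>w. (X w)\<^sup>2 \<partial>M) = v"
    using lim2 LIMSEQ_unique by auto
qed

text \<open>The scalar case applies to every projection, with \<open>t *\<^sub>R u\<close> in place
  of \<open>u\<close>; the mixed moments follow by polarisation.\<close>

lemma gaussian_mgf_vec_moments:
  fixes X :: "'w \<Rightarrow> real ^ 'n::finite"
  assumes "prob_space M" and [measurable]: "X \<in> borel_measurable M" and sym: "mtr S = S"
    and mgf: "\<And>u. (\<integral>\<^sup>+w. ennreal (exp (inner u (X w))) \<partial>M) = ennreal (exp (inner u (S *v u) / 2))"
  shows "integrable M (\<lambda>w. inner u (X w))" "(\<integral>w. inner u (X w) \<partial>M) = 0"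
    "integrable M (\<lambda>w. inner u (X w) * inner v (X w))"
    "(\<integral>w. inner u (X w) * inner v (X w) \<partial>M) = inner u (S *v v)"
proof -
  have m: "(\<integral>\<^sup>+w. ennreal (exp (t * inner u (X w))) \<partial>M) = ennreal (exp (t\<^sup>2 * inner u (S *v u) /
      2))" for t u
    using mgf[of "t *\<^sub>R u"] by (simp add: matrix_vector_mult_scaleR power2_eq_square mult_ac)
  note g = gaussian_mgf_moments[OF assms(1) _ m]
  show "integrable M (\<lambda>w. inner u (X w))" "(\<integral>w. inner u (X w) \<partial>M) = 0"
    by (rule g, measurable)+
  have sq: "integrable M (\<lambda>w. (inner u (X w))\<^sup>2)" "(\<integral>w. (inner u (X w))\<^sup>2 \<partial>M) = inner u (S *v u)"
      for u
    by (rule g, measurable)+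
  have eq: "inner u x * inner v x = ((inner (u + v) x)\<^sup>2 - (inner u x)\<^sup>2 - (inner v x)\<^sup>2) / 2" for x
    by (simp add: inner_add_left power2_sum)
  show "integrable M (\<lambda>w. inner u (X w) * inner v (X w))"
    unfolding eq using sq(1)[of "u + v"] sq(1)[of u] sq(1)[of v] by simp
  have "(\<integral>w. inner u (X w) * inner v (X w) \<partial>M)
      = (inner (u + v) (S *v (u + v)) - inner u (S *v u) - inner v (S *v v)) / 2"
    unfolding eq using sq[of "u + v"] sq[of u] sq[of v] by simp
  also have "\<dots> = inner u (S *v v)"
    using inner_matrix_sym[OF sym, of u v]
    by (simp add: matrix_vector_right_distrib inner_add_left inner_add_right)
  finally show "(\<integral>w. inner u (X w) * inner v (X w) \<partial>M) = inner u (S *v v)" .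
qed

section \<open>Moments and bounds for the sufficient statistic\<close>

lemma AE_pair_snd:
  assumes "sigma_finite_measure M2" "AE y in M2. P y"
  shows "AE x in M1 \<Otimes>\<^sub>M M2. P (snd x)"
proof -
  interpret sigma_finite_measure M2 by fact
  from assms(2) obtain N where N: "{y \<in> space M2. \<not> P y} \<subseteq> N" "emeasure M2 N = 0" "N \<in> sets M2"
    by (rule AE_E)
  show ?thesis
  proof (rule AE_I')
    show "space M1 \<times> N \<in> null_sets (M1 \<Otimes>\<^sub>M M2)"
      using N by (auto simp: null_sets_def emeasure_pair_measure_Times)
    show "{x \<in> space (M1 \<Otimes>\<^sub>M M2). \<not> P (snd x)} \<subseteq> space M1 \<times> N"
      using N by (auto simp: space_pair_measure)
  qed
qed

lemma norm_sq_eq_sum_Basis: "(norm x)\<^sup>2 = (\<Sum>b\<in>Basis. (inner b x)\<^sup>2)" for x :: "'a::euclidean_space"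
  by (subst power2_norm_eq_inner, subst euclidean_inner) (simp add: power2_eq_square inner_commute)

lemma quadratic_le: "a * b \<le> a\<^sup>2 / (2 * k) + k * b\<^sup>2 / 2" if "k > 0" for a b k :: real
proof -
  have "0 \<le> (a / sqrt k - sqrt k * b)\<^sup>2" by simp
  also have "\<dots> = a\<^sup>2 / k - 2 * (a * b) + k * b\<^sup>2"
    using that by (simp add: power2_diff power_divide power_mult_distrib)
  finally show ?thesis by (simp add: field_simps)
qed

context gauss_family
begin

text \<open>The law of the observation given \<open>\<theta> = 0\<close>; \<open>lik_ratio\<close> is the likelihood relative to it.\<close>

definition ref where "ref = density M (\<lambda>y. ennreal (h y))"

definition lik_ratio where "lik_ratio y \<theta> = exp (inner (s y) \<theta> - inner \<theta> (G *v \<theta>) / 2)"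

text \<open>The W of the overview: the evidence without the factor \<open>h y\<close>, which cancels
  against the same factor of the likelihood.\<close>

definition evid where "evid q y = (\<integral>\<theta>. lik_ratio y \<theta> \<partial>q)"

definition joint where "joint q = density (q \<Otimes>\<^sub>M ref) (\<lambda>(\<theta>, y). ennreal (lik_ratio y \<theta>))"

lemma sets_ref [measurable_cong, simp]: "sets ref = sets M"
  by (simp add: ref_def)

lemma space_ref [simp]: "space ref = space M"
  by (simp add: ref_def)

lemma lik_ratio_pos [simp]: "lik_ratio y \<theta> > 0" "lik_ratio y \<theta> \<ge> 0" "lik_ratio y \<theta> \<noteq> 0"
  by (simp_all add: lik_ratio_def)

lemma L_lik_ratio: "L y \<theta> = h y * lik_ratio y \<theta>"
  by (simp add: lik_ratio_def L_eq)

lemma s_measurable_ref [measurable]: "s \<in> borel_measurable ref"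
  by (simp add: ref_def)

lemma lik_ratio_measurable [measurable]: "(\<lambda>y. lik_ratio y \<theta>) \<in> borel_measurable M" "(\<lambda>\<theta>.
    lik_ratio y \<theta>) \<in> borel_measurable borel"
  unfolding lik_ratio_def by measurable

lemma lik_ratio_measurable_pair [measurable]:
  assumes [measurable_cong, simp]: "sets q = sets borel"
  shows "(\<lambda>(\<theta>, y). lik_ratio y \<theta>) \<in> borel_measurable (q \<Otimes>\<^sub>M ref)"
    "(\<lambda>(\<theta>, y). lik_ratio y \<theta>) \<in> borel_measurable (q \<Otimes>\<^sub>M M)"
  unfolding lik_ratio_def by measurable

lemma nn_integral_ref:
  assumes [measurable]: "f \<in> borel_measurable M"
  shows "(\<integral>\<^sup>+y. f y \<partial>ref) = (\<integral>\<^sup>+y. ennreal (h y) * f y \<partial>M)"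
  unfolding ref_def by (rule nn_integral_density) measurable

lemma nn_integral_lik_ratio: "(\<integral>\<^sup>+y. ennreal (lik_ratio y \<theta>) \<partial>ref) = 1"
  using normalized[of \<theta>] by (subst nn_integral_ref) (auto simp: L_lik_ratio ennreal_mult
      less_imp_le[OF h_pos])

lemma prob_space_ref: "prob_space ref"
proof
  have "emeasure ref (space ref) = (\<integral>\<^sup>+y. ennreal (lik_ratio y 0) \<partial>ref)"
    by (simp add: lik_ratio_def)
  then show "emeasure ref (space ref) = 1" by (simp add: nn_integral_lik_ratio)
qed

interpretation ref: prob_space ref by (rule prob_space_ref)

definition cond_law where "cond_law \<theta> = density ref (\<lambda>y. ennreal (lik_ratio y \<theta>))"

lemma sets_cond_law [measurable_cong, simp]: "sets (cond_law \<theta>) = sets M"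
  by (simp add: cond_law_def)

lemma prob_space_cond_law: "prob_space (cond_law \<theta>)"
proof
  have "emeasure (cond_law \<theta>) (space (cond_law \<theta>)) = (\<integral>\<^sup>+y. ennreal (lik_ratio y \<theta>) * indicator
      (space ref) y \<partial>ref)"
    unfolding cond_law_def by (subst emeasure_density) auto
  also have "\<dots> = (\<integral>\<^sup>+y. ennreal (lik_ratio y \<theta>) \<partial>ref)"
    by (intro nn_integral_cong) simp
  finally show "emeasure (cond_law \<theta>) (space (cond_law \<theta>)) = 1" by (simp add: nn_integral_lik_ratio)
qed

text \<open>Multiplying the likelihood at \<theta> by an exponential of \<open>s\<close> in
  direction \<open>u\<close> gives, up to a constant, the likelihood at \<theta> + u, which has mass
  1. So \<open>s\<close> has the moment generating function of a Gaussian with mean G \<theta> and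
  covariance \<open>G\<close>.\<close>

lemma cond_law_mgf:
  "(\<integral>\<^sup>+y. ennreal (exp (inner u (s y - G *v \<theta>))) \<partial>cond_law \<theta>) = ennreal (exp (inner u (G *v u) /
      2))"
proof -
  have eq: "lik_ratio y \<theta> * exp (inner u (s y - G *v \<theta>)) = exp (inner u (G *v u) / 2) * lik_ratio
      y (\<theta> + u)" for y
    using inner_matrix_sym[OF G_sym, of u \<theta>]
    by (simp add: lik_ratio_def exp_add[symmetric] matrix_vector_right_distrib inner_add_left
        inner_add_right
        inner_diff_right inner_commute[of u "s y"] field_simps)
  have "(\<integral>\<^sup>+y. ennreal (exp (inner u (s y - G *v \<theta>))) \<partial>cond_law \<theta>)
     = (\<integral>\<^sup>+y. ennreal (lik_ratio y \<theta>) * ennreal (exp (inner u (s y - G *v \<theta>))) \<partial>ref)"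
    unfolding cond_law_def by (rule nn_integral_density) measurable
  also have "\<dots> = (\<integral>\<^sup>+y. ennreal (exp (inner u (G *v u) / 2)) * ennreal (lik_ratio y (\<theta> + u)) \<partial>ref)"
    by (simp add: ennreal_mult[symmetric] eq)
  also have "\<dots> = ennreal (exp (inner u (G *v u) / 2))"
    by (subst nn_integral_cmult) (auto simp: nn_integral_lik_ratio)
  finally show ?thesis .
qed

lemma cond_law_moments:
  "integrable (cond_law \<theta>) (\<lambda>y. inner u (s y))"
  "(\<integral>y. inner u (s y) \<partial>cond_law \<theta>) = inner u (G *v \<theta>)"
  "integrable (cond_law \<theta>) (\<lambda>y. inner u (s y - G *v \<theta>) * inner v (s y - G *v \<theta>))"
  "(\<integral>y. inner u (s y - G *v \<theta>) * inner v (s y - G *v \<theta>) \<partial>cond_law \<theta>) = inner u (G *v v)"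
proof -
  interpret t: prob_space "cond_law \<theta>" by (rule prob_space_cond_law)
  have [measurable]: "(\<lambda>y. s y - G *v \<theta>) \<in> borel_measurable (cond_law \<theta>)" by measurable
  note m = gaussian_mgf_vec_moments[OF prob_space_cond_law this G_sym cond_law_mgf]
  show "integrable (cond_law \<theta>) (\<lambda>y. inner u (s y - G *v \<theta>) * inner v (s y - G *v \<theta>))"
    "(\<integral>y. inner u (s y - G *v \<theta>) * inner v (s y - G *v \<theta>) \<partial>cond_law \<theta>) = inner u (G *v v)"
    by (rule m)+
  have eq: "inner u (s y) = inner u (s y - G *v \<theta>) + inner u (G *v \<theta>)" for y
    by (simp add: inner_diff_right)
  show "integrable (cond_law \<theta>) (\<lambda>y. inner u (s y))"
    unfolding eq[abs_def] using m(1)[of u] by simp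
  show "(\<integral>y. inner u (s y) \<partial>cond_law \<theta>) = inner u (G *v \<theta>)"
    by (subst eq, subst Bochner_Integration.integral_add) (use m(1,2)[of u] in \<open>simp_all add:
        t.prob_space\<close>)
qed

text \<open>Covariance plus product of the means. The centre \<open>c\<close> is kept free: c = 0
  serves the norm of \<open>s\<close>, and c = G m serves a prior centred at
  \<open>m\<close>.\<close>

lemma cond_law_second_moments:
  "integrable (cond_law \<theta>) (\<lambda>y. inner u (s y - c) * inner v (s y - c))"
  "(\<integral>y. inner u (s y - c) * inner v (s y - c) \<partial>cond_law \<theta>)
    = inner u (G *v v) + inner u (G *v \<theta> - c) * inner v (G *v \<theta> - c)"
proof -
  interpret t: prob_space "cond_law \<theta>" by (rule prob_space_cond_law)
  note m = cond_law_moments[of \<theta>]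
  define d where "d = G *v \<theta> - c"
  have eq: "inner u (s y - c) * inner v (s y - c)
      = inner u (s y - G *v \<theta>) * inner v (s y - G *v \<theta>)
        + (inner v d * inner u (s y) + inner u d * inner v (s y))
        + (inner u d * inner v d - inner v d * inner u (G *v \<theta>) - inner u d * inner v (G *v \<theta>))"
            for y
    by (simp add: d_def inner_diff_right algebra_simps)
  show "integrable (cond_law \<theta>) (\<lambda>y. inner u (s y - c) * inner v (s y - c))"
    unfolding eq using m by (intro Bochner_Integration.integrable_add integrable_mult_right
        t.integrable_const) auto
  have "(\<integral>y. inner u (s y - c) * inner v (s y - c) \<partial>cond_law \<theta>)
     = inner u (G *v v) + (inner v d * inner u (G *v \<theta>) + inner u d * inner v (G *v \<theta>))
        + (inner u d * inner v d - inner v d * inner u (G *v \<theta>) - inner u d * inner v (G *v \<theta>))"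
    unfolding eq using m by (simp add: t.prob_space)
  then show "(\<integral>y. inner u (s y - c) * inner v (s y - c) \<partial>cond_law \<theta>)
    = inner u (G *v v) + inner u (G *v \<theta> - c) * inner v (G *v \<theta> - c)"
    by (simp add: d_def)
qed

lemma cond_law_0: "cond_law 0 = ref"
  by (simp add: cond_law_def lik_ratio_def density_1)

text \<open>\<open>G\<close> is the covariance matrix of \<open>s\<close> under
  \<open>ref\<close>.\<close>

lemma G_psd: "inner u (G *v u) \<ge> 0"
proof -
  have "0 \<le> (\<integral>y. inner u (s y - 0) * inner u (s y - 0) \<partial>cond_law 0)" by (rule integral_nonneg_AE)
      simp
  then show ?thesis unfolding cond_law_second_moments by simp
qed

section \<open>The kernel of the information matrix and bounds uniform in the parameter\<close>

lemma AE_inner_s_eq_0_iff: "(AE y in ref. inner u (s y) = 0) \<longleftrightarrow> inner u (G *v u) = 0"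
proof -
  have "(\<integral>y. inner u (s y - 0) * inner u (s y - 0) \<partial>cond_law 0) = 0
     \<longleftrightarrow> (AE y in cond_law 0. inner u (s y - 0) * inner u (s y - 0) = 0)"
    by (rule integral_nonneg_eq_0_iff_AE[OF cond_law_second_moments(1)]) simp
  then show ?thesis using cond_law_second_moments(2)[of 0 u 0 u] unfolding cond_law_0 by simp
qed

text \<open>This is the kernel of \<open>G\<close>, described through the statistic so that the
  almost sure orthogonality of \<open>s\<close> to it can be read off.\<close>

definition null_dirs where "null_dirs = {u. AE y in ref. inner u (s y) = 0}"

lemma subspace_null_dirs: "subspace null_dirs"
  unfolding subspace_def null_dirs_def
  by (auto simp: inner_add_left elim: AE_mp)

lemma null_dirs_G: "u \<in> null_dirs \<Longrightarrow> G *v u = 0"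
proof -
  assume u: "u \<in> null_dirs"
  have "inner v (G *v u) = 0" for v
  proof -
    have "inner v (G *v u) = (\<integral>y. inner v (s y) * inner u (s y) \<partial>ref)"
      using cond_law_second_moments(2)[of 0 v 0 u] by (simp add: cond_law_0
          matrix_vector_mult_0_right)
    also have "\<dots> = (\<integral>y. 0 \<partial>ref)"
      using u by (intro integral_cong_AE) (auto simp: null_dirs_def)
    finally show ?thesis by simp
  qed
  then show ?thesis by (metis inner_eq_zero_iff)
qed

text \<open>The exceptional set must not depend on \<open>u\<close>. A finite basis of the kernel
  reduces the uncountably many directions to finitely many null sets.\<close>

lemma AE_null_dirs: "AE y in ref. \<forall>u\<in>null_dirs. inner u (s y) = 0"
proof -
  obtain B where B: "B \<subseteq> null_dirs" "independent B" "null_dirs \<subseteq> span B"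
    using basis_exists[of null_dirs] by metis
  have "finite B" using B(2) by (rule independent_imp_finite)
  then have "AE y in ref. \<forall>b\<in>B. inner b (s y) = 0"
    using B(1) by (intro AE_finite_allI) (auto simp: null_dirs_def)
  then show ?thesis
  proof eventually_elim
    case (elim y)
    have "Linear_Algebra.orthogonal (s y) u" if "u \<in> span B" for u
      by (rule orthogonal_to_span[OF that]) (use elim in \<open>simp add: Linear_Algebra.orthogonal_def
          inner_commute\<close>)
    then show ?case using B(3) by (auto simp: Linear_Algebra.orthogonal_def inner_commute)
  qed
qed

text \<open>The form is positive on the orthogonal complement of the kernel, and its minimum over
  the compact unit sphere there is attained; scaling does the rest.\<close>

lemma G_coercive:
  obtains k where "k > 0" "\<And>u. (\<And>v. v \<in> null_dirs \<Longrightarrow> inner v u = 0) \<Longrightarrow> k * (norm u)\<^sup>2 \<le> inner u (G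
      *v u)"
proof -
  define V where "V = {u. \<forall>v\<in>null_dirs. inner v u = 0}"
  define K where "K = V \<inter> sphere 0 1"
  have "V = (\<Inter>v\<in>null_dirs. {u. inner v u = 0})" by (auto simp: V_def)
  then have "closed V" by (simp add: closed_hyperplane closed_INT)
  then have K: "compact K" by (simp add: K_def closed_Int_compact)
  have pos: "inner u (G *v u) > 0" if "u \<in> K" for u
  proof -
    have "u \<notin> null_dirs" using that unfolding K_def V_def by force
    then show ?thesis using G_psd[of u] AE_inner_s_eq_0_iff[of u] by (auto simp: null_dirs_def
        less_le)
  qed
  have "\<exists>k>0. \<forall>u\<in>K. k \<le> inner u (G *v u)"
  proof (cases "K = {}")
    case False
    have "continuous_on K (\<lambda>u. inner u (G *v u))"
      by (intro continuous_intros linear_continuous_on matrix_vector_mul_bounded_linear)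
    from continuous_attains_inf[OF K False this] show ?thesis using pos by blast
  \<comment> \<open>If the complement is trivial there are no unit vectors in it, and any positive
    constant will do.\<close>
  qed (auto intro: exI[of _ 1])
  then obtain k where k: "k > 0" "\<And>u. u \<in> K \<Longrightarrow> k \<le> inner u (G *v u)" by blast
  show thesis
  proof (rule that[OF k(1)])
    fix u assume u: "\<And>v. v \<in> null_dirs \<Longrightarrow> inner v u = 0"
    show "k * (norm u)\<^sup>2 \<le> inner u (G *v u)"
    proof (cases "u = 0")
      case False
      then have "u /\<^sub>R norm u \<in> K" using u by (auto simp: K_def V_def)
      from k(2)[OF this] have "k \<le> inner u (G *v u) / (norm u)\<^sup>2"
        by (simp add: matrix_vector_mult_scaleR power2_eq_square divide_inverse mult_ac)
      then show ?thesis using False by (simp add: pos_le_divide_eq)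
    qed simp
  qed
qed

text \<open>On the complement of the kernel the exponent is at most |s| t - k t^2 / 2 with t the
  norm of the parameter, and the maximum of this over \<open>t\<close> is |s|^2 / (2 k). One null
  set serves all parameters.\<close>

lemma lik_ratio_bound:
  obtains C where "C \<ge> 0" "AE y in ref. \<forall>\<theta>. lik_ratio y \<theta> \<le> exp (C * (norm (s y))\<^sup>2)"
proof -
  obtain k where k: "k > 0"
    "\<And>u. (\<And>v. v \<in> null_dirs \<Longrightarrow> inner v u = 0) \<Longrightarrow> k * (norm u)\<^sup>2 \<le> inner u (G *v u)"
    by (rule G_coercive) blast
  show thesis
  proof (rule that)
    show "1 / (2 * k) \<ge> 0" using k by simp
    show "AE y in ref. \<forall>\<theta>. lik_ratio y \<theta> \<le> exp (1 / (2 * k) * (norm (s y))\<^sup>2)"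
      using AE_null_dirs
    proof eventually_elim
      case (elim y)
      show ?case
      proof
        fix \<theta>
        \<comment> \<open>The kernel part \<open>u\<close> drops out of both terms of the exponent;
          coercivity applies to \<open>v\<close>.\<close>
        obtain u v where uv: "u \<in> span null_dirs" "\<And>w. w \<in> span null_dirs \<Longrightarrow>
            Linear_Algebra.orthogonal v w" "\<theta> = u + v"
          using orthogonal_subspace_decomp_exists[of null_dirs \<theta>] by metis
        have sp: "span null_dirs = null_dirs" using subspace_null_dirs by (simp add: span_eq_iff)
        have u: "u \<in> null_dirs" using uv(1) sp by simp
        have v: "k * (norm v)\<^sup>2 \<le> inner v (G *v v)"
          using uv(2) sp by (intro k(2)) (auto simp: Linear_Algebra.orthogonal_def inner_commute)
        have Gu: "G *v u = 0" by (rule null_dirs_G[OF u])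
        have "inner u (G *v v) = 0" using inner_matrix_sym[OF G_sym, of u v] Gu by simp
        then have 1: "inner \<theta> (G *v \<theta>) = inner v (G *v v)"
          unfolding uv(3) by (simp add: matrix_vector_right_distrib Gu inner_add_left
              inner_add_right)
        have "inner (s y) \<theta> = inner (s y) v"
          unfolding uv(3) using elim u by (simp add: inner_add_right inner_commute)
        also have "\<dots> \<le> norm (s y) * norm v" by (rule norm_cauchy_schwarz)
        also have "\<dots> \<le> (norm (s y))\<^sup>2 / (2 * k) + k * (norm v)\<^sup>2 / 2" by (rule quadratic_le[OF
            k(1)])
        finally show "lik_ratio y \<theta> \<le> exp (1 / (2 * k) * (norm (s y))\<^sup>2)"
          unfolding lik_ratio_def 1 using v by simp
      qed
    qed
  qed
qed

end

section \<open>Information gain in terms of the evidence\<close>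

context gauss_family
begin

interpretation ref: prob_space ref by (rule prob_space_ref)

context
  fixes q :: "(real ^ 'n) measure"
  assumes q: "prob_space q" and sets_q [measurable_cong, simp]: "sets q = sets borel"
begin

interpretation q: prob_space q by (rule q)
interpretation qr: pair_prob_space q ref ..

lemma sets_joint [measurable_cong, simp]: "sets (joint q) = sets (q \<Otimes>\<^sub>M ref)"
  by (simp add: joint_def)

lemma borel_measurable_lik_ratio_q [measurable]: "(\<lambda>\<theta>. lik_ratio y \<theta>) \<in> borel_measurable q"
  by (simp add: lik_ratio_measurable(2) measurable_cong_sets[OF sets_q refl])

lemma lik_ratio_measurable_joint [measurable]: "(\<lambda>x. lik_ratio (snd x) (fst x)) \<in> borel_measurable
    (q \<Otimes>\<^sub>M ref)"
  using lik_ratio_measurable_pair(1)[OF sets_q] by (simp add: case_prod_unfold)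

lemma evid_measurable [measurable]: "evid q \<in> borel_measurable ref"
proof -
  have "(\<lambda>y. \<integral>\<theta>. lik_ratio y \<theta> \<partial>q) \<in> borel_measurable ref"
    by (rule q.borel_measurable_lebesgue_integral)
      (use lik_ratio_measurable_joint in \<open>simp add: measurable_pair_swap_iff[of _ ref q]
          case_prod_unfold\<close>)
  then show ?thesis unfolding evid_def[abs_def] .
qed

lemma nn_integral_joint:
  assumes [measurable]: "f \<in> borel_measurable (q \<Otimes>\<^sub>M ref)"
  shows "(\<integral>\<^sup>+x. f x \<partial>joint q) = (\<integral>\<^sup>+\<theta>. (\<integral>\<^sup>+y. f (\<theta>, y) \<partial>cond_law \<theta>) \<partial>q)"
proof -
  have "(\<integral>\<^sup>+x. f x \<partial>joint q) = (\<integral>\<^sup>+x. ennreal (lik_ratio (snd x) (fst x)) * f x \<partial>(q \<Otimes>\<^sub>M ref))"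
    unfolding joint_def case_prod_unfold by (rule nn_integral_density) measurable
  also have "\<dots> = (\<integral>\<^sup>+\<theta>. (\<integral>\<^sup>+y. ennreal (lik_ratio y \<theta>) * f (\<theta>, y) \<partial>ref) \<partial>q)"
    by (subst ref.nn_integral_fst[symmetric]) auto
  also have "\<dots> = (\<integral>\<^sup>+\<theta>. (\<integral>\<^sup>+y. f (\<theta>, y) \<partial>cond_law \<theta>) \<partial>q)"
    unfolding cond_law_def
    by (intro nn_integral_cong nn_integral_density[symmetric]) (auto intro!: measurable_Pair2)
  finally show ?thesis .
qed

lemma prob_space_joint: "prob_space (joint q)"
proof
  have "emeasure (joint q) (space (joint q)) = (\<integral>\<^sup>+x. 1 \<partial>joint q)" by simp
  also have "\<dots> = (\<integral>\<^sup>+\<theta>. (\<integral>\<^sup>+y. 1 \<partial>cond_law \<theta>) \<partial>q)" by (rule nn_integral_joint) simp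
  also have "\<dots> = 1"
    using prob_space.emeasure_space_1[OF prob_space_cond_law] q.emeasure_space_1 by simp
  finally show "emeasure (joint q) (space (joint q)) = 1" .
qed

lemma AE_joint_snd:
  assumes "AE y in ref. P y"
  shows "AE x in joint q. P (snd x)"
proof -
  have "AE x in q \<Otimes>\<^sub>M ref. P (snd x)"
    by (rule AE_pair_snd[OF ref.sigma_finite_measure_axioms assms])
  then show ?thesis
    unfolding joint_def case_prod_unfold by (subst AE_density) auto
qed

lemma integral_joint_fst:
  assumes f: "integrable (joint q) (\<lambda>x. f (fst x) (snd x) :: real)"
  shows "(\<integral>x. f (fst x) (snd x) \<partial>joint q) = (\<integral>\<theta>. (\<integral>y. f \<theta> y \<partial>cond_law \<theta>) \<partial>q)"
proof -
  have [measurable]: "(\<lambda>x. f (fst x) (snd x)) \<in> borel_measurable (q \<Otimes>\<^sub>M ref)"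
    using borel_measurable_integrable[OF f] by (simp cong: measurable_cong_sets)
  have i: "integrable (q \<Otimes>\<^sub>M ref) (\<lambda>(\<theta>, y). lik_ratio y \<theta> * f \<theta> y)"
    using f unfolding joint_def case_prod_unfold by (subst (asm) integrable_density) auto
  have "(\<integral>x. f (fst x) (snd x) \<partial>joint q) = (\<integral>(\<theta>, y). lik_ratio y \<theta> * f \<theta> y \<partial>(q \<Otimes>\<^sub>M ref))"
    unfolding joint_def case_prod_unfold by (subst integral_density) auto
  also have "\<dots> = (\<integral>\<theta>. (\<integral>y. lik_ratio y \<theta> * f \<theta> y \<partial>ref) \<partial>q)"
    by (rule qr.integral_fst[OF i, symmetric])
  also have "\<dots> = (\<integral>\<theta>. (\<integral>y. f \<theta> y \<partial>cond_law \<theta>) \<partial>q)"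
  proof (rule Bochner_Integration.integral_cong[OF refl])
    fix \<theta> assume "\<theta> \<in> space q"
    then have [measurable]: "f \<theta> \<in> borel_measurable ref"
      using measurable_Pair2[of "\<lambda>x. f (fst x) (snd x)" q ref borel \<theta>] by simp
    show "(\<integral>y. lik_ratio y \<theta> * f \<theta> y \<partial>ref) = (\<integral>y. f \<theta> y \<partial>cond_law \<theta>)"
      unfolding cond_law_def by (subst integral_density) auto
  qed
  finally show ?thesis .
qed

text \<open>The marginal law of \<open>y\<close> has density \<open>evid q\<close> with respect to
  \<open>ref\<close>. This turns integrals under laws that vary with the prior into integrals over
  one fixed measure.\<close>

lemma integral_joint_snd:
  assumes f: "integrable (joint q) (\<lambda>x. f (snd x) :: real)" and [measurable]: "f \<in>
      borel_measurable ref"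
  shows "integrable ref (\<lambda>y. evid q y * f y)"
    and "(\<integral>x. f (snd x) \<partial>joint q) = (\<integral>y. evid q y * f y \<partial>ref)"
proof -
  have i: "integrable (q \<Otimes>\<^sub>M ref) (\<lambda>(\<theta>, y). lik_ratio y \<theta> * f y)"
    using f unfolding joint_def case_prod_unfold by (subst (asm) integrable_density) auto
  show "integrable ref (\<lambda>y. evid q y * f y)"
    using qr.integrable_snd[OF i] by (simp add: evid_def)
  have "(\<integral>x. f (snd x) \<partial>joint q) = (\<integral>(\<theta>, y). lik_ratio y \<theta> * f y \<partial>(q \<Otimes>\<^sub>M ref))"
    unfolding joint_def case_prod_unfold by (subst integral_density) auto
  also have "\<dots> = (\<integral>y. evid q y * f y \<partial>ref)"
    using qr.integral_snd[OF i] by (simp add: evid_def)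
  finally show "(\<integral>x. f (snd x) \<partial>joint q) = (\<integral>y. evid q y * f y \<partial>ref)" .
qed

text \<open>The factor \<open>h\<close> moves from the likelihood into the dominating measure and
  cancels inside the logarithm.\<close>

lemma info_gain_eq_joint:
  "info_gain M L q = (\<integral>x. ln (lik_ratio (snd x) (fst x) / evid q (snd x)) \<partial>joint q)"
proof -
  have "density q (\<lambda>_. 1) \<Otimes>\<^sub>M ref = density (q \<Otimes>\<^sub>M M) (\<lambda>(\<theta>, y). 1 * ennreal (h y))"
    unfolding ref_def
    by (rule pair_measure_density)
      (use sigma_finite_measure_axioms ref.sigma_finite_measure_axioms in \<open>auto simp: ref_def\<close>)
  then have qref: "q \<Otimes>\<^sub>M ref = density (q \<Otimes>\<^sub>M M) (\<lambda>x. ennreal (h (snd x)))"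
    by (simp add: density_1 case_prod_unfold)
  have "joint q = density (q \<Otimes>\<^sub>M M) (\<lambda>x. ennreal (h (snd x)) * ennreal (lik_ratio (snd x) (fst x)))"
    using lik_ratio_measurable_pair(2)[OF sets_q]
    unfolding joint_def qref case_prod_unfold by (subst density_density_eq) auto
  also have "(\<lambda>x. ennreal (h (snd x)) * ennreal (lik_ratio (snd x) (fst x))) = (\<lambda>(\<theta>, y). ennreal
      (L y \<theta>))"
    by (auto simp: L_lik_ratio ennreal_mult less_imp_le[OF h_pos])
  finally have j: "density (q \<Otimes>\<^sub>M M) (\<lambda>(\<theta>, y). ennreal (L y \<theta>)) = joint q" ..
  have "L y \<theta> / (\<integral>\<theta>'. L y \<theta>' \<partial>q) = lik_ratio y \<theta> / evid q y" for y \<theta>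
    using h_pos[of y] by (simp add: L_lik_ratio evid_def)
  then show ?thesis
    unfolding info_gain_def j by (simp add: case_prod_unfold)
qed

text \<open>For almost every \<open>y\<close> the ratio is bounded in the parameter, hence
  integrable. Only then is the evidence a genuine integral instead of the default 0, and its
  logarithm meaningful.\<close>

lemma AE_integrable_lik_ratio: "AE y in ref. integrable q (lik_ratio y) \<and> evid q y > 0"
proof -
  obtain C where "AE y in ref. \<forall>\<theta>. lik_ratio y \<theta> \<le> exp (C * (norm (s y))\<^sup>2)"
    using lik_ratio_bound by blast
  then show ?thesis
  proof eventually_elim
    case (elim y)
    have i: "integrable q (lik_ratio y)"
      by (rule q.integrable_const_bound[of _ "exp (C * (norm (s y))\<^sup>2)"]) (use elim in auto)
    have "evid q y > 0"
      unfolding evid_def using i by (subst q.integral_less_AE_space[of "\<lambda>_. 0", simplified]) (auto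
          simp: q.emeasure_space_1)
    with i show ?case by simp
  qed
qed

end

text \<open>\<open>C\<close> is chosen before \<open>q\<close> and \<open>m\<close>: it depends on
  the family alone, so a common bound on the second moments makes the estimate uniform along a
  sequence of priors.\<close>

lemma AE_ln_evid_bound:
  obtains C where "C \<ge> 0"
    "\<And>q m. prior2 q \<Longrightarrow> (\<integral>\<theta>. (norm \<theta>)\<^sup>2 \<partial>q) \<le> m \<Longrightarrow> AE y in ref. \<bar>ln (evid q y)\<bar> \<le> C * (1 + m) * (1 +
        (norm (s y))\<^sup>2)"
proof -
  obtain C where C: "C \<ge> 0" "AE y in ref. \<forall>\<theta>. lik_ratio y \<theta> \<le> exp (C * (norm (s y))\<^sup>2)"
    by (rule lik_ratio_bound)
  define D where "D = onorm ((*v) G)"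
  have D: "D \<ge> 0" unfolding D_def by (rule onorm_matrix_nonneg)
  have GD: "inner \<theta> (G *v \<theta>) \<le> D * (norm \<theta>)\<^sup>2" for \<theta>
    using abs_inner_matrix_le[of \<theta> G \<theta>] unfolding D_def by (simp add: power2_eq_square)
  show thesis
  proof (rule that)
    show "C + D + 1 \<ge> 0" using C D by simp
    fix q :: "(real ^ 'n) measure" and m :: real
    assume q: "prior2 q" and m: "(\<integral>\<theta>. (norm \<theta>)\<^sup>2 \<partial>q) \<le> m"
    have sets_q [measurable_cong, simp]: "sets q = sets borel" and i2: "integrable q (\<lambda>\<theta>. (norm
        \<theta>)\<^sup>2)"
      using q by (auto simp: prior2_def)
    interpret q: prob_space q using q by (simp add: prior2_def)
    have "0 \<le> (\<integral>\<theta>. (norm \<theta>)\<^sup>2 \<partial>q)" by (rule integral_nonneg_AE) simp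
    with m have m0: "m \<ge> 0" by linarith
    show "AE y in ref. \<bar>ln (evid q y)\<bar> \<le> (C + D + 1) * (1 + m) * (1 + (norm (s y))\<^sup>2)"
      using C(2) AE_integrable_lik_ratio[OF q.prob_space_axioms sets_q]
    proof eventually_elim
      case (elim y)
      define X where "X \<theta> = inner (s y) \<theta> - inner \<theta> (G *v \<theta>) / 2" for \<theta>
      have tX: "lik_ratio y \<theta> = exp (X \<theta>)" for \<theta> by (simp add: X_def lik_ratio_def)
      have [measurable]: "X \<in> borel_measurable q" unfolding X_def by measurable
      have Xb: "\<bar>X \<theta>\<bar> \<le> (norm (s y))\<^sup>2 / 2 + (1 + D) / 2 * (norm \<theta>)\<^sup>2" for \<theta>
      proof -
        have "\<bar>inner (s y) \<theta>\<bar> \<le> norm (s y) * norm \<theta>" by (rule Cauchy_Schwarz_ineq2)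
        also have "\<dots> \<le> (norm (s y))\<^sup>2 / 2 + (norm \<theta>)\<^sup>2 / 2"
          using quadratic_le[of 1 "norm (s y)" "norm \<theta>"] by simp
        finally show ?thesis
          using G_psd[of \<theta>] GD[of \<theta>] unfolding X_def by (simp add: add_divide_distrib
              distrib_right abs_le_iff)
      qed
      have iX: "integrable q X"
        by (rule Bochner_Integration.integrable_bound[of _ "\<lambda>\<theta>. (norm (s y))\<^sup>2 / 2 + (1 + D) / 2 *
            (norm \<theta>)\<^sup>2"])
          (use i2 Xb D in \<open>auto intro!: AE_I2 simp: abs_of_nonneg\<close>)
      \<comment> \<open>Jensen's inequality for the exponential; the exponent \<open>X\<close> is
        quadratic in the parameter, so its mean is controlled by \<open>m\<close>.\<close>
      have "exp (integral\<^sup>L q X) \<le> (\<integral>\<theta>. exp (X \<theta>) \<partial>q)"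
        by (rule q.jensens_inequality[OF iX, of UNIV 0 0 exp]) (use elim in \<open>auto simp:
            tX[symmetric] exp_convex\<close>)
      then have "exp (integral\<^sup>L q X) \<le> evid q y" by (simp add: evid_def tX)
      then have low: "integral\<^sup>L q X \<le> ln (evid q y)" using elim by (simp add: ln_ge_iff)
      have "\<bar>integral\<^sup>L q X\<bar> \<le> (\<integral>\<theta>. \<bar>X \<theta>\<bar> \<partial>q)" by (rule integral_abs_bound)
      also have "\<dots> \<le> (\<integral>\<theta>. (norm (s y))\<^sup>2 / 2 + (1 + D) / 2 * (norm \<theta>)\<^sup>2 \<partial>q)"
        using iX i2 Xb by (intro integral_mono) auto
      also have "\<dots> = (norm (s y))\<^sup>2 / 2 + (1 + D) / 2 * (\<integral>\<theta>. (norm \<theta>)\<^sup>2 \<partial>q)"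
        using i2 by (simp add: q.prob_space)
      also have "\<dots> \<le> (norm (s y))\<^sup>2 / 2 + (1 + D) / 2 * m"
        using m D by (intro add_left_mono mult_left_mono) auto
      finally have a: "\<bar>integral\<^sup>L q X\<bar> \<le> (norm (s y))\<^sup>2 / 2 + (1 + D) / 2 * m" .
      have "evid q y \<le> (\<integral>\<theta>. exp (C * (norm (s y))\<^sup>2) \<partial>q)"
        unfolding evid_def using elim by (intro integral_mono) auto
      then have "evid q y \<le> exp (C * (norm (s y))\<^sup>2)" by (simp add: q.prob_space)
      then have up: "ln (evid q y) \<le> C * (norm (s y))\<^sup>2"
        using elim ln_mono[of "evid q y" "exp (C * (norm (s y))\<^sup>2)"] by simp
      define S where "S = (norm (s y))\<^sup>2"
      have S: "S \<ge> 0" by (simp add: S_def)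
      \<comment> \<open>Every monomial of the expanded product is nonnegative, so both estimates
        become linear in these monomials.\<close>
      have n: "0 \<le> C * S" "0 \<le> C * m" "0 \<le> D * S" "0 \<le> D * m" "0 \<le> S * m" "0 \<le> C * (S * m)" "0 \<le> D
          * (S * m)"
        using C(1) D m0 S by simp_all
      have "(C + D + 1) * (1 + m) * (1 + S)
          = C + D + 1 + S + m + C * S + C * m + D * S + D * m + S * m + C * (S * m) + D * (S * m)"
        by (simp add: algebra_simps)
      moreover have "(1 + D) / 2 * m = m / 2 + D * m / 2" by (simp add: algebra_simps
          add_divide_distrib)
      ultimately have "S / 2 + (1 + D) / 2 * m \<le> (C + D + 1) * (1 + m) * (1 + S)"
        "C * S \<le> (C + D + 1) * (1 + m) * (1 + S)"
        using n C(1) D m0 S by linarith+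
      then show ?case
        using low up a unfolding S_def by linarith
    qed
  qed
qed

text \<open>Given \<theta>, the statistic has mean G \<theta> and covariance \<open>G\<close>,
  whence the trace and the square. The result is a quadratic functional of \<open>q\<close>, which
  is what passes to the limit later.\<close>

lemma norm_s_joint:
  assumes "prior2 q"
  shows "integrable (joint q) (\<lambda>x. (norm (s (snd x)))\<^sup>2)"
    "(\<integral>x. (norm (s (snd x)))\<^sup>2 \<partial>joint q)
      = (\<Sum>b\<in>Basis. inner b (G *v b)) + (\<integral>\<theta>. (norm (G *v \<theta>))\<^sup>2 \<partial>q)"
    "integrable (joint q) (\<lambda>x. (norm (fst x))\<^sup>2)"
    "integrable q (\<lambda>\<theta>. (norm (G *v \<theta>))\<^sup>2)"
proof -
  have sets_q [measurable_cong, simp]: "sets q = sets borel" and i2: "integrable q (\<lambda>\<theta>. (norm \<theta>)\<^sup>2)"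
    and pq: "prob_space q"
    using assms by (auto simp: prior2_def)
  interpret q: prob_space q by (rule pq)
  note [measurable_cong] = sets_joint[OF pq sets_q]
  show iG: "integrable q (\<lambda>\<theta>. (norm (G *v \<theta>))\<^sup>2)"
  proof (rule Bochner_Integration.integrable_bound)
    show "integrable q (\<lambda>\<theta>. (onorm ((*v) G))\<^sup>2 * (norm \<theta>)\<^sup>2)" using i2 by simp
    show "AE \<theta> in q. norm ((norm (G *v \<theta>))\<^sup>2) \<le> norm ((onorm ((*v) G))\<^sup>2 * (norm \<theta>)\<^sup>2)"
      using norm_matrix_le[of G]
      by (intro AE_I2) (simp add: power_mult_distrib[symmetric] power_mono)
  qed measurable
  have in2: "(\<integral>y. (norm (s y))\<^sup>2 \<partial>cond_law \<theta>) = (\<Sum>b\<in>Basis. inner b (G *v b)) + (norm (G *v \<theta>))\<^sup>2"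
    "integrable (cond_law \<theta>) (\<lambda>y. (norm (s y))\<^sup>2)" for \<theta>
    using cond_law_second_moments[of \<theta> _ 0] unfolding norm_sq_eq_sum_Basis
    by (simp_all add: power2_eq_square sum.distrib)
  have trG: "(\<Sum>b\<in>Basis. inner b (G *v b)) \<ge> 0" by (intro sum_nonneg G_psd)
  have "(\<integral>\<^sup>+x. ennreal ((norm (s (snd x)))\<^sup>2) \<partial>joint q) = (\<integral>\<^sup>+\<theta>. (\<integral>\<^sup>+y. ennreal ((norm (s y))\<^sup>2)
      \<partial>cond_law \<theta>) \<partial>q)"
    by (subst nn_integral_joint[OF pq sets_q]) auto
  also have "\<dots> = (\<integral>\<^sup>+\<theta>. ennreal ((\<Sum>b\<in>Basis. inner b (G *v b)) + (norm (G *v \<theta>))\<^sup>2) \<partial>q)"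
    using in2 by (intro nn_integral_cong) (simp add: nn_integral_eq_integral)
  also have "\<dots> < \<infinity>"
    using iG trG by (subst nn_integral_eq_integral) auto
  finally show i: "integrable (joint q) (\<lambda>x. (norm (s (snd x)))\<^sup>2)"
    by (intro integrableI_nonneg) auto
  show "(\<integral>x. (norm (s (snd x)))\<^sup>2 \<partial>joint q)
      = (\<Sum>b\<in>Basis. inner b (G *v b)) + (\<integral>\<theta>. (norm (G *v \<theta>))\<^sup>2 \<partial>q)"
    using integral_joint_fst[OF pq sets_q, of "\<lambda>\<theta> y. (norm (s y))\<^sup>2"] i iG in2 by (simp add:
        q.prob_space)
  have "(\<integral>\<^sup>+x. ennreal ((norm (fst x))\<^sup>2) \<partial>joint q) = (\<integral>\<^sup>+\<theta>. (\<integral>\<^sup>+y. ennreal ((norm \<theta>)\<^sup>2) \<partial>cond_law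
      \<theta>) \<partial>q)"
    by (subst nn_integral_joint[OF pq sets_q]) auto
  also have "\<dots> = (\<integral>\<^sup>+\<theta>. ennreal ((norm \<theta>)\<^sup>2) \<partial>q)"
    using prob_space.emeasure_space_1[OF prob_space_cond_law] by simp
  also have "\<dots> < \<infinity>" using i2 by (subst nn_integral_eq_integral) auto
  finally show "integrable (joint q) (\<lambda>x. (norm (fst x))\<^sup>2)"
    by (intro integrableI_nonneg) auto
qed

lemma integrable_ln_evid:
  assumes "prior2 q"
  shows "integrable (joint q) (\<lambda>x. ln (evid q (snd x)))"
proof -
  have sets_q [measurable_cong, simp]: "sets q = sets borel" and pq: "prob_space q"
    using assms by (auto simp: prior2_def)
  interpret j: prob_space "joint q" by (rule prob_space_joint[OF pq sets_q])
  note [measurable_cong] = sets_joint[OF pq sets_q]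
  note [measurable] = evid_measurable[OF pq sets_q]
  obtain C0 where C0: "\<And>q m. prior2 q \<Longrightarrow> (\<integral>\<theta>. (norm \<theta>)\<^sup>2 \<partial>q) \<le> m
      \<Longrightarrow> AE y in ref. \<bar>ln (evid q y)\<bar> \<le> C0 * (1 + m) * (1 + (norm (s y))\<^sup>2)"
    by (rule AE_ln_evid_bound) blast
  define C where "C = C0 * (1 + (\<integral>\<theta>. (norm \<theta>)\<^sup>2 \<partial>q))"
  have C: "AE y in ref. \<bar>ln (evid q y)\<bar> \<le> C * (1 + (norm (s y))\<^sup>2)"
    unfolding C_def by (rule C0[OF assms order_refl])
  show ?thesis
  proof (rule Bochner_Integration.integrable_bound)
    show "integrable (joint q) (\<lambda>x. C * (1 + (norm (s (snd x)))\<^sup>2))"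
      using norm_s_joint(1)[OF assms] by simp
    show "AE x in joint q. norm (ln (evid q (snd x))) \<le> norm (C * (1 + (norm (s (snd x)))\<^sup>2))"
      using AE_joint_snd[OF pq sets_q C] by eventually_elim auto
  qed measurable
qed

text \<open>Given \<theta>, the mean of \<open>s\<close> against \<theta> is the full quadratic
  form, half of which the exponent subtracts again. The logarithm may be split because every summand
  is integrable by itself.\<close>

lemma info_gain_eq:
  assumes "prior2 q"
  shows "info_gain M L q = (\<integral>\<theta>. inner \<theta> (G *v \<theta>) \<partial>q) / 2 - (\<integral>x. ln (evid q (snd x)) \<partial>joint q)"
proof -
  have sets_q [measurable_cong, simp]: "sets q = sets borel" and i2: "integrable q (\<lambda>\<theta>. (norm \<theta>)\<^sup>2)"
    and pq: "prob_space q"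
    using assms by (auto simp: prior2_def)
  interpret q: prob_space q by (rule pq)
  interpret j: prob_space "joint q" by (rule prob_space_joint[OF pq sets_q])
  note [measurable_cong] = sets_joint[OF pq sets_q]
  let ?X = "\<lambda>\<theta> y. inner (s y) \<theta> - inner \<theta> (G *v \<theta>) / 2"
  have i1: "integrable (joint q) (\<lambda>x. inner (s (snd x)) (fst x))"
  proof (rule Bochner_Integration.integrable_bound)
    show "integrable (joint q) (\<lambda>x. (norm (s (snd x)))\<^sup>2 / 2 + (norm (fst x))\<^sup>2 / 2)"
      using norm_s_joint[OF assms] by simp
    show "AE x in joint q. norm (inner (s (snd x)) (fst x)) \<le> norm ((norm (s (snd x)))\<^sup>2 / 2 +
        (norm (fst x))\<^sup>2 / 2)"
    proof (intro AE_I2)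
      fix x :: "(real ^ 'n) \<times> 'y"
      have "\<bar>inner (s (snd x)) (fst x)\<bar> \<le> norm (s (snd x)) * norm (fst x)" by (rule
          Cauchy_Schwarz_ineq2)
      also have "\<dots> \<le> (norm (s (snd x)))\<^sup>2 / 2 + (norm (fst x))\<^sup>2 / 2"
        using quadratic_le[of 1 "norm (s (snd x))" "norm (fst x)"] by simp
      finally show "norm (inner (s (snd x)) (fst x)) \<le> norm ((norm (s (snd x)))\<^sup>2 / 2 + (norm (fst
          x))\<^sup>2 / 2)"
        by simp
    qed
  qed measurable
  have i3: "integrable (joint q) (\<lambda>x. inner (fst x) (G *v fst x))"
  proof (rule Bochner_Integration.integrable_bound)
    show "integrable (joint q) (\<lambda>x. onorm ((*v) G) * (norm (fst x))\<^sup>2)"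
      using norm_s_joint[OF assms] by simp
    show "AE x in joint q. norm (inner (fst x) (G *v fst x)) \<le> norm (onorm ((*v) G) * (norm (fst
        x))\<^sup>2)"
      using abs_inner_matrix_le[of "fst _" G "fst _"] onorm_matrix_nonneg[of G]
      by (intro AE_I2) (simp add: power2_eq_square)
  qed measurable
  have "info_gain M L q = (\<integral>x. ?X (fst x) (snd x) - ln (evid q (snd x)) \<partial>joint q)"
    unfolding info_gain_eq_joint[OF pq sets_q]
  proof (rule integral_cong_AE)
    show "AE x in joint q. ln (lik_ratio (snd x) (fst x) / evid q (snd x)) = ?X (fst x) (snd x) -
        ln (evid q (snd x))"
      using AE_joint_snd[OF pq sets_q AE_integrable_lik_ratio[OF pq sets_q]]
      by eventually_elim (simp add: ln_div lik_ratio_def)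
    note [measurable] = evid_measurable[OF pq sets_q] lik_ratio_measurable_joint[OF pq sets_q]
    show "(\<lambda>x. ln (lik_ratio (snd x) (fst x) / evid q (snd x))) \<in> borel_measurable (joint q)" by
        measurable
    show "(\<lambda>x. ?X (fst x) (snd x) - ln (evid q (snd x))) \<in> borel_measurable (joint q)" by measurable
  qed
  also have "\<dots> = (\<integral>x. ?X (fst x) (snd x) \<partial>joint q) - (\<integral>x. ln (evid q (snd x)) \<partial>joint q)"
    using i1 i3 integrable_ln_evid[OF assms] by (intro Bochner_Integration.integral_diff) auto
  also have "(\<integral>x. ?X (fst x) (snd x) \<partial>joint q) = (\<integral>\<theta>. (\<integral>y. ?X \<theta> y \<partial>cond_law \<theta>) \<partial>q)"
    using i1 i3 by (intro integral_joint_fst[OF pq sets_q]) auto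
  also have "\<dots> = (\<integral>\<theta>. inner \<theta> (G *v \<theta>) / 2 \<partial>q)"
  proof (rule Bochner_Integration.integral_cong[OF refl])
    fix \<theta> :: "real ^ 'n"
    interpret t: prob_space "cond_law \<theta>" by (rule prob_space_cond_law)
    show "(\<integral>y. ?X \<theta> y \<partial>cond_law \<theta>) = inner \<theta> (G *v \<theta>) / 2"
      using cond_law_moments(1,2)[of \<theta> \<theta>] by (simp add: inner_commute[of "s _"] t.prob_space)
  qed
  finally show ?thesis by simp
qed

end

section \<open>Information gain under a Gaussian prior\<close>

lemma mposdef_add:
  assumes "mposdef P" "mtr B = B" "\<And>x. inner x (B *v x) \<ge> 0"
  shows "mposdef (P + B)"
  using assms unfolding mposdef_def
  by (auto simp: mtr_def cart_eq_iff
      matrix_vector_mult_add_rdistrib inner_add_right add_pos_nonneg)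

lemma mposdef_idm: "mposdef idm"
  by (simp add: mposdef_def)

lemma sets_std_gaussian [measurable_cong, simp]: "sets (std_gaussian :: (real ^ 'n::finite)
    measure) = sets borel"
  by (simp add: std_gaussian_def)

text \<open>The centred Gaussian law with covariance (I + T)^-1, written as a reweighted standard
  Gaussian: further quadratic weights just add to \<open>T\<close>, and a possibly singular
  \<open>A\<close> enters only by pushing forward.\<close>

definition gauss_tilt :: "real ^ 'n ^ 'n \<Rightarrow> (real ^ 'n::finite) measure" where
  "gauss_tilt T = density std_gaussian (\<lambda>z. ennreal (sqrt (vdet (idm + T)) * exp (- inner z (T *v
      z) / 2)))"

lemma sets_gauss_tilt [measurable_cong, simp]: "sets (gauss_tilt T) = sets borel"
  by (simp add: gauss_tilt_def)

lemma nn_integral_gauss_tilt_exp_quadratic: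
  fixes T B :: "real ^ 'n ^ 'n::finite"
  assumes P: "mposdef (idm + T)" and P': "mposdef (idm + T + B)"
  shows "(\<integral>\<^sup>+z. ennreal (exp (inner u z - inner z (B *v z) / 2)) \<partial>gauss_tilt T)
    = ennreal (sqrt (vdet (idm + T) / vdet (idm + T + B)) * exp (inner u (matrix_inv (idm + T + B)
        *v u) / 2))"
proof -
  have d: "vdet (idm + T) > 0" by (rule nn_integral_gaussian_vec(1)[OF P])
  have eq: "idm + T + B - idm = T + B" by simp
  have "(\<integral>\<^sup>+z. ennreal (exp (inner u z - inner z (B *v z) / 2)) \<partial>gauss_tilt T)
    = (\<integral>\<^sup>+z. ennreal (sqrt (vdet (idm + T)) * exp (- inner z (T *v z) / 2)) * ennreal (exp (inner
        u z - inner z (B *v z) / 2)) \<partial>std_gaussian)"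
    unfolding gauss_tilt_def by (rule nn_integral_density) measurable
  also have "\<dots> = (\<integral>\<^sup>+z. ennreal (sqrt (vdet (idm + T))) * ennreal (exp (inner u z - inner z ((idm
      + T + B - idm) *v z) / 2)) \<partial>std_gaussian)"
    unfolding eq using d
    by (intro nn_integral_cong) (simp add: ennreal_mult[symmetric] mult.assoc exp_add[symmetric]
        matrix_vector_mult_add_rdistrib inner_add_right
        add_divide_distrib)
  also have "\<dots> = ennreal (sqrt (vdet (idm + T))) * ennreal (exp (inner u (matrix_inv (idm + T + B)
      *v u) / 2) / sqrt (vdet (idm + T + B)))"
    by (subst nn_integral_cmult) (simp_all add: nn_integral_std_gaussian_exp_quadratic[OF P',
        unfolded eq] eq)
  also have "\<dots> = ennreal (sqrt (vdet (idm + T) / vdet (idm + T + B)) * exp (inner u (matrix_inv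
      (idm + T + B) *v u) / 2))"
    using d nn_integral_gaussian_vec(1)[OF P'] by (simp add: ennreal_mult[symmetric]
        real_sqrt_divide mult.commute)
  finally show ?thesis .
qed

lemma gauss_tilt_mgf:
  fixes T :: "real ^ 'n ^ 'n::finite"
  assumes P: "mposdef (idm + T)"
  shows "(\<integral>\<^sup>+z. ennreal (exp (inner u z)) \<partial>gauss_tilt T) = ennreal (exp (inner u (matrix_inv (idm
      + T) *v u) / 2))"
  using nn_integral_gauss_tilt_exp_quadratic[OF P, of 0 u] P nn_integral_gaussian_vec(1)[OF P] by
      simp

lemma prob_space_gauss_tilt:
  assumes "mposdef (idm + T)"
  shows "prob_space (gauss_tilt T)"
proof
  have "emeasure (gauss_tilt T) (space (gauss_tilt T)) = (\<integral>\<^sup>+z. ennreal (exp (inner 0 z))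
      \<partial>gauss_tilt T)" by simp
  also have "\<dots> = 1" unfolding gauss_tilt_mgf[OF assms] by simp
  finally show "emeasure (gauss_tilt T) (space (gauss_tilt T)) = 1" .
qed

lemma gauss_tilt_moments:
  fixes T :: "real ^ 'n ^ 'n::finite"
  assumes P: "mposdef (idm + T)"
  shows "integrable (gauss_tilt T) (\<lambda>z. inner u z)" "(\<integral>z. inner u z \<partial>gauss_tilt T) = 0"
    "integrable (gauss_tilt T) (\<lambda>z. inner u z * inner v z)"
    "(\<integral>z. inner u z * inner v z \<partial>gauss_tilt T) = inner u (matrix_inv (idm + T) *v v)"
proof -
  have [measurable]: "(\<lambda>z. z) \<in> borel_measurable (gauss_tilt T)" by measurable
  show "integrable (gauss_tilt T) (\<lambda>z. inner u z)" "(\<integral>z. inner u z \<partial>gauss_tilt T) = 0"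
    "integrable (gauss_tilt T) (\<lambda>z. inner u z * inner v z)"
    "(\<integral>z. inner u z * inner v z \<partial>gauss_tilt T) = inner u (matrix_inv (idm + T) *v v)"
    by (rule gaussian_mgf_vec_moments[OF prob_space_gauss_tilt[OF P] \<open>(\<lambda>z. z) \<in> _\<close>
        mposdef_matrix_inv(3)[OF P] gauss_tilt_mgf[OF P]])+
qed

lemma integrable_gauss_tilt_norm_sq:
  assumes P: "mposdef (idm + T)"
  shows "integrable (gauss_tilt T) (\<lambda>z. (norm z)\<^sup>2)"
  using gauss_tilt_moments(3)[OF P] by (simp add: norm_sq_eq_sum_Basis power2_eq_square[of "inner
      _ _"])

lemma prior2_affine_gauss_tilt:
  fixes T A :: "real ^ 'n ^ 'n::finite"
  assumes P: "mposdef (idm + T)"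
  shows "prior2 (distr (gauss_tilt T) borel (\<lambda>z. m + A *v z))"
proof -
  interpret g: prob_space "gauss_tilt T" by (rule prob_space_gauss_tilt[OF P])
  have [measurable]: "(\<lambda>z. m + A *v z) \<in> borel_measurable (gauss_tilt T)" by measurable
  have "integrable (gauss_tilt T) (\<lambda>z. (norm (m + A *v z))\<^sup>2)"
  proof (rule Bochner_Integration.integrable_bound)
    show "integrable (gauss_tilt T) (\<lambda>z. 2 * (norm m)\<^sup>2 + 2 * ((onorm ((*v) A))\<^sup>2 * (norm z)\<^sup>2))"
      using integrable_gauss_tilt_norm_sq[OF P] by simp
    show "AE z in gauss_tilt T. norm ((norm (m + A *v z))\<^sup>2) \<le> norm (2 * (norm m)\<^sup>2 + 2 * ((onorm
        ((*v) A))\<^sup>2 * (norm z)\<^sup>2))"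
    proof (intro AE_I2)
      fix z :: "real ^ 'n"
      have "norm (m + A *v z) \<le> norm m + onorm ((*v) A) * norm z"
        using norm_triangle_ineq[of m "A *v z"] norm_matrix_le[of A z] by linarith
      then have "(norm (m + A *v z))\<^sup>2 \<le> (norm m + onorm ((*v) A) * norm z)\<^sup>2" by (rule
          power_mono) simp
      also have "\<dots> \<le> 2 * (norm m)\<^sup>2 + 2 * ((onorm ((*v) A))\<^sup>2 * (norm z)\<^sup>2)"
        using sum_squares_bound[of "norm m" "onorm ((*v) A) * norm z"]
        unfolding power2_sum power_mult_distrib by linarith
      finally show "norm ((norm (m + A *v z))\<^sup>2) \<le> norm (2 * (norm m)\<^sup>2 + 2 * ((onorm ((*v) A))\<^sup>2
          * (norm z)\<^sup>2))" by simp
    qed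
  qed measurable
  then show ?thesis
    unfolding prior2_def by (auto intro!: g.prob_space_distr simp: integrable_distr_eq)
qed

lemma vec_nth_eq_inner_axis: "vec_nth x i = inner (axis i 1) x" for x :: "real ^ 'n::finite"
  by (simp add: inner_axis')

lemma matrix_nth_eq_inner_axis: "vec_nth (vec_nth M i) j = inner (axis i 1) (M *v axis j 1)" for M
    :: "real ^ 'n ^ 'n::finite"
  by (simp add: inner_axis' matrix_vector_mult_basis column_def)

lemma integral_quadratic_form:
  fixes X :: "'w \<Rightarrow> real ^ 'n::finite" and C :: "real ^ 'n ^ 'n"
  assumes "\<And>i j. integrable M (\<lambda>w. vec_nth (X w) i * vec_nth (X w) j)"
    "\<And>i j. (\<integral>w. vec_nth (X w) i * vec_nth (X w) j \<partial>M) = vec_nth (vec_nth C i) j"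
  shows "integrable M (\<lambda>w. inner (X w) (Q *v X w))" "mtr Q = Q \<Longrightarrow> (\<integral>w. inner (X w) (Q *v X w) \<partial>M) =
      trace (C ** Q)"
proof -
  have eq: "inner (X w) (Q *v X w) = (\<Sum>i\<in>UNIV. \<Sum>j\<in>UNIV. vec_nth (vec_nth Q i) j * (vec_nth (X w) i
      * vec_nth (X w) j))" for w
    by (simp add: inner_matrix_qform qform_def mult.assoc)
  show "integrable M (\<lambda>w. inner (X w) (Q *v X w))" unfolding eq using assms(1) by simp
  assume sym: "mtr Q = Q"
  have Qs: "vec_nth (vec_nth Q i) j = vec_nth (vec_nth Q j) i" for i j
    using arg_cong[OF sym, of "\<lambda>X. vec_nth (vec_nth X j) i"] by (simp add: mtr_def)
  have "(\<integral>w. inner (X w) (Q *v X w) \<partial>M) = (\<Sum>i\<in>UNIV. \<Sum>j\<in>UNIV. vec_nth (vec_nth Q i) j * vec_nth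
      (vec_nth C i) j)"
    unfolding eq using assms by simp
  also have "\<dots> = (\<Sum>i\<in>UNIV. \<Sum>j\<in>UNIV. vec_nth (vec_nth C i) j * vec_nth (vec_nth Q j) i)"
    by (intro sum.cong refl) (metis Qs mult.commute)
  also have "\<dots> = trace (C ** Q)"
    by (simp add: trace_def matrix_matrix_mult_def)
  finally show "(\<integral>w. inner (X w) (Q *v X w) \<partial>M) = trace (C ** Q)" .
qed

lemma inner_mtr_left: "inner (mtr A *v x) y = inner x (A *v y)" for A :: "real ^ 'n ^ 'n::finite"
  by (metis dot_lmul_matrix transpose_matrix_vector mtr_mtr)

lemma inner_mtr_right: "inner x (mtr A *v y) = inner (A *v x) y" for A :: "real ^ 'n ^ 'n::finite"
  by (metis inner_mtr_left inner_commute)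

lemma mtr_congruence: "mtr G = G \<Longrightarrow> mtr (mtr A ** G ** A) = mtr A ** G ** A" for A G :: "real ^ 'n
    ^ 'n::finite"
  by (simp add: matrix_transpose_mul mtr_mtr matrix_mul_assoc)

lemma inner_congruence: "inner u ((mtr A ** G ** A) *v v) = inner (A *v u) (G *v (A *v v))" for A
    G :: "real ^ 'n ^ 'n::finite"
  by (simp only: matrix_vector_mul_assoc[symmetric] inner_mtr_right)

context gauss_family
begin

text \<open>In the coordinate \<open>z\<close> the family has information \<open>B\<close> and
  statistic \<open>v y\<close>, and the likelihood ratio at m + A z splits off its value at
  \<open>m\<close>. What remains is a Gaussian integral in \<open>z\<close>.\<close>

lemma evid_affine_gauss_tilt:
  fixes T A :: "real ^ 'n ^ 'n" and m :: "real ^ 'n"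
  assumes P: "mposdef (idm + T)"
  defines "B \<equiv> mtr A ** G ** A" and "q \<equiv> distr (gauss_tilt T) borel (\<lambda>z. m + A *v z)"
    and "v \<equiv> \<lambda>y. mtr A *v (s y - G *v m)"
  shows "mposdef (idm + T + B)"
    "evid q y = lik_ratio y m * (sqrt (vdet (idm + T) / vdet (idm + T + B)) * exp (inner (v y)
        (matrix_inv (idm + T + B) *v v y) / 2))"
proof -
  show P': "mposdef (idm + T + B)"
    unfolding B_def by (intro mposdef_add P mtr_congruence G_sym) (simp add: inner_congruence G_psd)
  have inA: "inner (v y) z = inner (s y - G *v m) (A *v z)" for z
    unfolding v_def by (rule inner_mtr_left)
  have eq: "lik_ratio y (m + A *v z) = lik_ratio y m * exp (inner (v y) z - inner z (B *v z) / 2)"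
      for z
    unfolding inA B_def inner_congruence
    using inner_matrix_sym[OF G_sym, of m "A *v z"]
    by (simp add: lik_ratio_def exp_add[symmetric] matrix_vector_right_distrib inner_add_left
        inner_add_right
        inner_diff_left inner_commute[of "G *v m"] field_simps)
  have "integrable (gauss_tilt T) (\<lambda>z. exp (inner (v y) z - inner z (B *v z) / 2))"
    by (intro integrableI_nonneg) (auto simp: nn_integral_gauss_tilt_exp_quadratic[OF P P'])
  then have "(\<integral>z. exp (inner (v y) z - inner z (B *v z) / 2) \<partial>gauss_tilt T)
      = sqrt (vdet (idm + T) / vdet (idm + T + B)) * exp (inner (v y) (matrix_inv (idm + T + B) *v
          v y) / 2)"
    using nn_integral_gauss_tilt_exp_quadratic[OF P P', of "v y"] nn_integral_gaussian_vec(1)[OF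
        P] nn_integral_gaussian_vec(1)[OF P']
    by (subst (asm) nn_integral_eq_integral) (auto intro!: integral_nonneg_AE)
  then show "evid q y = lik_ratio y m * (sqrt (vdet (idm + T) / vdet (idm + T + B)) * exp (inner
      (v y) (matrix_inv (idm + T + B) *v v y) / 2))"
    unfolding evid_def q_def
    by (subst integral_distr) (auto simp: eq lik_ratio_measurable)
qed

text \<open>The logarithm of the evidence is a quadratic polynomial in \<open>s\<close>, so its mean
  needs only first and second moments. All trace terms cancel against the mean of the quadratic
  form, and the normalising factor \<open>r\<close> alone survives.\<close>

lemma info_gain_gaussian:
  fixes T A :: "real ^ 'n ^ 'n" and m :: "real ^ 'n"
  assumes P: "mposdef (idm + T)"
  defines "B \<equiv> mtr A ** G ** A"
  shows "info_gain M L (distr (gauss_tilt T) borel (\<lambda>z. m + A *v z)) = ln (vdet (idm + T + B) /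
      vdet (idm + T)) / 2"
proof -
  define q where "q = distr (gauss_tilt T) borel (\<lambda>z. m + A *v z)"
  define v where "v y = mtr A *v (s y - G *v m)" for y
  define P' where "P' = idm + T + B"
  define S where "S = matrix_inv (idm + T)"
  define S' where "S' = matrix_inv P'"
  define r where "r = sqrt (vdet (idm + T) / vdet P')"
  interpret g: prob_space "gauss_tilt T" by (rule prob_space_gauss_tilt[OF P])
  have prq: "prior2 q" unfolding q_def by (rule prior2_affine_gauss_tilt[OF P])
  then have pq: "prob_space q" and sets_q [measurable_cong, simp]: "sets q = sets borel" by (auto
      simp: prior2_def)
  have P'pd: "mposdef P'" and ev: "evid q y = lik_ratio y m * (r * exp (inner (v y) (S' *v v y) /
      2))" for y
    using evid_affine_gauss_tilt[OF P] unfolding P'_def B_def q_def v_def S'_def r_def by auto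
  have d: "vdet (idm + T) > 0" "vdet P' > 0" using nn_integral_gaussian_vec(1) P P'pd by auto
  have r: "r > 0" unfolding r_def using d by simp
  have Bsym: "mtr B = B" unfolding B_def by (rule mtr_congruence[OF G_sym])
  have S'sym: "mtr S' = S'" unfolding S'_def by (rule mposdef_matrix_inv[OF P'pd])
  have [measurable]: "(\<lambda>z. m + A *v z) \<in> borel_measurable (gauss_tilt T)" by measurable
  have lnev: "ln (evid q y) = (inner (s y) m - inner m (G *v m) / 2 + ln r) + inner (v y) (S' *v v
      y) / 2" for y
    unfolding ev using r by (simp add: ln_mult lik_ratio_def)
  have vi: "vec_nth (v y) i = inner (A *v axis i 1) (s y - G *v m)" for y i
    unfolding v_def vec_nth_eq_inner_axis by (rule inner_mtr_right)
  \<comment> \<open>Conditional mean of \<open>v\<close> given \<theta>; the matrix \<open>C\<close>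
    below is the conditional second moment of \<open>v\<close>, covariance \<open>B\<close> plus the
    square of this mean.\<close>
  define w where "w \<theta> = mtr A *v (G *v (\<theta> - m))" for \<theta>
  have wi: "vec_nth (w \<theta>) i = inner (A *v axis i 1) (G *v \<theta> - G *v m)" for \<theta> i
    unfolding w_def vec_nth_eq_inner_axis inner_mtr_right by (simp only:
        matrix_vector_mult_diff_distrib)
  have wB: "w (m + A *v z) = B *v z" for z
    by (simp add: w_def B_def matrix_vector_mul_assoc matrix_mul_assoc)
  define C where "C \<theta> = (\<chi> i j. vec_nth (vec_nth B i) j + vec_nth (w \<theta>) i * vec_nth (w \<theta>) j)" for \<theta>
  have Bij: "inner (A *v axis i 1) (G *v (A *v axis j 1)) = vec_nth (vec_nth B i) j" for i j
    unfolding matrix_nth_eq_inner_axis B_def inner_congruence ..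
  have vv: "integrable (cond_law \<theta>) (\<lambda>y. vec_nth (v y) i * vec_nth (v y) j)"
    "(\<integral>y. vec_nth (v y) i * vec_nth (v y) j \<partial>cond_law \<theta>) = vec_nth (vec_nth (C \<theta>) i) j" for \<theta> i j
  proof -
    show "integrable (cond_law \<theta>) (\<lambda>y. vec_nth (v y) i * vec_nth (v y) j)"
      unfolding vi by (rule cond_law_second_moments)
    show "(\<integral>y. vec_nth (v y) i * vec_nth (v y) j \<partial>cond_law \<theta>) = vec_nth (vec_nth (C \<theta>) i) j"
      unfolding vi cond_law_second_moments(2) by (simp add: C_def wi Bij)
  qed
  have trC: "trace (C \<theta> ** S') = trace (B ** S') + inner (w \<theta>) (S' *v w \<theta>)" for \<theta>
  proof -
    have "trace (C \<theta> ** S') = trace (B ** S') + (\<Sum>i\<in>UNIV. \<Sum>k\<in>UNIV. vec_nth (vec_nth S' k) i *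
        vec_nth (w \<theta>) i * vec_nth (w \<theta>) k)"
      by (simp add: trace_def matrix_matrix_mult_def C_def distrib_right distrib_left sum.distrib
          mult_ac)
    also have "(\<Sum>i\<in>UNIV. \<Sum>k\<in>UNIV. vec_nth (vec_nth S' k) i * vec_nth (w \<theta>) i * vec_nth (w \<theta>) k)
        = inner (w \<theta>) (S' *v w \<theta>)"
      unfolding inner_matrix_qform qform_def by (subst sum.swap) (simp add: mult_ac)
    finally show ?thesis .
  qed
  have inner_int: "(\<integral>y. ln (evid q y) \<partial>cond_law \<theta>)
      = (inner m (G *v \<theta>) - inner m (G *v m) / 2 + ln r) + (trace (B ** S') + inner (w \<theta>) (S' *v w
          \<theta>)) / 2" for \<theta>
  proof -
    interpret t: prob_space "cond_law \<theta>" by (rule prob_space_cond_law)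
    show ?thesis
      unfolding lnev trC[symmetric]
      using integral_quadratic_form[OF vv[of \<theta>], of S'] S'sym cond_law_moments(1,2)[of \<theta> m]
      by (simp add: inner_commute[of "s _"] t.prob_space)
  qed
  have Bzz: "integrable (gauss_tilt T) (\<lambda>z. vec_nth (B *v z) i * vec_nth (B *v z) j)"
    "(\<integral>z. vec_nth (B *v z) i * vec_nth (B *v z) j \<partial>gauss_tilt T) = vec_nth (vec_nth (B ** S ** B)
        i) j" for i j
  proof -
    have b: "vec_nth (B *v z) i = inner (B *v axis i 1) z" for z i
      unfolding vec_nth_eq_inner_axis by (simp add: inner_matrix_sym[OF Bsym, of "axis i 1" z]
          inner_commute)
    show "integrable (gauss_tilt T) (\<lambda>z. vec_nth (B *v z) i * vec_nth (B *v z) j)"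
      unfolding b by (rule gauss_tilt_moments[OF P])
    show "(\<integral>z. vec_nth (B *v z) i * vec_nth (B *v z) j \<partial>gauss_tilt T) = vec_nth (vec_nth (B ** S
        ** B) i) j"
      unfolding b gauss_tilt_moments(4)[OF P] S_def[symmetric] matrix_nth_eq_inner_axis
      by (simp add: matrix_vector_mul_assoc[symmetric] inner_matrix_sym[OF Bsym, of "axis i 1"]
          inner_commute)
  qed
  have itr: "integrable (gauss_tilt T) (\<lambda>z. inner (B *v z) (S' *v (B *v z)))"
    "(\<integral>z. inner (B *v z) (S' *v (B *v z)) \<partial>gauss_tilt T) = trace (B ** S ** B ** S')"
    using integral_quadratic_form[OF Bzz, of S'] S'sym by auto
  have "(\<integral>x. ln (evid q (snd x)) \<partial>joint q) = (\<integral>\<theta>. (\<integral>y. ln (evid q y) \<partial>cond_law \<theta>) \<partial>q)"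
    using integral_joint_fst[OF pq sets_q, of "\<lambda>\<theta> y. ln (evid q y)"] integrable_ln_evid[OF prq] by
        simp
  also have "\<dots> = (\<integral>z. (inner m (G *v (m + A *v z)) - inner m (G *v m) / 2 + ln r)
      + (trace (B ** S') + inner (B *v z) (S' *v (B *v z))) / 2 \<partial>gauss_tilt T)"
    unfolding inner_int wB[symmetric] unfolding q_def w_def by (rule integral_distr) measurable
  also have "\<dots> = inner m (G *v m) / 2 + ln r + (trace (B ** S') + trace (B ** S ** B ** S')) / 2"
  proof -
    have mA: "inner m (G *v (A *v z)) = inner (mtr A *v (G *v m)) z" for z
      unfolding inner_mtr_left by (metis inner_matrix_sym[OF G_sym] inner_commute)
    show ?thesis
      unfolding matrix_vector_right_distrib inner_add_right mA
      using itr gauss_tilt_moments(1,2)[OF P, of "mtr A *v (G *v m)"] by (simp add: g.prob_space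
          add_divide_distrib)
  qed
  \<comment> \<open>A resolvent identity: with \<open>S\<close> and \<open>S'\<close> the inverses
    of I + T and I + T + B, one has B + B S B = B S P', and multiplication by \<open>S'\<close> on
    the right leaves B S.\<close>
  also have "trace (B ** S') + trace (B ** S ** B ** S') = trace (B ** S)"
  proof -
    have "B ** S ** (idm + T) = B"
      unfolding S_def by (simp add: matrix_mul_assoc[symmetric] mposdef_matrix_inv[OF P])
    then have "B + B ** S ** B = B ** S ** P'"
      unfolding P'_def by (simp add: matrix_add_ldistrib)
    then have "(B + B ** S ** B) ** S' = B ** S ** (P' ** S')" by (simp add: matrix_mul_assoc)
    then have "B ** S' + B ** S ** B ** S' = B ** S"
      using mposdef_matrix_inv(1)[OF P'pd] by (simp add: S'_def matrix_add_rdistrib)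
    then show ?thesis by (metis trace_add)
  qed
  finally have I: "(\<integral>x. ln (evid q (snd x)) \<partial>joint q) = inner m (G *v m) / 2 + ln r + trace (B **
      S) / 2" .
  have "(\<integral>\<theta>. inner \<theta> (G *v \<theta>) \<partial>q) = (\<integral>z. inner (m + A *v z) (G *v (m + A *v z)) \<partial>gauss_tilt T)"
    unfolding q_def by (rule integral_distr) measurable
  also have "\<dots> = (\<integral>z. inner m (G *v m) + 2 * inner (mtr A *v (G *v m)) z + inner z (B *v z)
      \<partial>gauss_tilt T)"
  proof (rule Bochner_Integration.integral_cong[OF refl])
    fix z
    have mA: "inner m (G *v (A *v z)) = inner (mtr A *v (G *v m)) z"
      unfolding inner_mtr_left by (metis inner_matrix_sym[OF G_sym] inner_commute)
    then show "inner (m + A *v z) (G *v (m + A *v z)) = inner m (G *v m) + 2 * inner (mtr A *v (G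
        *v m)) z + inner z (B *v z)"
      unfolding B_def inner_congruence using inner_matrix_sym[OF G_sym, of m "A *v z"]
      by (simp add: matrix_vector_right_distrib inner_add_left inner_add_right)
  qed
  also have "\<dots> = inner m (G *v m) + trace (B ** S)"
  proof -
    have z: "integrable (gauss_tilt T) (\<lambda>z. vec_nth z i * vec_nth z j)"
      "(\<integral>z. vec_nth z i * vec_nth z j \<partial>gauss_tilt T) = vec_nth (vec_nth S i) j" for i j
    proof -
      show "integrable (gauss_tilt T) (\<lambda>z. vec_nth z i * vec_nth z j)"
        unfolding vec_nth_eq_inner_axis by (rule gauss_tilt_moments[OF P])
      have "(\<integral>z. vec_nth z i * vec_nth z j \<partial>gauss_tilt T) = (\<integral>z. inner (axis i 1) z * inner (axis
          j 1) z \<partial>gauss_tilt T)"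
        by (simp only: vec_nth_eq_inner_axis)
      also have "\<dots> = vec_nth (vec_nth S i) j"
        unfolding gauss_tilt_moments(4)[OF P] S_def matrix_nth_eq_inner_axis ..
      finally show "(\<integral>z. vec_nth z i * vec_nth z j \<partial>gauss_tilt T) = vec_nth (vec_nth S i) j" .
    qed
    have "integrable (gauss_tilt T) (\<lambda>z. inner z (B *v z))" "(\<integral>z. inner z (B *v z) \<partial>gauss_tilt T)
        = trace (B ** S)"
      using integral_quadratic_form[OF z, of B] Bsym trace_mul_sym[of S B] by auto
    then show ?thesis
      using gauss_tilt_moments(1,2)[OF P, of "mtr A *v (G *v m)"] by (simp add: g.prob_space)
  qed
  finally have "info_gain M L q = - ln r"
    using info_gain_eq[OF prq] I by (simp add: field_simps)
  also have "\<dots> = ln (vdet P' / vdet (idm + T)) / 2"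
    unfolding r_def using d by (simp add: ln_sqrt ln_div field_simps)
  finally show ?thesis by (simp add: q_def P'_def)
qed

end

section \<open>Test functions and Wasserstein convergence\<close>

text \<open>Clamp \<open>f k\<close> to \<open>[- g', g']\<close> and use that \<open>g k\<close> tends to \<open>g'\<close> in mean.\<close>

lemma integral_tendsto_dominated_varying:
  fixes f :: "nat \<Rightarrow> 'a \<Rightarrow> real"
  assumes [measurable]: "\<And>k. f k \<in> borel_measurable M" "f' \<in> borel_measurable M"
    and g: "\<And>k. integrable M (g k)" "integrable M g'"
    and le: "\<And>k. AE x in M. \<bar>f k x\<bar> \<le> g k x"
    and lim: "AE x in M. (\<lambda>k. f k x) \<longlonglongrightarrow> f' x" "AE x in M. (\<lambda>k. g k x) \<longlonglongrightarrow> g' x"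
    and int: "(\<lambda>k. integral\<^sup>L M (g k)) \<longlonglongrightarrow> integral\<^sup>L M g'"
  shows "(\<lambda>k. integral\<^sup>L M (f k)) \<longlonglongrightarrow> integral\<^sup>L M f'"
proof -
  note [measurable] = borel_measurable_integrable[OF g(1)] borel_measurable_integrable[OF g(2)]
  have le_all: "AE x in M. \<forall>k. \<bar>f k x\<bar> \<le> g k x" using le by (simp add: AE_all_countable)
  have fg': "AE x in M. \<bar>f' x\<bar> \<le> g' x"
    using le_all lim
  proof eventually_elim
    case (elim x)
    show ?case by (rule LIMSEQ_le[OF tendsto_rabs[OF elim(2)] elim(3)]) (use elim in auto)
  qed
  have g'0: "AE x in M. 0 \<le> g' x" using fg' by eventually_elim auto
  have intf: "integrable M (f k)" for k
    by (rule Bochner_Integration.integrable_bound[OF g(1)[of k]]) (use le[of k] in auto)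
  \<comment> \<open>Scheffe's argument: each \<open>g k\<close> is nonnegative almost everywhere, so
    the positive part of g' - g k is dominated by \<open>g'\<close>, and convergence of the
    integrals controls the other part.\<close>
  have A: "(\<lambda>k. \<integral>x. max 0 (g' x - g k x) \<partial>M) \<longlonglongrightarrow> (\<integral>x. 0 \<partial>M)"
  proof (rule integral_dominated_convergence[OF _ _ g(2)])
    show "AE x in M. (\<lambda>k. max 0 (g' x - g k x)) \<longlonglongrightarrow> 0"
      using lim(2)
    proof eventually_elim
      case (elim x)
      have "(\<lambda>k. max 0 (g' x - g k x)) \<longlonglongrightarrow> max 0 (g' x - g' x)" by (intro tendsto_intros elim)
      then show ?case by simp
    qed
    show "AE x in M. norm (max 0 (g' x - g k x)) \<le> g' x" for k
      using le_all g'0 by eventually_elim (auto simp: max_def elim!: allE[of _ k])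
  qed measurable
  have B: "(\<lambda>k. integral\<^sup>L M (g k) - integral\<^sup>L M g') \<longlonglongrightarrow> integral\<^sup>L M g' - integral\<^sup>L M g'"
    by (intro tendsto_intros int)
  have "(\<lambda>k. (integral\<^sup>L M (g k) - integral\<^sup>L M g') + 2 * (\<integral>x. max 0 (g' x - g k x) \<partial>M)) \<longlonglongrightarrow>
      (integral\<^sup>L M g' - integral\<^sup>L M g') + 2 * (\<integral>x. 0 \<partial>M)"
    by (rule tendsto_add[OF B tendsto_mult[OF tendsto_const A]])
  moreover have "(integral\<^sup>L M (g k) - integral\<^sup>L M g') + 2 * (\<integral>x. max 0 (g' x - g k x) \<partial>M) = (\<integral>x.
      \<bar>g k x - g' x\<bar> \<partial>M)" for k
  proof -
    have i: "integrable M (\<lambda>x. max 0 (g' x - g k x))" using g by auto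
    have "(\<integral>x. \<bar>g k x - g' x\<bar> \<partial>M) = (\<integral>x. (g k x - g' x) + 2 * max 0 (g' x - g k x) \<partial>M)"
      by (intro Bochner_Integration.integral_cong) (auto simp: max_def)
    then show ?thesis using i g by simp
  qed
  ultimately have scheffe: "(\<lambda>k. \<integral>x. \<bar>g k x - g' x\<bar> \<partial>M) \<longlonglongrightarrow> 0" by simp
  define c where "c k x = max (- g' x) (min (f k x) (g' x))" for k x
  have [measurable]: "c k \<in> borel_measurable M" for k unfolding c_def by measurable
  have cb: "AE x in M. norm (c k x) \<le> g' x" for k
    using g'0 by eventually_elim (auto simp: c_def)
  have ic: "integrable M (c k)" for k
    by (rule Bochner_Integration.integrable_bound[OF g(2)]) (use cb[of k] in auto)
  have clim: "(\<lambda>k. integral\<^sup>L M (c k)) \<longlonglongrightarrow> integral\<^sup>L M f'"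
  proof (rule integral_dominated_convergence[OF _ _ g(2) _ cb])
    show "AE x in M. (\<lambda>k. c k x) \<longlonglongrightarrow> f' x"
      using lim(1) fg'
    proof eventually_elim
      case (elim x)
      have "(\<lambda>k. c k x) \<longlonglongrightarrow> max (- g' x) (min (f' x) (g' x))"
        unfolding c_def by (intro tendsto_intros elim)
      then show ?case using elim(2) by (simp add: abs_le_iff max_def min_def)
    qed
  qed measurable
  \<comment> \<open>Clamping at level \<open>g'\<close> moves \<open>f k\<close> only where |f k|
    exceeds \<open>g'\<close>, and there by at most \<open>g k - g'\<close>.\<close>
  have diff: "norm (integral\<^sup>L M (f k) - integral\<^sup>L M (c k)) \<le> (\<integral>x. \<bar>g k x - g' x\<bar> \<partial>M)" for k
  proof -
    have "integral\<^sup>L M (f k) - integral\<^sup>L M (c k) = (\<integral>x. f k x - c k x \<partial>M)" using intf ic by simp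
    also have "norm \<dots> \<le> (\<integral>x. norm (f k x - c k x) \<partial>M)" by (rule integral_norm_bound)
    also have "\<dots> \<le> (\<integral>x. \<bar>g k x - g' x\<bar> \<partial>M)"
    proof (rule integral_mono_AE)
      show "AE x in M. norm (f k x - c k x) \<le> \<bar>g k x - g' x\<bar>"
        using le[of k] g'0 by eventually_elim (auto simp: c_def max_def min_def)
    qed (use intf ic g in auto)
    finally show ?thesis .
  qed
  have "(\<lambda>k. integral\<^sup>L M (f k) - integral\<^sup>L M (c k)) \<longlonglongrightarrow> 0"
    by (rule Lim_null_comparison[OF _ scheffe]) (use diff in auto)
  from tendsto_add[OF this clim] show ?thesis by simp
qed

text \<open>No optimal coupling is needed, only one within the slack 1 / (k + 1) of the infimum. The
  slack also makes \<open>d k\<close> positive, so that its square root can serve as a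
  weight.\<close>

lemma wasserstein2_tendsto_0_couplings:
  fixes q :: "(real ^ 'n::finite) measure"
  assumes "(\<lambda>k. wasserstein2 (p k) q) \<longlonglongrightarrow> 0"
  obtains \<gamma> d where "d \<longlonglongrightarrow> (0::real)" "\<And>k. d k > 0"
    "\<forall>\<^sub>F k in sequentially. \<gamma> k \<in> couplings (p k) q \<and> (\<integral>\<^sup>+(x, y). ennreal ((dist x y)\<^sup>2) \<partial>\<gamma> k) \<le>
        ennreal (d k)"
proof -
  define c where "c k = (INF \<gamma>\<in>couplings (p k) q. \<integral>\<^sup>+(x, y). ennreal ((dist x y)\<^sup>2) \<partial>\<gamma>)" for k
  define w where "w k = wasserstein2 (p k) q" for k
  define d where "d k = (enn2real (w k))\<^sup>2 + 1 / real (Suc k)" for k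
  have w: "w k = (if c k = \<infinity> then \<infinity> else ennreal (sqrt (enn2real (c k))))" for k
    unfolding w_def wasserstein2_def c_def Let_def ..
  have wlim: "(\<lambda>k. enn2real (w k)) \<longlonglongrightarrow> enn2real 0"
    using assms unfolding w_def[symmetric] by (intro tendsto_enn2real) auto
  have "d \<longlonglongrightarrow> (enn2real 0)\<^sup>2 + 0"
    unfolding d_def by (rule tendsto_add[OF tendsto_power[OF wlim] LIMSEQ_Suc[OF lim_1_over_n]])
  then have d0: "d \<longlonglongrightarrow> 0" by simp
  define Q where "Q k g \<longleftrightarrow> g \<in> couplings (p k) q
    \<and> (\<integral>\<^sup>+(x, y). ennreal ((dist x y)\<^sup>2) \<partial>g) \<le> ennreal (d k)" for k g
  \<comment> \<open>Excludes the infinite values, which \<open>enn2real\<close> would send to 0;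
    couplings are therefore available only eventually.\<close>
  have "\<forall>\<^sub>F k in sequentially. w k < 1"
    using assms unfolding w_def[symmetric] by (rule order_tendstoD) simp
  then have "\<forall>\<^sub>F k in sequentially. Q k (SOME g. Q k g)"
  proof eventually_elim
    case (elim k)
    then have c: "c k \<noteq> \<infinity>" unfolding w by (auto split: if_splits)
    then have "w k = ennreal (sqrt (enn2real (c k)))" unfolding w by simp
    then have "enn2real (w k) = sqrt (enn2real (c k))" by simp
    then have "d k = enn2real (c k) + 1 / real (Suc k)" unfolding d_def by simp
    then have "enn2real (c k) < d k" by simp
    then have "c k < ennreal (d k)"
      using c by (metis enn2real_nonneg ennreal_enn2real ennreal_lessI infinity_ennreal_def
          le_less_trans less_top)
    then have "\<exists>g. Q k g" unfolding c_def INF_less_iff Q_def by (auto intro: less_imp_le)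
    then show ?case by (rule someI_ex)
  qed
  then show thesis
    unfolding Q_def[of _ "SOME g. Q _ g"]
    by (intro that[of d "\<lambda>k. SOME g. Q k g"] d0) (auto simp: d_def intro: add_nonneg_pos)
qed

text \<open>Young's inequality with weight sqrt d separates the distance from \<open>g\<close>: the
  squared distance over 2 sqrt d integrates to at most sqrt d / 2, and the other part carries a
  factor sqrt d. The whole bound vanishes with \<open>d\<close>, and \<open>g\<close> is integrated
  against the second marginal only.\<close>

lemma coupling_integral_diff_bound:
  fixes p q :: "(real ^ 'n::finite) measure"
  assumes \<gamma>: "\<gamma> \<in> couplings p q" and d: "d > 0"
    and le: "(\<integral>\<^sup>+(x, y). ennreal ((dist x y)\<^sup>2) \<partial>\<gamma>) \<le> ennreal d"
    and [measurable]: "h \<in> borel_measurable borel" "g \<in> borel_measurable borel"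
    and h: "\<And>x y. \<bar>h x - h y\<bar> \<le> C * (dist x y)\<^sup>2 + g y * dist x y" and C: "C \<ge> 0" and g0: "\<And>y. g y
        \<ge> 0"
    and ip: "integrable p h" and iq: "integrable q h" and ig: "integrable q (\<lambda>y. (g y)\<^sup>2)"
  shows "\<bar>(\<integral>x. h x \<partial>p) - (\<integral>x. h x \<partial>q)\<bar> \<le> C * d + sqrt d / 2 * (\<integral>y. (g y)\<^sup>2 \<partial>q) + sqrt d / 2"
proof -
  have sets_\<gamma> [measurable_cong]: "sets \<gamma> = sets (borel \<Otimes>\<^sub>M borel)"
    and p: "p = distr \<gamma> borel fst" and q: "q = distr \<gamma> borel snd"
    using \<gamma> by (auto simp: couplings_def)
  have idist: "integrable \<gamma> (\<lambda>x. (dist (fst x) (snd x))\<^sup>2)"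
    using le by (intro integrableI_nonneg) (auto simp: case_prod_unfold intro: le_less_trans)
  have ledist: "(\<integral>x. (dist (fst x) (snd x))\<^sup>2 \<partial>\<gamma>) \<le> d"
    using le d nn_integral_eq_integral[OF idist] by (simp add: case_prod_unfold integral_nonneg_AE)
  have i1: "integrable \<gamma> (\<lambda>x. h (fst x))" "integrable \<gamma> (\<lambda>x. h (snd x))" "integrable \<gamma> (\<lambda>x. (g
      (snd x))\<^sup>2)"
    using ip iq ig unfolding p q by (simp_all add: integrable_distr_eq)
  have "\<bar>(\<integral>x. h x \<partial>p) - (\<integral>x. h x \<partial>q)\<bar> = \<bar>\<integral>x. h (fst x) - h (snd x) \<partial>\<gamma>\<bar>"
    using i1 unfolding p q by (simp add: integral_distr)
  also have "\<dots> \<le> (\<integral>x. \<bar>h (fst x) - h (snd x)\<bar> \<partial>\<gamma>)" by (rule integral_abs_bound)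
  also have "\<dots> \<le> (\<integral>x. (C + 1 / (2 * sqrt d)) * (dist (fst x) (snd x))\<^sup>2 + sqrt d / 2 * (g (snd
      x))\<^sup>2 \<partial>\<gamma>)"
  proof (rule integral_mono)
    fix x
    have "\<bar>h (fst x) - h (snd x)\<bar> \<le> C * (dist (fst x) (snd x))\<^sup>2 + dist (fst x) (snd x) * g (snd x)"
      using h[of "fst x" "snd x"] by (simp add: mult.commute)
    also have "dist (fst x) (snd x) * g (snd x) \<le> (dist (fst x) (snd x))\<^sup>2 / (2 * sqrt d) + sqrt d
        * (g (snd x))\<^sup>2 / 2"
      by (rule quadratic_le) (use d in simp)
    finally show "\<bar>h (fst x) - h (snd x)\<bar> \<le> (C + 1 / (2 * sqrt d)) * (dist (fst x) (snd x))\<^sup>2 +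
        sqrt d / 2 * (g (snd x))\<^sup>2"
      by (simp add: distrib_right)
  qed (use i1 idist in auto)
  also have "\<dots> = (C + 1 / (2 * sqrt d)) * (\<integral>x. (dist (fst x) (snd x))\<^sup>2 \<partial>\<gamma>) + sqrt d / 2 * (\<integral>x. (g
      (snd x))\<^sup>2 \<partial>\<gamma>)"
    using i1 idist by simp
  also have "\<dots> \<le> (C + 1 / (2 * sqrt d)) * d + sqrt d / 2 * (\<integral>x. (g (snd x))\<^sup>2 \<partial>\<gamma>)"
    using ledist C d by (intro add_right_mono mult_left_mono) auto
  also have "\<dots> = C * d + sqrt d / 2 * (\<integral>y. (g y)\<^sup>2 \<partial>q) + sqrt d / 2"
    unfolding q using d by (simp add: integral_distr distrib_right real_div_sqrt)
  finally show ?thesis .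
qed

text \<open>The test functions whose integrals converge along Wasserstein convergence: the modulus pairs
  with the second moment of a coupling.\<close>

definition tame :: "(real ^ 'n::finite \<Rightarrow> real) \<Rightarrow> bool" where
  "tame f \<longleftrightarrow> (\<exists>C\<ge>0. (\<forall>x y. \<bar>f x - f y\<bar> \<le> C * ((dist x y)\<^sup>2 + (1 + norm y) * dist x y)))"

lemma tame_growth:
  fixes f :: "real ^ 'n::finite \<Rightarrow> real"
  assumes "tame f"
  obtains C where "C \<ge> 0" "\<And>x. \<bar>f x\<bar> \<le> C * (1 + (norm x)\<^sup>2)"
proof -
  obtain C where C: "C \<ge> 0" "\<And>x y. \<bar>f x - f y\<bar> \<le> C * ((dist x y)\<^sup>2 + (1 + norm y) * dist x y)"
    using assms unfolding tame_def by blast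
  show thesis
  proof (rule that)
    show "2 * C + \<bar>f 0\<bar> \<ge> 0" using C(1) by simp
    fix x :: "real ^ 'n"
    have a: "(norm x)\<^sup>2 + norm x \<le> 2 * (1 + (norm x)\<^sup>2)"
    proof -
      have "0 \<le> (norm x - 1)\<^sup>2 + (norm x)\<^sup>2 + 3" by simp
      then show ?thesis by (simp add: power2_diff)
    qed
    have "\<bar>f x\<bar> \<le> \<bar>f x - f 0\<bar> + \<bar>f 0\<bar>" by simp
    also have "\<bar>f x - f 0\<bar> \<le> C * ((norm x)\<^sup>2 + norm x)" using C(2)[of x 0] by simp
    also have "\<dots> \<le> C * (2 * (1 + (norm x)\<^sup>2))" by (rule mult_left_mono[OF a C(1)])
    also have "\<bar>f 0\<bar> \<le> \<bar>f 0\<bar> * (1 + (norm x)\<^sup>2)" by (simp add: mult_le_cancel_left1)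
    finally show "\<bar>f x\<bar> \<le> (2 * C + \<bar>f 0\<bar>) * (1 + (norm x)\<^sup>2)" by (simp add: algebra_simps)
  qed
qed

lemma tame_continuous:
  fixes f :: "real ^ 'n::finite \<Rightarrow> real"
  shows "tame f \<Longrightarrow> continuous_on UNIV f"
  unfolding continuous_on_def
proof (intro ballI)
  fix y :: "real ^ 'n" assume "tame f"
  then obtain C where C: "\<And>x y. \<bar>f x - f y\<bar> \<le> C * ((dist x y)\<^sup>2 + (1 + norm y) * dist x y)"
    unfolding tame_def by blast
  have "((\<lambda>x. C * ((dist x y)\<^sup>2 + (1 + norm y) * dist x y)) \<longlongrightarrow> C * ((dist y y)\<^sup>2 + (1 + norm y) *
      dist y y)) (at y)"
    by (intro tendsto_intros)
  then have "((\<lambda>x. C * ((dist x y)\<^sup>2 + (1 + norm y) * dist x y)) \<longlongrightarrow> 0) (at y)" by simp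
  then have "((\<lambda>x. f x - f y) \<longlongrightarrow> 0) (at y)"
    by (rule Lim_null_comparison[rotated]) (use C in simp)
  then show "(f \<longlongrightarrow> f y) (at y)" by (simp add: LIM_zero_iff)
qed

lemma tame_measurable: "tame f \<Longrightarrow> f \<in> borel_measurable borel"
  by (intro borel_measurable_continuous_onI tame_continuous)

lemma tame_integrable:
  assumes "tame f" "prior2 q"
  shows "integrable q f"
proof -
  have [measurable_cong]: "sets q = sets borel" and i: "integrable q (\<lambda>\<theta>. (norm \<theta>)\<^sup>2)" and
      "prob_space q"
    using assms(2) by (auto simp: prior2_def)
  interpret prob_space q by fact
  note [measurable] = tame_measurable[OF assms(1)]
  obtain C where C: "C \<ge> 0" "\<And>x. \<bar>f x\<bar> \<le> C * (1 + (norm x)\<^sup>2)" by (rule tame_growth[OF assms(1)])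
      blast
  show ?thesis
    by (rule Bochner_Integration.integrable_bound[of _ "\<lambda>x. C * (1 + (norm x)\<^sup>2)"])
      (use i C in \<open>auto intro!: AE_I2 simp: abs_of_nonneg\<close>)
qed

lemma tame_const: "tame (\<lambda>_. c)"
  unfolding tame_def by (auto intro!: exI[of _ 0])

lemma tame_inner: "tame (\<lambda>x. inner b x)"
proof -
  have "\<bar>inner b x - inner b y\<bar> \<le> norm b * ((dist x y)\<^sup>2 + (1 + norm y) * dist x y)" for x y
  proof -
    have "\<bar>inner b x - inner b y\<bar> \<le> norm b * dist x y"
      unfolding inner_diff_right[symmetric] dist_norm by (rule Cauchy_Schwarz_ineq2)
    also have "\<dots> \<le> norm b * ((dist x y)\<^sup>2 + (1 + norm y) * dist x y)"
      by (intro mult_left_mono) (simp_all add: distrib_right)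
    finally show ?thesis .
  qed
  then show ?thesis unfolding tame_def by (intro exI[of _ "norm b"]) simp
qed

lemma quadratic_form_diff_bound:
  fixes Q :: "real ^ 'n ^ 'n::finite"
  assumes "mtr Q = Q"
  shows "\<bar>inner x (Q *v x) - inner y (Q *v y)\<bar> \<le> onorm ((*v) Q) * ((dist x y)\<^sup>2 + 2 * norm y *
      dist x y)"
proof -
  let ?D = "onorm ((*v) Q)"
  have "inner x (Q *v x) - inner y (Q *v y) = inner (x - y) (Q *v (x - y)) + 2 * inner (x - y) (Q
      *v y)"
    using inner_matrix_sym[OF assms, of x y]
    by (simp add: matrix_vector_mult_diff_distrib inner_diff_left inner_diff_right)
  then have "\<bar>inner x (Q *v x) - inner y (Q *v y)\<bar> \<le> \<bar>inner (x - y) (Q *v (x - y))\<bar> + 2 * \<bar>inner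
      (x - y) (Q *v y)\<bar>"
    by linarith
  also have "\<dots> \<le> ?D * (norm (x - y) * norm (x - y)) + 2 * (?D * (norm (x - y) * norm y))"
    using abs_inner_matrix_le[of "x - y" Q "x - y"] abs_inner_matrix_le[of "x - y" Q y] by linarith
  finally show ?thesis by (simp add: dist_norm power2_eq_square algebra_simps)
qed

lemma tame_quadratic_form:
  fixes Q :: "real ^ 'n ^ 'n::finite"
  assumes "mtr Q = Q"
  shows "tame (\<lambda>x. inner x (Q *v x))"
proof -
  let ?D = "onorm ((*v) Q)"
  have D: "?D \<ge> 0" by (rule onorm_matrix_nonneg)
  have "\<bar>inner x (Q *v x) - inner y (Q *v y)\<bar> \<le> 2 * ?D * ((dist x y)\<^sup>2 + (1 + norm y) * dist x y)"
      for x y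
  proof -
    have "?D * ((dist x y)\<^sup>2 + 2 * norm y * dist x y) \<le> ?D * (2 * ((dist x y)\<^sup>2 + (1 + norm y) *
        dist x y))"
      by (rule mult_left_mono[OF _ D]) (simp add: distrib_right)
    also have "\<dots> = 2 * ?D * ((dist x y)\<^sup>2 + (1 + norm y) * dist x y)" by (simp only: mult.assoc
        mult.left_commute)
    finally show ?thesis by (rule order_trans[OF quadratic_form_diff_bound[OF assms]])
  qed
  then show ?thesis unfolding tame_def using D by (intro exI[of _ "2 * ?D"]) simp
qed

lemma exp_diff_bound: "\<bar>exp a - exp b\<bar> \<le> E * \<bar>a - b\<bar>" if "exp a \<le> E" "exp b \<le> E" for a b E :: real
proof -
  have *: "exp a - exp b \<le> E * (a - b)" if "exp a \<le> E" "b \<le> a" for a b :: real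
  proof -
    have "1 + (b - a) \<le> exp (b - a)" by (rule exp_ge_add_one_self)
    then have "exp a * (1 + (b - a)) \<le> exp a * exp (b - a)" by (intro mult_left_mono) auto
    then have "exp a - exp b \<le> exp a * (a - b)" by (simp add: exp_diff algebra_simps)
    also have "\<dots> \<le> E * (a - b)" using that by (intro mult_right_mono) auto
    finally show ?thesis .
  qed
  show ?thesis
  proof (cases "b \<le> a")
    case True
    then show ?thesis using *[of a b] that by simp
  next
    case False
    then show ?thesis using *[of b a] that by simp
  qed
qed

text \<open>The exponential is Lipschitz below a level. This admits the likelihood ratio as a test
  function, although its exponent is quadratic.\<close>

lemma tame_exp:
  assumes "tame f" "\<And>x. exp (f x) \<le> E"
  shows "tame (\<lambda>x. exp (f x))"
proof -
  obtain C where C: "C \<ge> 0" "\<And>x y. \<bar>f x - f y\<bar> \<le> C * ((dist x y)\<^sup>2 + (1 + norm y) * dist x y)"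
    using assms(1) unfolding tame_def by blast
  have E: "E \<ge> 0" using assms(2)[of 0] by (meson exp_ge_zero order_trans)
  have "\<bar>exp (f x) - exp (f y)\<bar> \<le> E * C * ((dist x y)\<^sup>2 + (1 + norm y) * dist x y)" for x y
  proof -
    have "\<bar>exp (f x) - exp (f y)\<bar> \<le> E * \<bar>f x - f y\<bar>" by (rule exp_diff_bound[OF assms(2) assms(2)])
    also have "\<dots> \<le> E * (C * ((dist x y)\<^sup>2 + (1 + norm y) * dist x y))" by (intro mult_left_mono
        C(2) E)
    finally show ?thesis by (simp add: mult.assoc)
  qed
  then show ?thesis unfolding tame_def using E C(1) by (intro exI[of _ "E * C"]) simp
qed

lemma tame_add_scaled:
  assumes "tame f" "tame g"
  shows "tame (\<lambda>x. f x + c * g x)"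
proof -
  obtain C where C: "C \<ge> 0" "\<And>x y. \<bar>f x - f y\<bar> \<le> C * ((dist x y)\<^sup>2 + (1 + norm y) * dist x y)"
    using assms(1) unfolding tame_def by blast
  obtain D where D: "D \<ge> 0" "\<And>x y. \<bar>g x - g y\<bar> \<le> D * ((dist x y)\<^sup>2 + (1 + norm y) * dist x y)"
    using assms(2) unfolding tame_def by blast
  have "\<bar>(f x + c * g x) - (f y + c * g y)\<bar> \<le> (C + \<bar>c\<bar> * D) * ((dist x y)\<^sup>2 + (1 + norm y) * dist
      x y)" for x y
  proof -
    have "(f x + c * g x) - (f y + c * g y) = (f x - f y) + c * (g x - g y)" by (simp add:
        algebra_simps)
    then have "\<bar>(f x + c * g x) - (f y + c * g y)\<bar> \<le> \<bar>f x - f y\<bar> + \<bar>c\<bar> * \<bar>g x - g y\<bar>"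
      by (metis abs_mult abs_triangle_ineq)
    also have "\<dots> \<le> C * ((dist x y)\<^sup>2 + (1 + norm y) * dist x y) + \<bar>c\<bar> * (D * ((dist x y)\<^sup>2 + (1 +
        norm y) * dist x y))"
      by (intro add_mono mult_left_mono C D) simp
    finally show ?thesis by (simp add: algebra_simps)
  qed
  then show ?thesis unfolding tame_def using C(1) D(1) by (intro exI[of _ "C + \<bar>c\<bar> * D"]) simp
qed

section \<open>Continuity of the information gain\<close>

lemma power6_le_exp: "x ^ 6 \<le> 6 ^ 6 * exp x" if "x \<ge> 0" for x :: real
proof -
  have "x / 6 \<le> exp (x / 6)" using exp_ge_add_one_self[of "x / 6"] by linarith
  then have "(x / 6) ^ 6 \<le> exp (x / 6) ^ 6" using that by (intro power_mono) auto
  also have "exp (x / 6) ^ 6 = exp x" by (simp flip: exp_of_nat_mult)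
  finally show ?thesis by (simp add: power_divide divide_le_eq mult.commute)
qed

lemma std_gaussian_eq_gauss_tilt: "std_gaussian = gauss_tilt (0 :: real ^ 'n ^ 'n::finite)"
  by (simp add: gauss_tilt_def density_1)

lemma integrable_std_gaussian_power6:
  "integrable std_gaussian (\<lambda>z :: real ^ 'n::finite. (1 + norm z) ^ 6)"
proof -
  \<comment> \<open>With P = I / 2 the exponent is + |z|^2 / 4: a growing exponential that is still
    integrable and beats every power.\<close>
  let ?P = "(1 / 2) *\<^sub>R idm :: real ^ 'n ^ 'n"
  have P: "mposdef ?P"
    unfolding mposdef_def
  proof
    show "mtr ?P = ?P"
      by (auto simp: mtr_def idm_def
          cart_eq_iff)
    show "\<forall>x. x \<noteq> 0 \<longrightarrow> inner x (?P *v x) > 0"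
      by (simp add: scaleR_matrix_vector_assoc[symmetric])
  qed
  have q: "inner 0 z - inner z ((?P - idm) *v z) / 2 = (norm z)\<^sup>2 / 4" for z
    by (simp add: matrix_vector_mult_diff_rdistrib scaleR_matrix_vector_assoc[symmetric]
        inner_diff_right power2_norm_eq_inner)
  have "integrable std_gaussian (\<lambda>z :: real ^ 'n. exp ((norm z)\<^sup>2 / 4))"
    using nn_integral_std_gaussian_exp_quadratic[OF P, of 0] unfolding q by (intro
        integrableI_nonneg) auto
  then have i: "integrable std_gaussian (\<lambda>z :: real ^ 'n. 6 ^ 6 * exp 2 * exp ((norm z)\<^sup>2 / 4))"
      by simp
  show ?thesis
  proof (rule Bochner_Integration.integrable_bound[OF i])
    show "AE z :: real ^ 'n in std_gaussian. norm ((1 + norm z) ^ 6) \<le> norm (6 ^ 6 * exp 2 * exp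
        ((norm z)\<^sup>2 / 4))"
    proof (intro AE_I2)
      fix z :: "real ^ 'n"
      have "0 \<le> (norm z / 2 - 1)\<^sup>2" by simp
      then have "1 + norm z \<le> 2 + (norm z)\<^sup>2 / 4" by (simp add: power2_diff power_divide)
      have "(1 + norm z) ^ 6 \<le> 6 ^ 6 * exp (1 + norm z)" by (rule power6_le_exp) simp
      also have "\<dots> \<le> 6 ^ 6 * exp (2 + (norm z)\<^sup>2 / 4)" using \<open>1 + norm z \<le> _\<close> by simp
      finally show "norm ((1 + norm z) ^ 6) \<le> norm (6 ^ 6 * exp 2 * exp ((norm z)\<^sup>2 / 4))"
        by (simp add: exp_add mult.assoc)
    qed
  qed measurable
qed

lemma gaussian_law_gauss_tilt:
  fixes S :: "real ^ 'n ^ 'n::finite"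
  assumes "gaussian_law m S p"
  obtains A :: "real ^ 'n ^ 'n" where "A ** mtr A = S" "p = distr (gauss_tilt 0) borel (\<lambda>z. m + A
      *v z)"
  using assms unfolding gaussian_law_def std_gaussian_eq_gauss_tilt by blast

lemma integrable_gaussian_law_power6:
  fixes p :: "(real ^ 'n::finite) measure"
  assumes "gaussian_law m S p"
  shows "integrable p (\<lambda>x. (1 + norm x) ^ 6)"
proof -
  obtain A :: "real ^ 'n ^ 'n" where p: "p = distr std_gaussian borel (\<lambda>z. m + A *v z)"
    using assms unfolding gaussian_law_def by blast
  define c where "c = 1 + norm m + onorm ((*v) A)"
  have D: "onorm ((*v) A) \<ge> 0" by (rule onorm_matrix_nonneg)
  have "integrable std_gaussian (\<lambda>z. (1 + norm (m + A *v z)) ^ 6)"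
  proof (rule Bochner_Integration.integrable_bound)
    show "integrable std_gaussian (\<lambda>z :: real ^ 'n. c ^ 6 * (1 + norm z) ^ 6)"
      by (intro integrable_mult_right integrable_std_gaussian_power6)
    show "AE z in std_gaussian. norm ((1 + norm (m + A *v z)) ^ 6) \<le> norm (c ^ 6 * (1 + norm z) ^
        6)"
    proof (intro AE_I2)
      fix z :: "real ^ 'n"
      have "1 + norm (m + A *v z) \<le> 1 + norm m + onorm ((*v) A) * norm z"
        using norm_triangle_ineq[of m "A *v z"] norm_matrix_le[of A z] by linarith
      also have "\<dots> \<le> c * (1 + norm z)"
        using D by (simp add: c_def algebra_simps)
      finally have "(1 + norm (m + A *v z)) ^ 6 \<le> (c * (1 + norm z)) ^ 6" by (rule power_mono) simp
      then show "norm ((1 + norm (m + A *v z)) ^ 6) \<le> norm (c ^ 6 * (1 + norm z) ^ 6)"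
        by (simp add: power_mult_distrib)
    qed
  qed measurable
  then show ?thesis unfolding p by (simp add: integrable_distr_eq)
qed

lemma gaussian_law_prior2: "gaussian_law m S p \<Longrightarrow> prior2 p"
  by (erule gaussian_law_gauss_tilt) (simp add: prior2_affine_gauss_tilt mposdef_idm)

lemma gaussian_law_mean:
  fixes p :: "(real ^ 'n::finite) measure"
  assumes "gaussian_law m S p"
  shows "(\<integral>\<theta>. inner b \<theta> \<partial>p) = inner b m"
proof -
  obtain A :: "real ^ 'n ^ 'n" where p: "p = distr (gauss_tilt 0) borel (\<lambda>z. m + A *v z)"
    using gaussian_law_gauss_tilt[OF assms] by blast
  have P: "mposdef (idm + 0 :: real ^ 'n ^ 'n)" by (simp add: mposdef_idm)
  interpret g: prob_space "gauss_tilt 0 :: (real ^ 'n) measure" by (rule prob_space_gauss_tilt[OF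
      P])
  have "(\<integral>\<theta>. inner b \<theta> \<partial>p) = (\<integral>z. inner b m + inner (mtr A *v b) z \<partial>gauss_tilt 0)"
    unfolding p by (subst integral_distr) (auto simp: inner_add_right inner_mtr_left simp del:
        transpose_matrix_vector)
  also have "\<dots> = inner b m" using gauss_tilt_moments(1,2)[OF P, of "mtr A *v b"] by (simp add:
      g.prob_space)
  finally show ?thesis .
qed

section \<open>Gaussian weights and their modulus of continuity\<close>

definition gauss_weight :: "real ^ 'n ^ 'n \<Rightarrow> real ^ 'n \<Rightarrow> real ^ 'n::finite \<Rightarrow> real" where
  "gauss_weight F r x = exp (- inner (x - r) (F *v (x - r)) / 2)"

lemma gauss_weight_measurable [measurable]: "gauss_weight F r \<in> borel_measurable borel"
  unfolding gauss_weight_def by measurable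

lemma gauss_weight_bounds:
  assumes "\<And>x. inner x (F *v x) \<ge> 0"
  shows "0 < gauss_weight F r x" "gauss_weight F r x \<le> 1"
  using assms[of "x - r"] by (simp_all add: gauss_weight_def)

lemma abs_mult_gauss_weight_le:
  assumes "\<And>x. inner x (F *v x) \<ge> 0"
  shows "\<bar>c * gauss_weight F r x\<bar> \<le> \<bar>c\<bar>"
  using gauss_weight_bounds[OF assms, of r x] by (simp add: abs_mult mult_left_le)

text \<open>The increment of the exponent contains a squared distance. It is absorbed into the
  linear one for distances up to 1; beyond that, two weights in [0, 1] differ by at most 1
  anyway.\<close>

lemma gauss_weight_lipschitz:
  fixes F :: "real ^ 'n ^ 'n::finite"
  assumes sym: "mtr F = F" and psd: "\<And>x. inner x (F *v x) \<ge> 0"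
  shows "\<bar>gauss_weight F r x - gauss_weight F r y\<bar> \<le> (1 + onorm ((*v) F) * (1 + norm y + norm r))
      * dist x y"
proof -
  let ?D = "onorm ((*v) F)"
  have D: "?D \<ge> 0" by (rule onorm_matrix_nonneg)
  show ?thesis
  proof (cases "dist x y \<le> 1")
    case True
    let ?Q = "\<lambda>x. inner (x - r) (F *v (x - r))"
    have "\<bar>gauss_weight F r x - gauss_weight F r y\<bar> \<le> 1 * \<bar>- ?Q x / 2 - - ?Q y / 2\<bar>"
      unfolding gauss_weight_def by (rule exp_diff_bound) (use psd in simp_all)
    also have "\<dots> = \<bar>?Q x - ?Q y\<bar> / 2" by (simp add: abs_if)
    also have "\<dots> \<le> ?D * ((dist (x - r) (y - r))\<^sup>2 + 2 * norm (y - r) * dist (x - r) (y - r)) / 2"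
      by (intro divide_right_mono quadratic_form_diff_bound sym) simp
    also have "\<dots> = ?D * (dist x y * dist x y / 2 + norm (y - r) * dist x y)"
      by (simp add: dist_norm power2_eq_square field_simps)
    also have "\<dots> \<le> ?D * (1 * dist x y + (norm y + norm r) * dist x y)"
    proof (intro mult_left_mono add_mono mult_right_mono D)
      have "dist x y * dist x y \<le> 1 * dist x y" by (intro mult_right_mono True) simp
      then show "dist x y * dist x y / 2 \<le> 1 * dist x y" using zero_le_dist[of x y] by linarith
      show "norm (y - r) \<le> norm y + norm r" by (rule norm_triangle_ineq4)
    qed simp
    also have "\<dots> \<le> (1 + ?D * (1 + norm y + norm r)) * dist x y"
      by (simp add: algebra_simps)
    finally show ?thesis .
  next
    case False
    have "\<bar>gauss_weight F r x - gauss_weight F r y\<bar> \<le> 1"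
      using gauss_weight_bounds[OF psd, of r x] gauss_weight_bounds[OF psd, of r y] by linarith
    also have "1 \<le> (1 + ?D * (1 + norm y + norm r)) * 1" using D by simp
    also have "\<dots> \<le> (1 + ?D * (1 + norm y + norm r)) * dist x y"
      using False D by (intro mult_left_mono) auto
    finally show ?thesis .
  qed
qed

text \<open>The cube is quadratic growth of \<open>f\<close> times linear growth of the Lipschitz
  constant of the weight. The constants are uniform over reference points in a ball, as the
  reference point will vary with the prior.\<close>

lemma tame_gauss_weight_bound:
  fixes F :: "real ^ 'n ^ 'n::finite"
  assumes "tame f" and sym: "mtr F = F" and psd: "\<And>x. inner x (F *v x) \<ge> 0"
  obtains C K where "C \<ge> 0" "K \<ge> 0"
    "\<And>r x y. norm r \<le> R \<Longrightarrow> \<bar>f x * gauss_weight F r x - f y * gauss_weight F r y\<bar> \<le> C * (dist x y)\<^sup>2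
        + K * (1 + norm y) ^ 3 * dist x y"
proof -
  obtain C where C: "C \<ge> 0" "\<And>x y. \<bar>f x - f y\<bar> \<le> C * ((dist x y)\<^sup>2 + (1 + norm y) * dist x y)"
    using assms(1) unfolding tame_def by blast
  obtain B where B: "B \<ge> 0" "\<And>x. \<bar>f x\<bar> \<le> B * (1 + (norm x)\<^sup>2)" by (rule tame_growth[OF assms(1)])
      blast
  define D where "D = onorm ((*v) F)"
  have D: "D \<ge> 0" unfolding D_def by (rule onorm_matrix_nonneg)
  define K where "K = C + B * (1 + D * (1 + \<bar>R\<bar>))"
  show thesis
  proof (rule that[OF C(1)])
    show "K \<ge> 0" unfolding K_def using B C D by simp
    fix r x y :: "real ^ 'n" assume R: "norm r \<le> R"
    let ?w = "gauss_weight F r"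
    \<comment> \<open>This splitting evaluates \<open>f\<close> and the Lipschitz constant at
      \<open>y\<close> only, so no power of the norm of \<open>x\<close> appears; the increment of
      \<open>f\<close> meets a weight of at most 1.\<close>
    have "f x * ?w x - f y * ?w y = (f x - f y) * ?w x + f y * (?w x - ?w y)" by (simp add:
        algebra_simps)
    then have "\<bar>f x * ?w x - f y * ?w y\<bar> \<le> \<bar>f x - f y\<bar> * \<bar>?w x\<bar> + \<bar>f y\<bar> * \<bar>?w x - ?w y\<bar>"
      by (metis abs_mult abs_triangle_ineq)
    also have "\<bar>f x - f y\<bar> * \<bar>?w x\<bar> \<le> (C * ((dist x y)\<^sup>2 + (1 + norm y) * dist x y)) * 1"
      using gauss_weight_bounds[OF psd, of r x] by (intro mult_mono C(2)) (auto intro!: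
          mult_nonneg_nonneg C(1) add_nonneg_nonneg)
    also have "\<bar>f y\<bar> * \<bar>?w x - ?w y\<bar> \<le> (B * (1 + (norm y)\<^sup>2)) * ((1 + D * (1 + norm y + norm r)) *
        dist x y)"
      unfolding D_def by (intro mult_mono B(2) gauss_weight_lipschitz sym psd) (auto intro!:
          mult_nonneg_nonneg B(1) add_nonneg_nonneg)
    also have "\<dots> \<le> (B * (1 + norm y)\<^sup>2) * (((1 + D * (1 + \<bar>R\<bar>)) * (1 + norm y)) * dist x y)"
    proof (intro mult_mono mult_right_mono mult_left_mono B)
      show "1 + (norm y)\<^sup>2 \<le> (1 + norm y)\<^sup>2" by (simp add: power2_sum)
      have "D * (norm y + norm r) \<le> D * (norm y + \<bar>R\<bar> + \<bar>R\<bar> * norm y)"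
        using R D by (intro mult_left_mono) (auto intro!: add_increasing2 mult_nonneg_nonneg)
      moreover have "1 + D * (1 + norm y + norm r) = 1 + D + D * (norm y + norm r)"
        "(1 + D * (1 + \<bar>R\<bar>)) * (1 + norm y) = 1 + norm y + D + D * (norm y + \<bar>R\<bar> + \<bar>R\<bar> * norm y)"
        by (simp_all add: algebra_simps)
      ultimately show "1 + D * (1 + norm y + norm r) \<le> (1 + D * (1 + \<bar>R\<bar>)) * (1 + norm y)"
        using norm_ge_zero[of y] by linarith
    qed (auto intro!: mult_nonneg_nonneg B(1) D add_nonneg_nonneg)
    also have "C * ((dist x y)\<^sup>2 + (1 + norm y) * dist x y) * 1 \<le> C * (dist x y)\<^sup>2 + C * (1 + norm
        y) ^ 3 * dist x y"
    proof -
      have "(1 + norm y) ^ 1 \<le> (1 + norm y) ^ 3" by (rule power_increasing) auto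
      then have "C * ((1 + norm y) * dist x y) \<le> C * ((1 + norm y) ^ 3 * dist x y)"
        by (intro mult_left_mono mult_right_mono C(1)) auto
      then show ?thesis by (simp add: distrib_left mult.assoc)
    qed
    finally show "\<bar>f x * ?w x - f y * ?w y\<bar> \<le> C * (dist x y)\<^sup>2 + K * (1 + norm y) ^ 3 * dist x y"
      by (simp add: K_def algebra_simps power2_eq_square power3_eq_cube)
  qed
qed

lemma integrable_tame_gauss_weight:
  fixes F :: "real ^ 'n ^ 'n::finite"
  assumes "tame f" "prior2 q" "\<And>x. inner x (F *v x) \<ge> 0"
  shows "integrable q (\<lambda>x. f x * gauss_weight F r x)"
proof -
  have [measurable_cong]: "sets q = sets borel" using assms(2) by (simp add: prior2_def)
  note [measurable] = tame_measurable[OF assms(1)]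
  show ?thesis
  proof (rule Bochner_Integration.integrable_bound[OF tame_integrable[OF assms(1,2)]])
    show "AE x in q. norm (f x * gauss_weight F r x) \<le> norm (f x)"
      using abs_mult_gauss_weight_le[OF assms(3)] by simp
  qed measurable
qed

text \<open>Two moves: the prior changes to \<open>q\<close> with the reference point
  \<open>r k\<close> held, by couplings; then the reference point moves under the fixed
  \<open>q\<close>, by dominated convergence with bound |f|.\<close>

lemma tendsto_integral_tame_gauss_weight:
  fixes F :: "real ^ 'n ^ 'n::finite" and p :: "nat \<Rightarrow> (real ^ 'n) measure"
  assumes f: "tame f" and sym: "mtr F = F" and psd: "\<And>x. inner x (F *v x) \<ge> 0"
    and p: "\<And>k. prior2 (p k)" and q: "prior2 q" and q6: "integrable q (\<lambda>x. (1 + norm x) ^ 6)"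
    and W: "(\<lambda>k. wasserstein2 (p k) q) \<longlonglongrightarrow> 0" and r: "r \<longlonglongrightarrow> m"
  shows "(\<lambda>k. \<integral>x. f x * gauss_weight F (r k) x \<partial>p k) \<longlonglongrightarrow> (\<integral>x. f x * gauss_weight F m x \<partial>q)"
proof -
  have sets_q [measurable_cong]: "sets q = sets borel" using q by (simp add: prior2_def)
  note [measurable] = tame_measurable[OF f]
  obtain R where R: "\<And>k. norm (r k) \<le> R"
    using convergent_imp_Bseq[of r] r by (auto simp: convergent_def Bseq_def)
  obtain C K where CK: "C \<ge> 0" "K \<ge> 0"
    "\<And>r x y. norm r \<le> R \<Longrightarrow> \<bar>f x * gauss_weight F r x - f y * gauss_weight F r y\<bar> \<le> C * (dist x y)\<^sup>2
        + K * (1 + norm y) ^ 3 * dist x y"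
    by (rule tame_gauss_weight_bound[OF f sym psd, of R]) blast
  obtain \<gamma> d where d: "d \<longlonglongrightarrow> (0::real)" "\<And>k. d k > 0" and
    \<gamma>: "\<forall>\<^sub>F k in sequentially. \<gamma> k \<in> couplings (p k) q \<and> (\<integral>\<^sup>+(x, y). ennreal ((dist x y)\<^sup>2) \<partial>\<gamma> k)
        \<le> ennreal (d k)"
    by (rule wasserstein2_tendsto_0_couplings[OF W]) blast
  define E where "E = (\<integral>y. (K * (1 + norm y) ^ 3)\<^sup>2 \<partial>q)"
  have iE: "integrable q (\<lambda>y. (K * (1 + norm y) ^ 3)\<^sup>2)"
    using q6 by (simp add: power_mult_distrib power_mult[symmetric])
  have A: "\<forall>\<^sub>F k in sequentially. norm ((\<integral>x. f x * gauss_weight F (r k) x \<partial>p k) - (\<integral>x. f x *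
      gauss_weight F (r k) x \<partial>q))
      \<le> C * d k + sqrt (d k) / 2 * E + sqrt (d k) / 2"
    using \<gamma>
  proof eventually_elim
    case (elim k)
    show ?case
      unfolding E_def real_norm_def
      by (rule coupling_integral_diff_bound[OF conjunct1[OF elim] d(2) conjunct2[OF elim] _ _
          CK(3)[OF R] CK(1) _
            integrable_tame_gauss_weight[OF f p psd] integrable_tame_gauss_weight[OF f q psd] iE])
        (use CK(2) in auto)
  qed
  have B: "(\<lambda>k. C * d k + sqrt (d k) / 2 * E + sqrt (d k) / 2) \<longlonglongrightarrow> C * 0 + sqrt 0 / 2 * E + sqrt 0 /
      2"
    by (intro tendsto_add tendsto_mult tendsto_divide tendsto_const tendsto_real_sqrt d) auto
  have 1: "(\<lambda>k. (\<integral>x. f x * gauss_weight F (r k) x \<partial>p k) - (\<integral>x. f x * gauss_weight F (r k) x \<partial>q)) \<longlonglongrightarrow>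
      0"
    by (rule Lim_null_comparison[OF A]) (use B in simp)
  have 2: "(\<lambda>k. \<integral>x. f x * gauss_weight F (r k) x \<partial>q) \<longlonglongrightarrow> (\<integral>x. f x * gauss_weight F m x \<partial>q)"
  proof (rule integral_dominated_convergence)
    show "integrable q (\<lambda>x. \<bar>f x\<bar>)" using tame_integrable[OF f q] by simp
    show "AE x in q. norm (f x * gauss_weight F (r k) x) \<le> \<bar>f x\<bar>" for k
      using abs_mult_gauss_weight_le[OF psd] by simp
    show "AE x in q. (\<lambda>k. f x * gauss_weight F (r k) x) \<longlonglongrightarrow> f x * gauss_weight F m x"
      unfolding gauss_weight_def
      by (intro AE_I2 tendsto_intros r bounded_linear.tendsto[OF
          matrix_vector_mul_bounded_linear]) auto
  qed measurable
  from tendsto_add[OF 1 2] show ?thesis by simp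
qed

section \<open>Tilted priors along Wasserstein convergence\<close>

definition weighted_prior :: "real ^ 'n ^ 'n \<Rightarrow> real ^ 'n \<Rightarrow> (real ^ 'n::finite) measure \<Rightarrow> (real ^
    'n) measure" where
  "weighted_prior F r p = density p (\<lambda>\<theta>. ennreal (gauss_weight F r \<theta> / (\<integral>\<theta>'. gauss_weight F r \<theta>'
      \<partial>p)))"

lemma gauss_weight_normalizer_pos:
  fixes F :: "real ^ 'n ^ 'n::finite"
  assumes psd: "\<And>x. inner x (F *v x) \<ge> 0" and p: "prior2 p"
  shows "(\<integral>\<theta>. gauss_weight F r \<theta> \<partial>p) > 0"
proof -
  interpret prob_space p using p by (simp add: prior2_def)
  have i: "integrable p (gauss_weight F r)" using integrable_tame_gauss_weight[OF tame_const[of 1]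
      p psd] by simp
  have "(\<integral>\<theta>. 0 \<partial>p) < (\<integral>\<theta>. gauss_weight F r \<theta> \<partial>p)"
    using i gauss_weight_bounds(1)[OF psd] by (intro integral_less_AE_space) (auto simp:
        emeasure_space_1)
  then show ?thesis by simp
qed

lemma integral_weighted_prior:
  fixes F :: "real ^ 'n ^ 'n::finite"
  assumes psd: "\<And>x. inner x (F *v x) \<ge> 0" and p: "prior2 p" and f: "tame f"
  shows "(\<integral>\<theta>. f \<theta> \<partial>weighted_prior F r p) = (\<integral>\<theta>. f \<theta> * gauss_weight F r \<theta> \<partial>p) / (\<integral>\<theta>. gauss_weight F
      r \<theta> \<partial>p)"
proof -
  have [measurable_cong]: "sets p = sets borel" using p by (simp add: prior2_def)
  note [measurable] = tame_measurable[OF f]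
  show ?thesis
    unfolding weighted_prior_def
    by (subst integral_density)
      (auto simp: mult.commute divide_nonneg_pos gauss_weight_normalizer_pos[OF psd p]
          less_imp_le[OF gauss_weight_bounds(1)[OF psd]])
qed

lemma prior2_weighted_prior:
  fixes F :: "real ^ 'n ^ 'n::finite"
  assumes psd: "\<And>x. inner x (F *v x) \<ge> 0" and p: "prior2 p"
  shows "prior2 (weighted_prior F r p)"
proof -
  have sets_p [measurable_cong]: "sets p = sets borel" and i2: "integrable p (\<lambda>x. (norm x)\<^sup>2)"
      using p by (simp_all add: prior2_def)
  define N where "N = (\<integral>\<theta>. gauss_weight F r \<theta> \<partial>p)"
  have N: "N > 0" unfolding N_def by (rule gauss_weight_normalizer_pos[OF psd p])
  have w0: "gauss_weight F r x \<ge> 0" for x by (rule less_imp_le[OF gauss_weight_bounds(1)[OF psd]])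
  have i1: "integrable p (gauss_weight F r)" using integrable_tame_gauss_weight[OF tame_const[of
      1] p psd] by simp
  have "prob_space (weighted_prior F r p)"
  proof
    have "emeasure (weighted_prior F r p) (space (weighted_prior F r p)) = (\<integral>\<^sup>+x. ennreal
        (gauss_weight F r x / N) * indicator (space p) x \<partial>p)"
      unfolding weighted_prior_def N_def by (subst emeasure_density) auto
    also have "\<dots> = (\<integral>\<^sup>+x. ennreal (gauss_weight F r x / N) \<partial>p)" by (intro nn_integral_cong) simp
    also have "\<dots> = ennreal (\<integral>x. gauss_weight F r x / N \<partial>p)"
      using i1 w0 N by (intro nn_integral_eq_integral) auto
    also have "\<dots> = 1" using N by (simp add: N_def)
    finally show "emeasure (weighted_prior F r p) (space (weighted_prior F r p)) = 1" .
  qed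
  moreover have "integrable (weighted_prior F r p) (\<lambda>x. (norm x)\<^sup>2)"
  proof -
    have "integrable p (\<lambda>x. gauss_weight F r x / N * (norm x)\<^sup>2)"
    proof (rule Bochner_Integration.integrable_bound)
      show "integrable p (\<lambda>x. 1 / N * (norm x)\<^sup>2)" using i2 by simp
      show "AE x in p. norm (gauss_weight F r x / N * (norm x)\<^sup>2) \<le> norm (1 / N * (norm x)\<^sup>2)"
        using w0 N gauss_weight_bounds(2)[OF psd]
        by (intro AE_I2) (auto simp: abs_mult mult_left_le_one_le intro!: divide_right_mono)
    qed measurable
    then show ?thesis
      unfolding weighted_prior_def N_def[symmetric] using w0 N by (subst integrable_density) auto
  qed
  ultimately show ?thesis by (simp add: prior2_def weighted_prior_def sets_p)
qed

lemma tendsto_integral_weighted_prior: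
  fixes F :: "real ^ 'n ^ 'n::finite" and p :: "nat \<Rightarrow> (real ^ 'n) measure"
  assumes f: "tame f" and sym: "mtr F = F" and psd: "\<And>x. inner x (F *v x) \<ge> 0"
    and p: "\<And>k. prior2 (p k)" and q: "prior2 q" and q6: "integrable q (\<lambda>x. (1 + norm x) ^ 6)"
    and W: "(\<lambda>k. wasserstein2 (p k) q) \<longlonglongrightarrow> 0" and r: "r \<longlonglongrightarrow> m"
  shows "(\<lambda>k. \<integral>\<theta>. f \<theta> \<partial>weighted_prior F (r k) (p k)) \<longlonglongrightarrow> (\<integral>\<theta>. f \<theta> \<partial>weighted_prior F m q)"
proof -
  have "(\<lambda>k. \<integral>x. 1 * gauss_weight F (r k) x \<partial>p k) \<longlonglongrightarrow> (\<integral>x. 1 * gauss_weight F m x \<partial>q)"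
    by (rule tendsto_integral_tame_gauss_weight[OF tame_const sym psd p q q6 W r])
  then show ?thesis
    unfolding integral_weighted_prior[OF psd p f] integral_weighted_prior[OF psd q f]
    using gauss_weight_normalizer_pos[OF psd q, of m]
    by (intro tendsto_divide tendsto_integral_tame_gauss_weight[OF f sym psd p q q6 W r]) auto
qed

context gauss_family
begin

interpretation ref: prob_space ref by (rule prob_space_ref)

text \<open>For almost every observation the evidence is the integral of a test function, so it
  converges along the priors.\<close>

lemma AE_tame_lik_ratio: "AE y in ref. tame (lik_ratio y)"
proof -
  obtain C where C: "AE y in ref. \<forall>\<theta>. lik_ratio y \<theta> \<le> exp (C * (norm (s y))\<^sup>2)" by (rule
      lik_ratio_bound) blast
  then show ?thesis
  proof eventually_elim
    case (elim y)
    have "tame (\<lambda>\<theta>. inner (s y) \<theta> + (- 1 / 2) * inner \<theta> (G *v \<theta>))"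
      by (intro tame_add_scaled tame_inner tame_quadratic_form G_sym)
    then have "tame (\<lambda>\<theta>. exp (inner (s y) \<theta> + (- 1 / 2) * inner \<theta> (G *v \<theta>)))"
      by (rule tame_exp[where E = "exp (C * (norm (s y))\<^sup>2)"]) (use elim in \<open>simp add:
          lik_ratio_def\<close>)
    then show ?case unfolding lik_ratio_def[abs_def] by simp
  qed
qed

text \<open>Convergence is assumed only against \<open>tame\<close> functions, so the statement
  applies to tilted priors, for which no Wasserstein distance has been estimated.\<close>

lemma info_gain_tendsto:
  assumes q: "\<And>k. prior2 (q k)" "prior2 q'"
    and conv: "\<And>f. tame f \<Longrightarrow> (\<lambda>k. integral\<^sup>L (q k) f) \<longlonglongrightarrow> integral\<^sup>L q' f"
  shows "(\<lambda>k. info_gain M L (q k)) \<longlonglongrightarrow> info_gain M L q'"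
proof -
  have pq: "prob_space (q k)" "sets (q k) = sets borel" for k using q(1)[of k] by (simp_all add:
      prior2_def)
  have pq': "prob_space q'" "sets q' = sets borel" using q(2) by (simp_all add: prior2_def)
  note [measurable] = evid_measurable[OF pq] evid_measurable[OF pq']
  have tame_norm: "tame (\<lambda>\<theta> :: real ^ 'n. (norm \<theta>)\<^sup>2)"
    using tame_quadratic_form[of idm] by (simp add: power2_norm_eq_inner)
  have GG: "(norm (G *v \<theta>))\<^sup>2 = inner \<theta> ((mtr G ** G) *v \<theta>)" for \<theta>
    by (simp only: matrix_vector_mul_assoc[symmetric] inner_mtr_right power2_norm_eq_inner)
  have tame_G: "tame (\<lambda>\<theta>. (norm (G *v \<theta>))\<^sup>2)"
    unfolding GG by (rule tame_quadratic_form) (simp add: matrix_transpose_mul mtr_mtr)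
  have "Bseq (\<lambda>k. \<integral>\<theta>. (norm \<theta>)\<^sup>2 \<partial>q k)"
    using conv[OF tame_norm] by (intro convergent_imp_Bseq) (auto simp: convergent_def)
  then obtain m1 where m1: "\<And>k. norm (\<integral>\<theta>. (norm \<theta>)\<^sup>2 \<partial>q k) \<le> m1"
    unfolding Bseq_def by blast
  define m where "m = max m1 (\<integral>\<theta>. (norm \<theta>)\<^sup>2 \<partial>q')"
  have m: "(\<integral>\<theta>. (norm \<theta>)\<^sup>2 \<partial>q k) \<le> m" "(\<integral>\<theta>. (norm \<theta>)\<^sup>2 \<partial>q') \<le> m" for k
    using m1[of k] by (auto simp: m_def)
  obtain C0 where C0: "C0 \<ge> 0" "\<And>q m. prior2 q \<Longrightarrow> (\<integral>\<theta>. (norm \<theta>)\<^sup>2 \<partial>q) \<le> m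
      \<Longrightarrow> AE y in ref. \<bar>ln (evid q y)\<bar> \<le> C0 * (1 + m) * (1 + (norm (s y))\<^sup>2)"
    by (rule AE_ln_evid_bound) blast
  \<comment> \<open>The dominating functions vary with the prior, but by \<open>norm_s_joint\<close>
    their integrals are affine in the integral of a \<open>tame\<close> function and hence
    converge.\<close>
  define g where "g q y = evid q y * (C0 * (1 + m) * (1 + (norm (s y))\<^sup>2))" for q y
  have ig: "integrable ref (g p)"
    and int_g: "integral\<^sup>L ref (g p) = C0 * (1 + m) * (1 + ((\<Sum>b\<in>Basis. inner b (G *v b)) + (\<integral>\<theta>.
        (norm (G *v \<theta>))\<^sup>2 \<partial>p)))"
    if p: "prior2 p" for p
  proof -
    have pp: "prob_space p" "sets p = sets borel" using p by (simp_all add: prior2_def)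
    interpret j: prob_space "joint p" by (rule prob_space_joint[OF pp])
    have i: "integrable (joint p) (\<lambda>x. C0 * (1 + m) * (1 + (norm (s (snd x)))\<^sup>2))"
      using norm_s_joint(1)[OF p] by simp
    show "integrable ref (g p)"
      unfolding g_def by (rule integral_joint_snd(1)[OF pp i]) measurable
    have "integral\<^sup>L ref (g p) = (\<integral>x. C0 * (1 + m) * (1 + (norm (s (snd x)))\<^sup>2) \<partial>joint p)"
      unfolding g_def by (rule integral_joint_snd(2)[OF pp i, symmetric]) measurable
    also have "\<dots> = C0 * (1 + m) * (1 + (\<integral>x. (norm (s (snd x)))\<^sup>2 \<partial>joint p))"
      using norm_s_joint(1)[OF p] by (simp add: j.prob_space)
    finally show "integral\<^sup>L ref (g p) = C0 * (1 + m) * (1 + ((\<Sum>b\<in>Basis. inner b (G *v b)) + (\<integral>\<theta>.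
        (norm (G *v \<theta>))\<^sup>2 \<partial>p)))"
      unfolding norm_s_joint(2)[OF p] .
  qed
  have evid_lim: "AE y in ref. (\<lambda>k. evid (q k) y) \<longlonglongrightarrow> evid q' y"
    using AE_tame_lik_ratio by eventually_elim (simp add: evid_def conv)
  have "(\<lambda>k. \<integral>y. evid (q k) y * ln (evid (q k) y) \<partial>ref) \<longlonglongrightarrow> (\<integral>y. evid q' y * ln (evid q' y) \<partial>ref)"
  proof (rule integral_tendsto_dominated_varying[where g = "\<lambda>k. g (q k)" and g' = "g q'"])
    show "integrable ref (g (q k))" "integrable ref (g q')" for k by (intro ig q)+
    show "AE y in ref. \<bar>evid (q k) y * ln (evid (q k) y)\<bar> \<le> g (q k) y" for k
      using C0(2)[OF q(1) m(1), of k] AE_integrable_lik_ratio[OF pq, of k]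
      by eventually_elim (auto simp: g_def abs_mult intro!: mult_left_mono)
    show "AE y in ref. (\<lambda>k. evid (q k) y * ln (evid (q k) y)) \<longlonglongrightarrow> evid q' y * ln (evid q' y)"
      using evid_lim AE_integrable_lik_ratio[OF pq'] by eventually_elim (intro tendsto_intros, auto)
    show "AE y in ref. (\<lambda>k. g (q k) y) \<longlonglongrightarrow> g q' y"
      using evid_lim unfolding g_def by eventually_elim (intro tendsto_intros)
    show "(\<lambda>k. integral\<^sup>L ref (g (q k))) \<longlonglongrightarrow> integral\<^sup>L ref (g q')"
      unfolding int_g[OF q(1)] int_g[OF q(2)] by (intro tendsto_intros conv tame_G)
  qed measurable
  moreover have "(\<lambda>k. (\<integral>\<theta>. inner \<theta> (G *v \<theta>) \<partial>q k) / 2) \<longlonglongrightarrow> (\<integral>\<theta>. inner \<theta> (G *v \<theta>) \<partial>q') / 2"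
    by (intro tendsto_intros conv tame_quadratic_form G_sym) simp
  moreover have "info_gain M L p = (\<integral>\<theta>. inner \<theta> (G *v \<theta>) \<partial>p) / 2 - (\<integral>y. evid p y * ln (evid p y)
      \<partial>ref)"
    if p: "prior2 p" for p
  proof -
    have pp: "prob_space p" "sets p = sets borel" using p by (simp_all add: prior2_def)
    show ?thesis
      unfolding info_gain_eq[OF p]
      by (subst integral_joint_snd(2)[OF pp integrable_ln_evid[OF p]])
        (use evid_measurable[OF pp] in auto)
  qed
  ultimately show ?thesis
    using q by (simp add: tendsto_diff)
qed

end

section \<open>Designs\<close>

lemma finite_active: "finite (active D i)"
  by (simp add: active_def)

lemma product_sigma_finite_PiM_lborel:
  fixes m :: "'i \<Rightarrow> nat"
  shows "product_sigma_finite (\<lambda>d. PiM {..<m d} (\<lambda>_. lborel :: real measure))"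
  unfolding product_sigma_finite_def by (simp add: sigma_finite_PiM_lborel)

lemma product_sigma_finite_block_measure: "product_sigma_finite (block_measure D)"
proof -
  have "sigma_finite_measure (block_measure D i)" for i
  proof -
    interpret product_sigma_finite "\<lambda>d. PiM {..<obs_dim D i d} (\<lambda>_. lborel :: real measure)"
      by (rule product_sigma_finite_PiM_lborel)
    interpret finite_product_sigma_finite "\<lambda>d. PiM {..<obs_dim D i d} (\<lambda>_. lborel :: real
        measure)" "active D i"
      by unfold_locales (rule finite_active)
    show ?thesis unfolding block_measure_def by (rule sigma_finite_measure_axioms)
  qed
  then show ?thesis by (simp add: product_sigma_finite_def)
qed

definition stage_info :: "'n::finite design \<Rightarrow> nat \<Rightarrow> real ^ 'n ^ 'n" where
  "stage_info D i = (\<Sum>d\<in>active D i. sensor_info D i d)"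

lemma gauss_family_block:
  fixes D :: "'n::finite design"
  assumes "valid_design D" "i \<in> {1..stages D}"
  shows "\<exists>h s. gauss_family (block_measure D i) (lik D i) h s (stage_info D i)"
proof -
  have pd: "pos_def_mat (obs_dim D i d) (noise_cov D i d)" if "d \<in> active D i" for d
    using assms that unfolding valid_design_def active_def by auto
  let ?h = "\<lambda>d x. normal_pdf (obs_dim D i d) (offset D i d) (noise_cov D i d) x"
  let ?s = "\<lambda>d x. \<Sum>j<obs_dim D i d. \<Sum>k<obs_dim D i d.
    (mat_inv (noise_cov D i d) $$ (j, k) * (x k - offset D i d k)) *\<^sub>R obs_row D i d j"
  have sensor: "gauss_family (PiM {..<obs_dim D i d} (\<lambda>_. lborel))
      (\<lambda>x \<theta>. normal_pdf (obs_dim D i d) (obs_mean D i d \<theta>) (noise_cov D i d) x)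
      (?h d) (?s d) (sensor_info D i d)" if "d \<in> active D i" for d
    using gauss_family_sensor[OF pd[OF that], of "obs_row D i d" "offset D i d"]
    unfolding obs_mean_def[abs_def] sensor_info_def .
  have "gauss_family (block_measure D i) (lik D i)
      (\<lambda>y. \<Prod>d\<in>active D i. ?h d (y d)) (\<lambda>y. \<Sum>d\<in>active D i. ?s d (y d)) (stage_info D i)"
    unfolding block_measure_def stage_info_def lik_def[abs_def]
    by (rule gauss_family_PiM[OF product_sigma_finite_PiM_lborel finite_active sensor])
  then show ?thesis by blast
qed

lemma gauss_family_full:
  fixes D :: "'n::finite design"
  assumes "valid_design D"
  shows "\<exists>h s. gauss_family (obs_measure D) (full_lik D) h s (\<Sum>i = 1..stages D. stage_info D i)"
proof -
  have "\<forall>i\<in>{1..stages D}. \<exists>h s. gauss_family (block_measure D i) (lik D i) h s (stage_info D i)"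
    using gauss_family_block[OF assms] by blast
  then obtain h s where "\<And>i. i \<in> {1..stages D} \<Longrightarrow> gauss_family (block_measure D i) (lik D i) (h i)
      (s i) (stage_info D i)"
    by metis
  note fam = gauss_family_PiM[OF product_sigma_finite_block_measure _ this]
  show ?thesis
    using fam unfolding obs_measure_def full_lik_def[abs_def] by blast
qed

lemma fisher_eq_sum:
  "fisher D k = (\<Sum>i = 1..k. \<Sum>d = 1..sensors D. weight D i d *\<^sub>R sensor_info D i d)"
  by (induction k) simp_all

lemma weighted_sensor_info_eq_stage_info:
  assumes "valid_design D" "i \<in> {1..stages D}"
  shows "(\<Sum>d = 1..sensors D. weight D i d *\<^sub>R sensor_info D i d) = stage_info D i"
proof -
  have w: "weight D i d \<in> {0, 1}" if "d \<in> {1..sensors D}" for d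
    using assms that unfolding valid_design_def by blast
  have "(\<Sum>d = 1..sensors D. weight D i d *\<^sub>R sensor_info D i d)
      = (\<Sum>d = 1..sensors D. if weight D i d = 1 then sensor_info D i d else 0)"
    by (intro sum.cong refl) (use w in force)
  also have "\<dots> = stage_info D i"
    unfolding stage_info_def active_def by (rule sum.inter_filter[symmetric]) simp
  finally show ?thesis .
qed

lemma fisher_eq_sum_stage_info:
  assumes "valid_design D" "k \<le> stages D"
  shows "fisher D k = (\<Sum>i = 1..k. stage_info D i)"
  unfolding fisher_eq_sum
  by (intro sum.cong refl weighted_sensor_info_eq_stage_info) (use assms in auto)

lemma fisher_step:
  assumes "valid_design D" "i \<in> {1..stages D}"
  shows "fisher D i = fisher D (i - 1) + stage_info D i"
proof -
  obtain j where "i = Suc j" using assms(2) by (cases i) auto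
  then show ?thesis using weighted_sensor_info_eq_stage_info[OF assms] by simp
qed

text \<open>Inherited from the stages, where \<open>G_psd\<close> reads semidefiniteness off a
  covariance.\<close>

lemma fisher_sym_psd:
  fixes D :: "'n::finite design"
  assumes "valid_design D" "k \<le> stages D"
  shows "mtr (fisher D k) = fisher D k" "inner x (fisher D k *v x) \<ge> 0"
proof -
  have s: "mtr (stage_info D i) = stage_info D i" "inner x (stage_info D i *v x) \<ge> 0" if i: "i \<in>
      {1..k}" for i
  proof -
    obtain h s where "gauss_family (block_measure D i) (lik D i) h s (stage_info D i)"
      using gauss_family_block[OF assms(1), of i] i assms(2) by auto
    then interpret gauss_family "block_measure D i" "lik D i" h s "stage_info D i" .
    show "mtr (stage_info D i) = stage_info D i" "inner x (stage_info D i *v x) \<ge> 0"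
      by (rule G_sym G_psd)+
  qed
  show "inner x (fisher D k *v x) \<ge> 0"
    unfolding fisher_eq_sum_stage_info[OF assms] inner_sum_matrix_vector_mult by (intro sum_nonneg
        s)
  have "mtr (\<Sum>i = 1..k. stage_info D i) = (\<Sum>i = 1..k. mtr (stage_info D i))"
    by (simp add: mtr_def cart_eq_iff)
  then show "mtr (fisher D k) = fisher D k"
    unfolding fisher_eq_sum_stage_info[OF assms] using s(1) by simp
qed

lemma tilted_eq_weighted_prior: "tilted D r p i = weighted_prior (fisher D i) r p"
  unfolding tilted_def weighted_prior_def tilt_weight_def gauss_weight_def ..

text \<open>A weight centred at the mean depends on A z alone. Pulled back to \<open>z\<close> it is
  a quadratic form without linear term, so the tilted law is again an affine image of a centred
  Gaussian. This is where the choice of reference point enters.\<close>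

lemma weighted_prior_gaussian:
  fixes F A :: "real ^ 'n ^ 'n::finite"
  assumes sym: "mtr F = F" and psd: "\<And>x. inner x (F *v x) \<ge> 0"
  defines "T \<equiv> mtr A ** F ** A"
  shows "mposdef (idm + T)"
    "weighted_prior F m (distr (gauss_tilt 0) borel (\<lambda>z. m + A *v z)) = distr (gauss_tilt T) borel
        (\<lambda>z. m + A *v z)"
proof -
  show P: "mposdef (idm + T)"
    unfolding T_def by (intro mposdef_add mposdef_idm mtr_congruence sym) (simp add:
        inner_congruence psd)
  have d: "vdet (idm + T) > 0" by (rule nn_integral_gaussian_vec(1)[OF P])
  have [measurable]: "(\<lambda>z. m + A *v z) \<in> borel_measurable (gauss_tilt 0)" by measurable
  have w: "gauss_weight F m (m + A *v z) = exp (- inner z (T *v z) / 2)" for z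
    by (simp add: gauss_weight_def T_def inner_congruence)
  have N: "(\<integral>\<theta>. gauss_weight F m \<theta> \<partial>distr (gauss_tilt 0) borel (\<lambda>z. m + A *v z)) = 1 / sqrt (vdet
      (idm + T))"
  proof -
    have "(\<integral>\<theta>. gauss_weight F m \<theta> \<partial>distr (gauss_tilt 0) borel (\<lambda>z. m + A *v z)) = (\<integral>z. exp (-
        inner z (T *v z) / 2) \<partial>gauss_tilt 0)"
      by (subst integral_distr) (auto simp: w)
    also have "\<dots> = enn2real (\<integral>\<^sup>+z. ennreal (exp (- inner z (T *v z) / 2)) \<partial>gauss_tilt 0)"
      by (rule integral_eq_nn_integral) auto
    also have "(\<integral>\<^sup>+z. ennreal (exp (- inner z (T *v z) / 2)) \<partial>gauss_tilt 0) = ennreal (1 / sqrt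
        (vdet (idm + T)))"
      using nn_integral_std_gaussian_exp_quadratic[OF P, of 0] by (simp add:
          std_gaussian_eq_gauss_tilt)
    finally show ?thesis using d by simp
  qed
  have "weighted_prior F m (distr (gauss_tilt 0) borel (\<lambda>z. m + A *v z))
      = distr (density (gauss_tilt 0) (\<lambda>z. ennreal (gauss_weight F m (m + A *v z) / (1 / sqrt
          (vdet (idm + T)))))) borel (\<lambda>z. m + A *v z)"
    unfolding weighted_prior_def N by (rule density_distr) measurable
  also have "density (gauss_tilt 0) (\<lambda>z. ennreal (gauss_weight F m (m + A *v z) / (1 / sqrt (vdet
      (idm + T))))) = gauss_tilt T"
    unfolding w gauss_tilt_def[of T] std_gaussian_eq_gauss_tilt by (simp add: mult.commute)
  finally show "weighted_prior F m (distr (gauss_tilt 0) borel (\<lambda>z. m + A *v z)) = distr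
      (gauss_tilt T) borel (\<lambda>z. m + A *v z)" .
qed

lemma prior2_integrable_id:
  fixes p :: "(real ^ 'n::finite) measure"
  assumes "prior2 p"
  shows "integrable p (\<lambda>\<theta>. \<theta>)"
proof -
  have [measurable_cong]: "sets p = sets borel" and i: "integrable p (\<lambda>\<theta>. (norm \<theta>)\<^sup>2)" and
      "prob_space p"
    using assms by (auto simp: prior2_def)
  interpret prob_space p by fact
  show ?thesis
  proof (rule Bochner_Integration.integrable_bound)
    show "integrable p (\<lambda>\<theta>. 1 + (norm \<theta>)\<^sup>2)" using i by simp
    show "AE \<theta> in p. norm \<theta> \<le> norm (1 + (norm \<theta>)\<^sup>2)"
    proof (intro AE_I2)
      fix \<theta> :: "real ^ 'n"
      have "0 \<le> (norm \<theta> - 1)\<^sup>2 + (norm \<theta>)\<^sup>2 + 1" by simp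
      then show "norm \<theta> \<le> norm (1 + (norm \<theta>)\<^sup>2)" by (simp add: power2_diff)
    qed
  qed measurable
qed

text \<open>With zero information the weight is constantly 1, so the convergence rule for weighted
  integrals specialises to plain coordinates.\<close>

lemma tendsto_mean:
  fixes p :: "nat \<Rightarrow> (real ^ 'n::finite) measure"
  assumes p: "\<And>k. prior2 (p k)" and q: "gaussian_law m S q"
    and W: "(\<lambda>k. wasserstein2 (p k) q) \<longlonglongrightarrow> 0"
  shows "(\<lambda>k. \<integral>\<theta>. \<theta> \<partial>p k) \<longlonglongrightarrow> m"
proof (rule vec_tendstoI)
  fix i
  have w: "gauss_weight 0 0 = (\<lambda>x :: real ^ 'n. 1)" by (simp add: gauss_weight_def fun_eq_iff)
  have "(\<lambda>k. \<integral>\<theta>. inner (axis i 1) \<theta> * gauss_weight 0 0 \<theta> \<partial>p k) \<longlonglongrightarrow> (\<integral>\<theta>. inner (axis i 1) \<theta> *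
      gauss_weight 0 0 \<theta> \<partial>q)"
    by (rule tendsto_integral_tame_gauss_weight[OF tame_inner _ _ p gaussian_law_prior2[OF q]
        integrable_gaussian_law_power6[OF q] W tendsto_const])
      (simp_all add: mtr_def cart_eq_iff)
  moreover have "(\<integral>\<theta>. inner (axis i 1) \<theta> \<partial>p k) = vec_nth (\<integral>\<theta>. \<theta> \<partial>p k) i" for k
    using integral_inner_right[of "axis i 1" "p k" "\<lambda>\<theta>. \<theta>"] prior2_integrable_id[OF p] by (simp
        add: inner_axis')
  moreover have "(\<integral>\<theta>. inner (axis i 1) \<theta> \<partial>q) = vec_nth m i"
    unfolding gaussian_law_mean[OF q] by (simp add: inner_axis')
  ultimately show "(\<lambda>k. vec_nth (\<integral>\<theta>. \<theta> \<partial>p k) i) \<longlonglongrightarrow> vec_nth m i"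
    by (simp add: w)
qed

lemma J_EIG_gaussian:
  fixes D :: "'n::finite design"
  assumes "valid_design D" "gaussian_law m0 S0 p0"
  shows "J_EIG D p0 = 1 / 2 * ln (vdet (idm + S0 ** fisher D (stages D)))"
proof -
  obtain A :: "real ^ 'n ^ 'n" where A: "A ** mtr A = S0" and p0: "p0 = distr (gauss_tilt 0) borel
      (\<lambda>z. m0 + A *v z)"
    by (rule gaussian_law_gauss_tilt[OF assms(2)])
  obtain h s where "gauss_family (obs_measure D) (full_lik D) h s (\<Sum>i = 1..stages D. stage_info D
      i)"
    using gauss_family_full[OF assms(1)] by blast
  then interpret gauss_family "obs_measure D" "full_lik D" h s "fisher D (stages D)"
    by (simp add: fisher_eq_sum_stage_info[OF assms(1)])
  have "J_EIG D p0 = ln (vdet (idm + (mtr A ** fisher D (stages D)) ** A)) / 2"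
    unfolding J_EIG_def p0 using info_gain_gaussian[of 0 m0 A] by (simp add: mposdef_idm)
  also have "vdet (idm + (mtr A ** fisher D (stages D)) ** A) = vdet (idm + S0 ** fisher D (stages
      D))"
    \<comment> \<open>Moving \<open>A\<close> around the product replaces A^T F A by A A^T F, which
      depends on the covariance alone and not on the factor chosen.\<close>
    unfolding A[symmetric] by (subst vdet_idm_add_mult_commute) (simp add: matrix_mul_assoc)
  finally show ?thesis by simp
qed

lemma J_tilt_gaussian:
  fixes D :: "'n::finite design"
  assumes "valid_design D" "gaussian_law m0 S0 p0"
  shows "J_tilt D m0 p0 = 1 / 2 * ln (vdet (idm + S0 ** fisher D (stages D)))"
proof -
  obtain A :: "real ^ 'n ^ 'n" where A: "A ** mtr A = S0" and p0: "p0 = distr (gauss_tilt 0) borel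
      (\<lambda>z. m0 + A *v z)"
    by (rule gaussian_law_gauss_tilt[OF assms(2)])
  define T where "T i = mtr A ** fisher D i ** A" for i
  define a where "a i = ln (vdet (idm + T i)) / 2" for i
  have pd: "mposdef (idm + T i)" if "i \<le> stages D" for i
    unfolding T_def by (rule weighted_prior_gaussian(1)[OF fisher_sym_psd[OF assms(1) that]])
  have step: "info_gain (block_measure D i) (lik D i) (tilted D m0 p0 (i - 1)) = a i - a (i - 1)"
    if i: "i \<in> {1..stages D}" for i
  proof -
    obtain h s where "gauss_family (block_measure D i) (lik D i) h s (stage_info D i)"
      using gauss_family_block[OF assms(1) i] by blast
    then interpret gauss_family "block_measure D i" "lik D i" h s "stage_info D i" .
    have i': "i - 1 \<le> stages D" "i \<le> stages D" using i by auto
    have t: "tilted D m0 p0 (i - 1) = distr (gauss_tilt (T (i - 1))) borel (\<lambda>z. m0 + A *v z)"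
      unfolding tilted_eq_weighted_prior p0 T_def by (rule weighted_prior_gaussian(2)[OF
          fisher_sym_psd[OF assms(1) i'(1)]])
    \<comment> \<open>Stage \<open>i\<close> meets the prior tilted with
      \<open>fisher D (i - 1)\<close>; its own information completes \<open>fisher D i\<close>, so
      the numerator of one stage is the denominator of the next.\<close>
    have T: "idm + T (i - 1) + mtr A ** stage_info D i ** A = idm + T i"
      unfolding T_def fisher_step[OF assms(1) i]
      by (simp add: matrix_add_ldistrib matrix_add_rdistrib add.assoc)
    show ?thesis
      unfolding t info_gain_gaussian[OF pd[OF i'(1)]] T a_def
      using nn_integral_gaussian_vec(1)[OF pd[OF i'(1)]] nn_integral_gaussian_vec(1)[OF pd[OF
          i'(2)]]
      by (simp add: ln_div diff_divide_distrib)
  qed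
  have "J_tilt D m0 p0 = (\<Sum>i = 1..stages D. a i - a (i - 1))"
    unfolding J_tilt_def by (rule sum.cong[OF refl step])
  also have "\<dots> = a (stages D) - a 0"
  proof -
    have "(\<Sum>i = 1..n. a i - a (i - 1)) = a n - a 0" for n by (induction n) simp_all
    then show ?thesis .
  qed
  also have "a 0 = 0" by (simp add: a_def T_def)
  also have "vdet (idm + T (stages D)) = vdet (idm + S0 ** fisher D (stages D))"
    unfolding A[symmetric] T_def by (subst vdet_idm_add_mult_commute) (simp add: matrix_mul_assoc)
  then have "a (stages D) - 0 = 1 / 2 * ln (vdet (idm + S0 ** fisher D (stages D)))"
    by (simp add: a_def)
  finally show ?thesis .
qed

lemma J_tilt_tendsto:
  fixes D :: "'n::finite design" and p :: "nat \<Rightarrow> (real ^ 'n) measure"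
  assumes D: "valid_design D" and p0: "gaussian_law m0 S0 p0" and p: "\<And>k. prior2 (p k)"
    and W: "(\<lambda>k. wasserstein2 (p k) p0) \<longlonglongrightarrow> 0"
  shows "(\<lambda>k. J_tilt D (\<integral>\<theta>. \<theta> \<partial>p k) (p k)) \<longlonglongrightarrow> J_tilt D m0 p0"
  unfolding J_tilt_def tilted_eq_weighted_prior
proof (rule tendsto_sum)
  fix i assume i: "i \<in> {1..stages D}"
  obtain h s where "gauss_family (block_measure D i) (lik D i) h s (stage_info D i)"
    using gauss_family_block[OF D i] by blast
  then interpret gauss_family "block_measure D i" "lik D i" h s "stage_info D i" .
  have "i - 1 \<le> stages D" using i by auto
  note F = fisher_sym_psd[OF D this]
  note q = gaussian_law_prior2[OF p0]
  show "(\<lambda>k. info_gain (block_measure D i) (lik D i) (weighted_prior (fisher D (i - 1)) (\<integral>\<theta>. \<theta> \<partial>p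
      k) (p k)))
    \<longlonglongrightarrow> info_gain (block_measure D i) (lik D i) (weighted_prior (fisher D (i - 1)) m0 p0)"
    by (rule info_gain_tendsto[OF prior2_weighted_prior[OF F(2) p] prior2_weighted_prior[OF F(2) q]
          tendsto_integral_weighted_prior[OF _ F p q integrable_gaussian_law_power6[OF p0] W
              tendsto_mean[OF p p0 W]]])
qed

theorem proposition2:
  fixes D :: "'n::finite design"
    and m0 :: "real ^ 'n" and S0 :: "real ^ 'n ^ 'n" and p0 :: "(real ^ 'n) measure"
  assumes "valid_design D"
    and "gaussian_law m0 S0 p0"
  shows "(J_tilt D m0 p0 = J_EIG D p0 \<and>
          J_EIG D p0 = 1 / 2 * ln (Determinants.det (Finite_Cartesian_Product.mat 1 + S0 ** fisher D (stages D))) \<and>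
          fisher D (stages D) =
            (\<Sum>i = 1..stages D. \<Sum>d = 1..sensors D. weight D i d *\<^sub>R sensor_info D i d)) \<and>
         (\<forall>p :: nat \<Rightarrow> (real ^ 'n) measure.
            (\<forall>k\<ge>1. prior2 (p k)) \<longrightarrow>
            (\<lambda>k. wasserstein2 (p k) p0) \<longlonglongrightarrow> 0 \<longrightarrow>
            (\<lambda>k. J_tilt D (\<integral>\<theta>. \<theta> \<partial>p k) (p k)) \<longlonglongrightarrow> J_EIG D p0)"
proof (intro conjI allI impI)
  show eq: "J_tilt D m0 p0 = J_EIG D p0"
    by (simp only: J_tilt_gaussian[OF assms] J_EIG_gaussian[OF assms])
  show "J_EIG D p0 = 1 / 2 * ln (vdet (idm + S0 ** fisher D (stages D)))"
    by (rule J_EIG_gaussian[OF assms])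
  show "fisher D (stages D) = (\<Sum>i = 1..stages D. \<Sum>d = 1..sensors D. weight D i d *\<^sub>R sensor_info D i d)"
    by (rule fisher_eq_sum)
  fix p :: "nat \<Rightarrow> (real ^ 'n) measure"
  assume p: "\<forall>k\<ge>1. prior2 (p k)" and W: "(\<lambda>k. wasserstein2 (p k) p0) \<longlonglongrightarrow> 0"
  \<comment> \<open>Nothing is known about \<open>p 0\<close>, so the sequence is shifted by one
    before the limit is taken.\<close>
  have "(\<lambda>k. J_tilt D (\<integral>\<theta>. \<theta> \<partial>p (Suc k)) (p (Suc k))) \<longlonglongrightarrow> J_tilt D m0 p0"
    using p by (intro J_tilt_tendsto[OF assms] LIMSEQ_Suc[OF W]) auto
  then show "(\<lambda>k. J_tilt D (\<integral>\<theta>. \<theta> \<partial>p k) (p k)) \<longlonglongrightarrow> J_EIG D p0"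
    unfolding eq by (rule LIMSEQ_imp_Suc)
qed

end
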